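(* Let $T$ be a tree with at least three vertices such that $n_2(T)\leq n_1(T)$. If $|E(T)|\leq 2(n_1(T)+1)$, then $\chi'_{es}(T)=\chi'_s(T)$.
   Context: All graphs are finite and simple. A proper edge $k$-coloring of a graph $G$ is a vertex distinguishing edge $k$-coloring (vdec) if for any two distinct vertices $u,v$ the set of colors on edges incident to $u$ differs from that of $v$. $\chi'_s(G)$ is the minimum $k$ such that $G$ has a $k$-vdec. A $k$-vdec $\pi$ is equitable if the color classes $S_i=\{e:\pi(e)=i\}$, $i\in[1,k]$, pairwise differ in size by at most one; $\chi'_{es}(G)$ is the minimum $k$ such that $G$ has an equitable $k$-vdec. $n_d(G)$ is the number of vertices of degree $d$. *)

theory Defs
  imports "HOL-Library.Ramsey"
begin

text \<open>
  A finite simple graph is given by a vertex set \<open>V\<close> and an edge set \<open>E\<close> of two-element subsets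
  of \<open>V\<close>; \<open>[V]\<^bsup>2\<^esup>\<close> is the set of all two-element subsets.
\<close>

definition simple_graph :: "'a set \<Rightarrow> 'a set set \<Rightarrow> bool" where
  "simple_graph V E \<longleftrightarrow> finite V \<and> E \<subseteq> [V]\<^bsup>2\<^esup>"

definition incident_edges :: "'a set set \<Rightarrow> 'a \<Rightarrow> 'a set set" where
  "incident_edges E v = {e \<in> E. v \<in> e}"

definition degree :: "'a set set \<Rightarrow> 'a \<Rightarrow> nat" where
  "degree E v = card (incident_edges E v)"

definition num_deg :: "'a set \<Rightarrow> 'a set set \<Rightarrow> nat \<Rightarrow> nat" where
  "num_deg V E d = card {v \<in> V. degree E v = d}"

definition adj_rel :: "'a set set \<Rightarrow> ('a \<times> 'a) set" where
  "adj_rel E = {(u, v). {u, v} \<in> E}"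

definition connected_graph :: "'a set \<Rightarrow> 'a set set \<Rightarrow> bool" where
  "connected_graph V E \<longleftrightarrow> V \<noteq> {} \<and> (\<forall>u\<in>V. \<forall>v\<in>V. (u, v) \<in> (adj_rel E)\<^sup>*)"

text \<open>A cycle is listed by its distinct vertices, without repeating the first one at the end.\<close>

definition is_cycle :: "'a set set \<Rightarrow> 'a list \<Rightarrow> bool" where
  "is_cycle E c \<longleftrightarrow> 3 \<le> length c \<and> distinct c \<and>
     (\<forall>i < length c. {c ! i, c ! (Suc i mod length c)} \<in> E)"

definition is_tree :: "'a set \<Rightarrow> 'a set set \<Rightarrow> bool" where
  "is_tree V E \<longleftrightarrow> simple_graph V E \<and> connected_graph V E \<and> (\<nexists>c. is_cycle E c)"

text \<open>Colors are \<open>1, \<dots>, k\<close>; a coloring need not use all of them.\<close>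

definition proper_edge_coloring :: "'a set set \<Rightarrow> nat \<Rightarrow> ('a set \<Rightarrow> nat) \<Rightarrow> bool" where
  "proper_edge_coloring E k p \<longleftrightarrow> p \<in> E \<rightarrow> {1..k} \<and>
     (\<forall>e\<in>E. \<forall>f\<in>E. e \<noteq> f \<and> e \<inter> f \<noteq> {} \<longrightarrow> p e \<noteq> p f)"

definition color_set :: "'a set set \<Rightarrow> ('a set \<Rightarrow> nat) \<Rightarrow> 'a \<Rightarrow> nat set" where
  "color_set E p v = p ` incident_edges E v"

definition vdec :: "'a set \<Rightarrow> 'a set set \<Rightarrow> nat \<Rightarrow> ('a set \<Rightarrow> nat) \<Rightarrow> bool" where
  "vdec V E k p \<longleftrightarrow> proper_edge_coloring E k p \<and>
     (\<forall>u\<in>V. \<forall>v\<in>V. u \<noteq> v \<longrightarrow> color_set E p u \<noteq> color_set E p v)"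

definition color_class :: "'a set set \<Rightarrow> ('a set \<Rightarrow> nat) \<Rightarrow> nat \<Rightarrow> 'a set set" where
  "color_class E p i = {e \<in> E. p e = i}"

text \<open>As \<open>i\<close> and \<open>j\<close> range over all ordered pairs, the one-sided bound covers both directions.\<close>

definition equitable_vdec :: "'a set \<Rightarrow> 'a set set \<Rightarrow> nat \<Rightarrow> ('a set \<Rightarrow> nat) \<Rightarrow> bool" where
  "equitable_vdec V E k p \<longleftrightarrow> vdec V E k p \<and>
     (\<forall>i\<in>{1..k}. \<forall>j\<in>{1..k}. card (color_class E p i) \<le> card (color_class E p j) + 1)"

text \<open>
  Both minima are meaningful only if a suitable coloring exists.  The lemma
  \<open>ex_equitable_vdec_tree\<close> below shows that one does for every tree with at least three vertices.
\<close>

definition chi_s :: "'a set \<Rightarrow> 'a set set \<Rightarrow> nat" where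
  "chi_s V E = (LEAST k. \<exists>p. vdec V E k p)"

definition chi_es :: "'a set \<Rightarrow> 'a set set \<Rightarrow> nat" where
  "chi_es V E = (LEAST k. \<exists>p. equitable_vdec V E k p)"

lemma ex_equitable_vdec_tree:
  assumes tree: "is_tree V E" and card: "3 \<le> card V"
  shows "\<exists>p. equitable_vdec V E (card E) p"
proof -
  have finV: "finite V" and EV: "E \<subseteq> [V]\<^bsup>2\<^esup>" and conn: "connected_graph V E"
    using tree by (auto simp: is_tree_def simple_graph_def)
  have finE: "finite E"
    using EV finV finite_imp_finite_nsets finite_subset by blast
  have "card E = card {1..card E}" by simp
  then obtain p where p: "bij_betw p E {1..card E}"
    using finE finite_same_card_bij by blast
  then have inj: "inj_on p E" and pE: "p \<in> E \<rightarrow> {1..card E}"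
    by (auto simp: bij_betw_def)
  have dist: "color_set E p u \<noteq> color_set E p v" if uv: "u \<in> V" "v \<in> V" "u \<noteq> v" for u v
  proof
    assume "color_set E p u = color_set E p v"
    then have eq: "incident_edges E u = incident_edges E v"
      using inj inj_on_image_eq_iff[OF inj, of "incident_edges E u" "incident_edges E v"]
      by (auto simp: color_set_def incident_edges_def)
    have only: "e = {u, v}" if e: "e \<in> E" "u \<in> e \<or> v \<in> e" for e
    proof -
      have "u \<in> e" "v \<in> e" using e eq by (auto simp: incident_edges_def)
      moreover obtain x y where "e = {x, y}" using e(1) EV nsets2_E by (metis subsetD)
      ultimately show ?thesis using uv(3) by auto
    qed
    have stay: "w = u \<or> w = v" if "(u, w) \<in> (adj_rel E)\<^sup>*" for w
      using that
    proof (induction rule: rtrancl_induct)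
      case (step y z)
      then have "{y, z} = {u, v}" using only[of "{y, z}"] by (auto simp: adj_rel_def)
      then show ?case by (auto simp: doubleton_eq_iff)
    qed simp
    then have "V \<subseteq> {u, v}" using conn uv(1) by (auto simp: connected_graph_def)
    then have "card V \<le> card {u, v}" by (intro card_mono) auto
    then show False using card uv(3) by simp
  qed
  have "card (color_class E p i) \<le> 1" for i
    using inj by (auto simp: color_class_def card_le_Suc0_iff_eq finE inj_on_def)
  then have "card (color_class E p i) \<le> card (color_class E p j) + 1" for i j
    using trans_le_add2 by blast
  moreover have "vdec V E (card E) p"
    using pE inj dist by (auto simp: vdec_def proper_edge_coloring_def inj_on_def)
  ultimately show ?thesis by (auto simp: equitable_vdec_def)
qed

end

theory Submission
  imports Defs
begin

text \<open>
  The leaves force the pendant edges to have distinct colours, so a vertex distinguishing colouring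
  needs at least \<open>L = n\<^sub>1(T)\<close> colours.  If at least three edges join inner (non-leaf) vertices, \<open>L\<close>
  colours suffice even equitably.  Such a colouring is built from a smaller tree: if \<open>M\<close> is a
  matching that contains exactly one pendant edge, then a colouring of \<open>T / M\<close> together with the
  new colour class \<open>M\<close> separates all vertices except possibly the ends of \<open>M\<close>.
  With \<open>m\<close> inner edges there are three cases.  If \<open>m < L\<close>, take for \<open>M\<close> a single pendant edge.
  If \<open>m = L\<close>, add one inner edge to it; a double count shows that the ends of \<open>M\<close> can be chosen so
  that they are separated for every colouring that is injective on the inner edges.
  If \<open>m = L + d\<close> with \<open>d \<in> {1, 2}\<close>, contract three consecutive edges, the first of them pendant, and
  colour them \<open>\<nu>, c, \<nu>\<close> with \<open>\<nu>\<close> new and \<open>c\<close> an old colour chosen by counting; this lowers \<open>d\<close> by one.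
  If \<open>m \<le> 2\<close>, every vertex distinguishing colouring with \<open>L\<close> colours is equitable, and \<open>L + 1\<close>
  colours always suffice.
\<close>

text \<open>With L colours the pendant edges use every colour exactly once, so equitability only
  asks that the inner edges be spread evenly. As |E| = m + L, the size hypothesis says that m is at
  most L + 2. If m = L + d with d positive, then at most L of the m + 1 non-leaf vertices have
  degree two, so at least d + 1 have larger degree; they supply the slack for choosing c. The new
  colour marks the blocks met by M, so these cannot be confused with the others. The obstacle is to
  separate the marked blocks from each other without knowing the colouring of the smaller tree. For
  m at most L the induction therefore carries injectivity on all inner edges. Beyond L this is
  impossible, and the invariant becomes that each colour occurs once or twice on inner edges. Fewer
  than three inner edges really are exceptional: let u have two leaves and continue by a path u, v,
  t with one leaf at t. Then L = 3, but with three colours the edge uv and the leaf edge at t both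
  get the colour missing at the leaves of u, and v and t see the same colours.\<close>

section \<open>Trees as families of blocks\<close>

text \<open>
  A tree is represented by its blocks, the sets of edges incident to its non-leaf vertices: an edge is
  pendant if it lies in one block only, contracting an inner edge unites two blocks, and
  deleting a leaf removes an element of a block.
\<close>

definition inner :: "'e set set \<Rightarrow> 'e set" where
  "inner W = {e. \<exists>A\<in>W. \<exists>B\<in>W. A \<noteq> B \<and> e \<in> A \<and> e \<in> B}"

definition outer :: "'e set set \<Rightarrow> 'e set" where
  "outer W = \<Union>W - inner W"

lemma innerI: "\<lbrakk>A \<in> W; B \<in> W; A \<noteq> B; e \<in> A; e \<in> B\<rbrakk> \<Longrightarrow> e \<in> inner W"
  by (auto simp: inner_def)

lemma inner_mono: "S \<subseteq> W \<Longrightarrow> inner S \<subseteq> inner W"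
  by (auto simp: inner_def)

lemma inner_subset: "inner W \<subseteq> \<Union>W"
  by (auto simp: inner_def)

lemma outer_subset: "outer W \<subseteq> \<Union>W"
  by (auto simp: outer_def)

lemma outer_unique: "\<lbrakk>e \<in> outer W; A \<in> W; B \<in> W; e \<in> A; e \<in> B\<rbrakk> \<Longrightarrow> A = B"
  by (auto simp: outer_def inner_def)

text \<open>\<open>sparse\<close> is acyclicity in counting form, and together with
  \<open>card_blocks\<close> it also yields connectedness. Counts are easy to carry through
  deletions and contractions, where cycles and walks would have to be rerouted.\<close>

locale block_tree =
  fixes W :: "'e set set"
  assumes finite_blocks: "finite W"
    and card_block: "A \<in> W \<Longrightarrow> 2 \<le> card A"
    and no_three: "\<lbrakk>A \<in> W; B \<in> W; C \<in> W; e \<in> A; e \<in> B; e \<in> C\<rbrakk> \<Longrightarrow> A = B \<or> A = C \<or> B = C"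
    and sparse: "\<lbrakk>S \<subseteq> W; S \<noteq> {}\<rbrakk> \<Longrightarrow> card (inner S) < card S"
    and card_blocks: "card W = card (inner W) + 1"
begin

lemma finite_block: "A \<in> W \<Longrightarrow> finite A"
  using card_block[of A] by (metis card.infinite not_numeral_le_zero)

lemma finite_Union_blocks: "finite (\<Union>W)"
  using finite_blocks finite_block by blast

lemma finite_inner: "finite (inner W)"
  using finite_Union_blocks inner_subset by (rule finite_subset[rotated])

lemma finite_outer: "finite (outer W)"
  using finite_Union_blocks outer_subset by (rule finite_subset[rotated])

lemma blocks_nonempty: "W \<noteq> {}"
  using card_blocks by auto

text \<open>Two common edges would be two inner edges on two blocks, against \<open>sparse\<close>;
  triangles are excluded below in the same way.\<close>

lemma meet_unique:
  assumes "A \<in> W" "B \<in> W" "A \<noteq> B" "e \<in> A" "e \<in> B" "f \<in> A" "f \<in> B"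
  shows "e = f"
proof (rule ccontr)
  assume "e \<noteq> f"
  have "card (inner {A, B}) < card {A, B}"
    using assms by (intro sparse) auto
  moreover have "card {e, f} \<le> card (inner {A, B})"
    using assms finite_inner inner_mono[of "{A, B}" W]
    by (intro card_mono) (auto intro: innerI finite_subset)
  ultimately show False
    using \<open>e \<noteq> f\<close> assms(3) by simp
qed

lemma no_triangle:
  assumes "A \<in> W" "B \<in> W" "C \<in> W" "A \<noteq> B" "B \<noteq> C" "A \<noteq> C"
    and "e \<in> A" "e \<in> B" "f \<in> B" "f \<in> C" "g \<in> A" "g \<in> C"
  shows False
proof -
  have "card (inner {A, B, C}) < card {A, B, C}"
    using assms by (intro sparse) auto
  moreover have "card {e, f, g} \<le> card (inner {A, B, C})"
    using assms finite_inner inner_mono[of "{A, B, C}" W]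
    by (intro card_mono) (auto intro: innerI finite_subset)
  moreover have "e \<noteq> f" "f \<noteq> g" "e \<noteq> g"
    using assms no_three[OF assms(1-3)] by metis+
  ultimately show False
    using assms by simp
qed

text \<open>Connectedness by counting: if the complement of \<open>S\<close> were nonempty, no inner
  edge would join the two parts, and \<open>sparse\<close> would allow at most
  \<open>card W - 2\<close> inner edges.\<close>

lemma closed_eq_all:
  assumes "S \<subseteq> W" "S \<noteq> {}"
    and closed: "\<And>A B e. \<lbrakk>A \<in> S; B \<in> W; e \<in> A; e \<in> B\<rbrakk> \<Longrightarrow> B \<in> S"
  shows "S = W"
proof (rule ccontr)
  assume "S \<noteq> W"
  then have ne: "W - S \<noteq> {}" using assms by auto
  have "inner W \<subseteq> inner S \<union> inner (W - S)"
  proof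
    fix e assume "e \<in> inner W"
    then obtain A B where AB: "A \<in> W" "B \<in> W" "A \<noteq> B" "e \<in> A" "e \<in> B"
      by (auto simp: inner_def)
    then have "A \<in> S \<longleftrightarrow> B \<in> S" using closed by blast
    then show "e \<in> inner S \<union> inner (W - S)"
      using AB innerI[of A S B e] innerI[of A "W - S" B e] by auto
  qed
  moreover have "finite (inner S)" "finite (inner (W - S))"
    using finite_inner inner_mono assms(1) by (meson finite_subset Diff_subset)+
  ultimately have "card (inner W) \<le> card (inner S) + card (inner (W - S))"
    by (meson card_Un_le card_mono finite_UnI le_trans)
  moreover have "card (inner S) < card S" "card (inner (W - S)) < card (W - S)"
    using sparse assms ne by auto
  moreover have "card W = card S + card (W - S)"
    using assms(1) finite_blocks by (metis card_Diff_subset card_mono finite_subset le_add_diff_inverse)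
  ultimately show False using card_blocks by linarith
qed

section \<open>Double counting of edges over blocks\<close>

lemma card_blocks_containing:
  assumes "e \<in> \<Union>W"
  shows "card {A \<in> W. e \<in> A} = (if e \<in> inner W then 2 else 1)"
proof (cases "e \<in> inner W")
  case True
  then obtain A B where AB: "A \<in> W" "B \<in> W" "A \<noteq> B" "e \<in> A" "e \<in> B"
    by (auto simp: inner_def)
  then have "{A \<in> W. e \<in> A} = {A, B}"
    using no_three by blast
  then show ?thesis using True AB by simp
next
  case False
  then obtain A where A: "A \<in> W" "e \<in> A" using assms by auto
  then have "{A \<in> W. e \<in> A} = {A}"
    using False by (auto simp: inner_def)
  then show ?thesis using False by simp
qed

text \<open>Handshake count restricted to \<open>X\<close>: an inner edge is seen by two blocks, a
  pendant edge by one. It is used with all edges, with the pendant edges and with the inner edges as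
  \<open>X\<close>.\<close>

lemma sum_card_blocks: "(\<Sum>A\<in>W. card (A \<inter> X)) = 2 * card (inner W \<inter> X) + card (outer W \<inter> X)"
proof -
  have "(\<Sum>A\<in>W. card (A \<inter> X)) = (\<Sum>A\<in>W. \<Sum>e\<in>\<Union>W \<inter> X. if e \<in> A then 1 else 0)"
    using finite_Union_blocks
    by (intro sum.cong refl) (auto simp: sum.If_cases intro!: arg_cong[where f = card])
  also have "\<dots> = (\<Sum>e\<in>\<Union>W \<inter> X. card {A \<in> W. e \<in> A})"
    using finite_blocks by (subst sum.swap) (auto simp: sum.If_cases Int_def)
  also have "\<dots> = (\<Sum>e\<in>\<Union>W \<inter> X. if e \<in> inner W then 2 else 1)"
    by (intro sum.cong refl) (use card_blocks_containing in auto)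
  also have "\<dots> = 2 * card (inner W \<inter> X) + card (outer W \<inter> X)"
  proof -
    have "\<Union>W \<inter> X \<inter> {e. e \<in> inner W} = inner W \<inter> X" "\<Union>W \<inter> X \<inter> - {e. e \<in> inner W} = outer W \<inter> X"
      using inner_subset[of W] by (auto simp: outer_def)
    then show ?thesis
      using finite_Union_blocks by (simp add: sum.If_cases)
  qed
  finally show ?thesis .
qed

text \<open>The familiar leaf formula of a tree. The natural subtraction is exact because blocks
  have at least two elements; blocks of size two contribute nothing, so the pendant edges bound the
  larger blocks.\<close>

lemma sum_excess: "(\<Sum>A\<in>W. card A - 2) + 2 = card (outer W)"
proof -
  have "(\<Sum>A\<in>W. card A) = 2 * card (inner W) + card (outer W)"
    using sum_card_blocks[of UNIV] by simp
  moreover have "(\<Sum>A\<in>W. card A) = (\<Sum>A\<in>W. card A - 2) + 2 * card W"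
  proof -
    have "(\<Sum>A\<in>W. card A) = (\<Sum>A\<in>W. (card A - 2) + 2)"
      by (intro sum.cong refl) (use card_block in fastforce)
    also have "\<dots> = (\<Sum>A\<in>W. card A - 2) + 2 * card W"
      by (simp only: sum.distrib sum_constant) simp
    finally show ?thesis .
  qed
  ultimately show ?thesis using card_blocks by simp
qed

lemma sum_outer: "(\<Sum>A\<in>W. card (A \<inter> outer W)) = card (outer W)"
proof -
  have "inner W \<inter> outer W = {}" by (auto simp: outer_def)
  then show ?thesis using sum_card_blocks[of "outer W"] by simp
qed

lemma card_block_split: "A \<in> W \<Longrightarrow> card A = card (A \<inter> inner W) + card (A \<inter> outer W)"
  using finite_block[of A]
  by (subst card_Un_disjoint[symmetric]) (auto simp: outer_def intro!: arg_cong[where f = card])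

section \<open>Deleting a pendant edge and contracting an inner edge\<close>

text \<open>Size three ensures that a block of size two remains. As \<open>l\<close> is pendant,
  \<open>inner\<close> stays the same for every subfamily, so \<open>sparse\<close> and the edge
  count transfer.\<close>

lemma block_tree_delete:
  assumes A: "A \<in> W" "3 \<le> card A" and l: "l \<in> A" "l \<in> outer W"
  defines "W' \<equiv> insert (A - {l}) (W - {A})"
  shows "block_tree W'" "inner W' = inner W" "outer W' = outer W - {l}" "card W' = card W"
    "A - {l} \<notin> W"
proof -
  let ?f = "\<lambda>B. B - {l}"
  have l_notin: "l \<notin> B" if "B \<in> W" "B \<noteq> A" for B
    using that A l outer_unique by metis
  have card_A: "card (A - {l}) \<ge> 2"
    using A l by (simp add: card_Diff_singleton_if)
  \<comment> \<open>Otherwise \<open>A\<close> and \<open>A - {l}\<close> would be different blocks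
    with two common edges.\<close>
  have notin: "A - {l} \<notin> W"
  proof
    assume "A - {l} \<in> W"
    then have "a = b" if "a \<in> A - {l}" "b \<in> A - {l}" for a b
      using meet_unique[of A "A - {l}" a b] A l that by auto
    then have "card (A - {l}) \<le> 1"
      by (simp add: card_le_Suc0_iff_eq A finite_block)
    then show False using card_A by simp
  qed
  then show "A - {l} \<notin> W" .
  \<comment> \<open>No block other than \<open>A\<close> contains \<open>l\<close>, so
    \<open>W'\<close> is an injective image of \<open>W\<close> and its subfamilies can be pulled
    back.\<close>
  have W': "W' = ?f ` W"
    using A(1) l_notin by (force simp: W'_def image_iff)
  have inj: "inj_on ?f W"
    using l_notin notin A(1) by (smt (verit) Diff_empty Diff_insert0 inj_onI)
  have inner_image: "inner (?f ` S) = inner S" if S: "S \<subseteq> W" for S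
  proof -
    have "l \<notin> inner S" using l(2) inner_mono[OF S] by (auto simp: outer_def)
    moreover have "inner (?f ` S) = inner S - {l}"
    proof (intro equalityI subsetI)
      fix e assume "e \<in> inner S - {l}"
      then obtain C D where CD: "C \<in> S" "D \<in> S" "C \<noteq> D" "e \<in> C" "e \<in> D" "e \<noteq> l"
        by (auto simp: inner_def)
      then have "?f C \<noteq> ?f D"
        using inj S by (metis inj_onD subsetD)
      then show "e \<in> inner (?f ` S)"
        using CD by (intro innerI[of "?f C" _ "?f D"]) auto
    qed (auto simp: inner_def)
    ultimately show ?thesis by simp
  qed
  show inn: "inner W' = inner W"
    using inner_image[of W] W' by simp
  show "outer W' = outer W - {l}"
    unfolding outer_def inn by (auto simp: W')
  show card_W': "card W' = card W"
    using inj by (simp add: W' card_image)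
  show "block_tree W'"
  proof
    show "finite W'" by (simp add: W' finite_blocks)
  next
    fix B assume "B \<in> W'" then show "2 \<le> card B"
      using card_A card_block by (auto simp: W'_def)
  next
    fix B C D e assume *: "B \<in> W'" "C \<in> W'" "D \<in> W'" and "e \<in> B" "e \<in> C" "e \<in> D"
    then show "B = C \<or> B = D \<or> C = D"
      unfolding W' using no_three by (smt (verit) DiffD1 imageE)
  next
    fix S' assume "S' \<subseteq> W'" "S' \<noteq> {}"
    then obtain S where S: "S \<subseteq> W" "S' = ?f ` S" "S \<noteq> {}"
      unfolding W' by (metis image_is_empty subset_imageE)
    then show "card (inner S') < card S'"
      using sparse[of S] inner_image[of S] card_image[OF inj_on_subset[OF inj S(1)]] by simp
  next
    show "card W' = card (inner W') + 1"
      using card_W' inn card_blocks by simp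
  qed
qed

text \<open>In every subfamily containing both ends of \<open>e\<close>, the merger loses exactly
  one block and exactly one inner edge, so the strict inequality of \<open>sparse\<close>
  survives.\<close>

lemma block_tree_contract:
  assumes AB: "A \<in> W" "B \<in> W" "A \<noteq> B" and e: "e \<in> A" "e \<in> B"
  defines "Z \<equiv> A \<union> B - {e}"
  defines "W' \<equiv> insert Z (W - {A, B})"
  shows "block_tree W'" "inner W' = inner W - {e}" "outer W' = outer W" "card W = card W' + 1"
    "Z \<notin> W" "card A + card B = card Z + 2"
proof -
  have fin: "finite A" "finite B" using AB finite_block by auto
  have disj: "A \<inter> B = {e}" using meet_unique[OF AB] e by blast
  have e_in: "e \<in> inner W" using AB e innerI by metis
  have e_notin: "e \<notin> C" if "C \<in> W" "C \<noteq> A" "C \<noteq> B" for C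
    using that no_three[of A B C e] AB e by auto
  show card_Z: "card A + card B = card Z + 2"
    using card_Un_Int[OF fin] disj e fin by (simp add: Z_def card_Diff_singleton_if) 
      (metis Suc_pred card_gt_0_iff empty_iff finite_Un UnI1)
  show Z_notin: "Z \<notin> W"
  proof
    assume Z: "Z \<in> W"
    obtain a where a: "a \<in> A - {e}"
      using card_block[OF AB(1)] by (metis One_nat_def Suc_1 card_le_Suc0_iff_eq fin(1) not_less_eq_eq e(1) DiffI singletonD)
    obtain b where b: "b \<in> B - {e}"
      using card_block[OF AB(2)] by (metis One_nat_def Suc_1 card_le_Suc0_iff_eq fin(2) not_less_eq_eq e(2) DiffI singletonD)
    \<comment> \<open>A block equal to \<open>Z\<close> would form a triangle with \<open>A\<close>
      and \<open>B\<close>.\<close>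
    show False
      using no_triangle[OF AB(1,2) Z AB(3), of e b a] a b e Z_def by auto
  qed
  have inner_merge: "inner (insert A (insert B S)) = insert e (inner (insert Z S))" "e \<notin> inner (insert Z S)"
    if S: "S \<subseteq> W - {A, B}" for S
  proof -
    have not_e: "e \<notin> C" if "C \<in> insert Z S" for C
      using that S e_notin by (auto simp: Z_def)
    then show "e \<notin> inner (insert Z S)" by (auto simp: inner_def)
    have "f \<in> inner (insert Z S)" if f: "f \<in> inner (insert A (insert B S))" "f \<noteq> e" for f
    proof -
      \<comment> \<open>\<open>g\<close> sends the old ends of \<open>f\<close> to its new ends.
        They stay different because \<open>e\<close> is the only edge between \<open>A\<close> and
        \<open>B\<close>.\<close>
      define g where "g C = (if C \<in> {A, B} then Z else C)" for C
      obtain C D where CD: "C \<in> insert A (insert B S)" "D \<in> insert A (insert B S)"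
          "C \<noteq> D" "f \<in> C" "f \<in> D"
        using f(1) by (auto simp: inner_def)
      have "\<not> (f \<in> A \<and> f \<in> B)" using disj f(2) by auto
      then have "g C \<noteq> g D"
        using CD S Z_notin by (auto simp: g_def)
      moreover have "f \<in> g C" "f \<in> g D" using CD f(2) by (auto simp: g_def Z_def)
      moreover have "g C \<in> insert Z S" "g D \<in> insert Z S" using CD by (auto simp: g_def)
      ultimately show ?thesis by (metis innerI)
    qed
    moreover have "f \<in> inner (insert A (insert B S))" if f: "f \<in> inner (insert Z S)" for f
    proof -
      obtain C D where CD: "C \<in> insert Z S" "D \<in> insert Z S" "C \<noteq> D" "f \<in> C" "f \<in> D"
        using f by (auto simp: inner_def)
      define T where "T = insert A (insert B S)"
      have "\<exists>C'\<in>T. f \<in> C' \<and> (C = Z \<longrightarrow> C' \<in> {A, B}) \<and> (C \<noteq> Z \<longrightarrow> C' = C)"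
        if "C \<in> insert Z S" "f \<in> C" for C
        using that by (auto simp: T_def Z_def)
      then obtain C' D' where *: "C' \<in> T" "D' \<in> T" "f \<in> C'" "f \<in> D'"
        "C = Z \<longrightarrow> C' \<in> {A, B}" "C \<noteq> Z \<longrightarrow> C' = C"
        "D = Z \<longrightarrow> D' \<in> {A, B}" "D \<noteq> Z \<longrightarrow> D' = D"
        using CD by metis
      moreover have "C' \<noteq> D'"
        using * CD S by (cases "C = Z"; cases "D = Z") auto
      ultimately show ?thesis using innerI T_def by metis
    qed
    moreover have "e \<in> inner (insert A (insert B S))"
      using AB(3) e by (intro innerI[of A _ B]) auto
    ultimately show "inner (insert A (insert B S)) = insert e (inner (insert Z S))"
      by blast
  qed
  have W: "insert A (insert B (W - {A, B})) = W" using AB by auto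
  show inn: "inner W' = inner W - {e}"
    using inner_merge[of "W - {A, B}"] unfolding W W'_def by simp
  show "outer W' = outer W"
    using e_in e_notin AB unfolding outer_def inn by (auto simp: W'_def Z_def)
  have "card (W - {A, B}) + 2 = card W"
    using AB finite_blocks card_mono[of W "{A, B}"] card_Diff_subset[of "{A, B}" W] by simp
  then show card_W': "card W = card W' + 1"
    using Z_notin finite_blocks by (simp add: W'_def)
  show "block_tree W'"
  proof
    show "finite W'" by (simp add: W'_def finite_blocks)
  next
    fix C assume "C \<in> W'" then show "2 \<le> card C"
      using card_block[of C] card_block[OF AB(1)] card_block[OF AB(2)] card_Z by (auto simp: W'_def)
  next
    fix C D F f assume *: "C \<in> W'" "D \<in> W'" "F \<in> W'" and f: "f \<in> C" "f \<in> D" "f \<in> F"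
    have ex: "\<exists>C'\<in>W. f \<in> C' \<and> (C = Z \<longrightarrow> C' \<in> {A, B}) \<and> (C \<noteq> Z \<longrightarrow> C' = C \<and> C' \<notin> {A, B})"
      if "C \<in> W'" "f \<in> C" for C
      using that AB by (cases "C = Z") (auto simp: W'_def Z_def)
    obtain C' where C': "C' \<in> W" "f \<in> C'" "C = Z \<longrightarrow> C' \<in> {A, B}" "C \<noteq> Z \<longrightarrow> C' = C \<and> C' \<notin> {A, B}"
      using ex[OF *(1) f(1)] by blast
    obtain D' where D': "D' \<in> W" "f \<in> D'" "D = Z \<longrightarrow> D' \<in> {A, B}" "D \<noteq> Z \<longrightarrow> D' = D \<and> D' \<notin> {A, B}"
      using ex[OF *(2) f(2)] by blast
    obtain F' where F': "F' \<in> W" "f \<in> F'" "F = Z \<longrightarrow> F' \<in> {A, B}" "F \<noteq> Z \<longrightarrow> F' = F \<and> F' \<notin> {A, B}"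
      using ex[OF *(3) f(3)] by blast
    have "C' = D' \<or> C' = F' \<or> D' = F'"
      using no_three C' D' F' by metis
    then show "C = D \<or> C = F \<or> D = F"
      using C' D' F' by metis
  next
    fix S' assume S': "S' \<subseteq> W'" "S' \<noteq> {}"
    show "card (inner S') < card S'"
    proof (cases "Z \<in> S'")
      case False
      then have "S' \<subseteq> W" using S' by (auto simp: W'_def)
      then show ?thesis using sparse S' by blast
    next
      case True
      define S where "S = S' - {Z}"
      have S: "S \<subseteq> W - {A, B}" "S' = insert Z S" "Z \<notin> S" "finite S"
        using S' True finite_blocks by (auto simp: S_def W'_def intro: finite_subset)
      have "card (inner (insert A (insert B S))) < card (insert A (insert B S))"
        using S AB by (intro sparse) auto
      moreover have "A \<notin> insert B S" "B \<notin> S" using S(1) AB by auto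
      moreover have "finite (inner S')"
      proof -
        have "inner S' \<subseteq> inner W'" using inner_mono S' by blast
        then show ?thesis using inn finite_inner by (metis finite_Diff finite_subset)
      qed
      ultimately show ?thesis
        using inner_merge[OF S(1)] S by simp
    qed
  next
    show "card W' = card (inner W') + 1"
      using card_W' inn card_blocks e_in finite_inner by (simp add: card_Diff_singleton_if)
         (metis One_nat_def Suc_pred card_gt_0_iff empty_iff)
  qed
qed

end

section \<open>Good colourings and their extension by one colour class\<close>

text \<open>This is \<open>vdec\<close> read on blocks. The colour sets of leaves are singletons, so
  separating leaves means injectivity on the pendant edges; a leaf and a non-leaf differ already in
  the size of their colour sets.\<close>

definition good :: "'e set set \<Rightarrow> nat \<Rightarrow> ('e \<Rightarrow> nat) \<Rightarrow> bool" where
  "good W k p \<longleftrightarrow> (\<forall>A\<in>W. inj_on p A) \<and> inj_on (image p) W \<and> inj_on p (outer W) \<and> p ` \<Union>W \<subseteq> {1..k}"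

lemma good_range: "\<lbrakk>good W k p; e \<in> A; A \<in> W\<rbrakk> \<Longrightarrow> p e \<in> {1..k}"
  unfolding good_def by blast

text \<open>\<open>T\<close> consists of the blocks that receive the new colour. Blocks inside
  \<open>T\<close> see it and blocks outside do not, so after the extension only pairs inside
  \<open>T\<close> have to be separated.\<close>

lemma good_extend:
  assumes good: "good W' k p'"
    and T: "T \<subseteq> W" "W - T \<subseteq> W'" "\<And>A. A \<in> T \<Longrightarrow> inj_on p A" "\<And>A. A \<in> T \<Longrightarrow> Suc k \<in> p ` A"
      "inj_on (image p) T" "p ` \<Union>T \<subseteq> {1..Suc k}"
    and old: "\<And>A e. \<lbrakk>A \<in> W - T; e \<in> A\<rbrakk> \<Longrightarrow> p e = p' e"
    and l: "outer W = insert l (outer W')" "l \<notin> outer W'" "p l = Suc k"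
      "\<And>e. e \<in> outer W' \<Longrightarrow> p e = p' e"
  shows "good W (Suc k) p"
  unfolding good_def
proof (intro conjI ballI)
  fix A assume A: "A \<in> W"
  show "inj_on p A"
  proof (cases "A \<in> T")
    case False
    then have "inj_on p' A" using A T(2) good by (auto simp: good_def)
    then show ?thesis using old A False by (simp add: inj_on_def)
  qed (use T(3) in auto)
next
  have image_old: "p ` A = p' ` A" if "A \<in> W - T" for A
    using old[OF that] by (auto simp: image_iff)
  have range: "p' ` \<Union>W' \<subseteq> {1..k}" using good by (simp add: good_def)
  have no_new: "Suc k \<notin> p ` A" if A: "A \<in> W - T" for A
  proof -
    have "A \<in> W'" using A T(2) by auto
    then have "p' ` A \<subseteq> {1..k}" using range by blast
    then show ?thesis unfolding image_old[OF A] by (auto dest!: subsetD)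
  qed
  have inj': "inj_on (image p') W'" using good by (simp add: good_def)
  show "inj_on (image p) W"
  proof (rule inj_onI)
    fix A B assume AB: "A \<in> W" "B \<in> W" "p ` A = p ` B"
    show "A = B"
    proof (cases "A \<in> T")
      case True
      then have "B \<in> T" using AB no_new[of B] T(4)[of A] by auto
      then show ?thesis using True AB T(5) by (auto dest: inj_onD)
    next
      case False
      then have "B \<notin> T" using AB no_new[of A] T(4)[of B] by auto
      then show ?thesis
        using False AB image_old[of A] image_old[of B] T(2) inj_onD[OF inj', of A B] by auto
    qed
  qed
  have "p' e \<le> k" if "e \<in> outer W'" for e
  proof -
    have "e \<in> \<Union>W'" using that outer_subset[of W'] by auto
    then show ?thesis using range by force
  qed
  moreover have "inj_on p' (outer W')" using good by (simp add: good_def)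
  ultimately show "inj_on p (outer W)"
    using l by (fastforce simp: inj_on_def)
  show "p ` \<Union>W \<subseteq> {1..Suc k}"
  proof (rule image_subsetI)
    fix e assume "e \<in> \<Union>W"
    then obtain A where A: "A \<in> W" "e \<in> A" by auto
    show "p e \<in> {1..Suc k}"
    proof (cases "A \<in> T")
      case True then show ?thesis using T(6) A by blast
    next
      case False
      then have "p e = p' e" "A \<in> W'" using A old T(2) by auto
      then have "p e \<in> {1..k}" using good_range[OF good A(2)] by simp
      then show ?thesis by simp
    qed
  qed
qed

context block_tree
begin

lemma ex_inner: 
  assumes A: "A \<in> W" and W: "card W \<ge> 2"
  shows "A \<inter> inner W \<noteq> {}"
proof
  assume *: "A \<inter> inner W = {}"
  have "{A} = W"
    using A * by (intro closed_eq_all) (auto simp: inner_def)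
  then have "card W = card {A}" by simp
  then show False using W by simp
qed

lemma inj_on_fun_upd_new:
  assumes "inj_on p (A - {l})" "\<And>e. e \<in> A - {l} \<Longrightarrow> p e \<noteq> c"
  shows "inj_on (p(l := c)) A"
proof (rule inj_onI)
  fix e f assume "e \<in> A" "f \<in> A" "(p(l := c)) e = (p(l := c)) f"
  then show "e = f"
    using assms(2)[of e] assms(2)[of f] inj_onD[OF assms(1), of e f] by (auto split: if_splits)
qed

text \<open>The new colour touches the single block \<open>A\<close>, so there is no pair to
  separate.\<close>

lemma good_delete:
  assumes A: "A \<in> W" "3 \<le> card A" and l: "l \<in> A" "l \<in> outer W"
    and p: "good (insert (A - {l}) (W - {A})) k p"
  shows "good W (Suc k) (p(l := Suc k))"
proof (rule good_extend[OF p, where T = "{A}" and l = l])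
  have less: "p e \<le> k" "e \<noteq> l" if "e \<in> A - {l}" for e
    using good_range[OF p that] that by auto
  have new: "p e \<noteq> Suc k" if "e \<in> A - {l}" for e
    using less(1)[OF that] by simp
  have inj: "inj_on p (A - {l})" using p by (simp add: good_def)
  show "inj_on (p(l := Suc k)) B" if "B \<in> {A}" for B
    using that inj_on_fun_upd_new[OF inj new] by simp
  show "(p(l := Suc k)) ` \<Union> {A} \<subseteq> {1..Suc k}"
  proof (rule image_subsetI)
    fix e assume "e \<in> \<Union> {A}"
    then show "(p(l := Suc k)) e \<in> {1..Suc k}"
      using good_range[OF p, of e "A - {l}"] by (cases "e = l") auto
  qed
  show "(p(l := Suc k)) e = p e" if "B \<in> W - {A}" "e \<in> B" for B e
  proof -
    have "e \<noteq> l" using that outer_unique[OF l(2) A(1) _ l(1)] by auto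
    then show ?thesis by simp
  qed
  show "outer W = insert l (outer (insert (A - {l}) (W - {A})))"
    "l \<notin> outer (insert (A - {l}) (W - {A}))"
    unfolding block_tree_delete(3)[OF A l] using l by auto
  show "(p(l := Suc k)) e = p e" if "e \<in> outer (insert (A - {l}) (W - {A}))" for e
    using that unfolding block_tree_delete(3)[OF A l] by simp
  show "Suc k \<in> (p(l := Suc k)) ` B" if "B \<in> {A}" for B
    using that l(1) by force
qed (use A l in auto)

text \<open>If \<open>apart w x\<close> holds, then the colour set of \<open>w\<close> without one pendant edge and that of \<open>x\<close>
  without one inner edge differ in every colouring that is injective on the inner edges
  and on the pendant edges.\<close>

definition apart :: "'e set \<Rightarrow> 'e set \<Rightarrow> bool" where
  "apart w x \<longleftrightarrow> card (x \<inter> outer W) < card (w \<inter> inner W - x) \<or> card (x \<inter> inner W) < card (w \<inter> outer W)"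

text \<open>Suppose the colour sets agree. By injectivity, an inner edge of \<open>w\<close> off
  \<open>x\<close> can share its colour only with a pendant edge of \<open>x\<close>, and a pendant
  edge of \<open>w\<close> other than \<open>l\<close> only with an inner edge of \<open>x\<close>
  other than \<open>e\<close>. Counting contradicts both clauses of \<open>apart\<close>; in the
  second count the removed edges \<open>l\<close> and \<open>e\<close> cancel.\<close>

lemma apart_image_neq:
  fixes p :: "'e \<Rightarrow> nat"
  assumes "apart w x" and wx: "w \<in> W" "x \<in> W" and l: "l \<in> w" "l \<in> outer W" and e: "e \<in> x" "e \<notin> w" "e \<in> inner W"
    and inj: "inj_on p (outer W - {l})" "inj_on p (inner W - {e})"
  shows "p ` (w - {l}) \<noteq> p ` (x - {e})"
proof
  assume eq: "p ` (w - {l}) = p ` (x - {e})"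
  have disj: "inner W \<inter> outer W = {}" by (auto simp: outer_def)
  have split: "f \<in> inner W \<or> f \<in> outer W" if "f \<in> A" "A \<in> W" for f A
    using that by (auto simp: outer_def)
  have fin: "finite w" "finite x" using wx finite_block by auto
  have wne: "w \<noteq> x" using e by auto
  have 1: "card (w \<inter> inner W - x) \<le> card (x \<inter> outer W)"
  proof -
    have "p ` (w \<inter> inner W - x) \<subseteq> p ` (x \<inter> outer W)"
    proof (rule image_subsetI)
      fix f assume f: "f \<in> w \<inter> inner W - x"
      then have "f \<in> w - {l}" using l(2) disj by auto
      then have "p f \<in> p ` (x - {e})" unfolding eq[symmetric] by blast
      then obtain g where g: "g \<in> x - {e}" "p f = p g" by auto
      have "g \<notin> inner W"
      proof
        assume "g \<in> inner W"
        then have "f = g" using inj_onD[OF inj(2) g(2)] f g(1) e by auto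
        then show False using f g(1) by auto
      qed
      then show "p f \<in> p ` (x \<inter> outer W)" using g split[of g x] wx by auto
    qed
    moreover have "inj_on p (w \<inter> inner W - x)"
      using inj(2) e by (elim inj_on_subset) auto
    ultimately have "card (w \<inter> inner W - x) \<le> card (p ` (x \<inter> outer W))"
      using fin by (intro card_inj_on_le[of p]) auto
    also have "\<dots> \<le> card (x \<inter> outer W)" using fin by (intro card_image_le) auto
    finally show ?thesis .
  qed
  have 2: "card (w \<inter> outer W - {l}) \<le> card (x \<inter> inner W - {e})"
  proof -
    have "p ` (w \<inter> outer W - {l}) \<subseteq> p ` (x \<inter> inner W - {e})"
    proof (rule image_subsetI)
      fix f assume f: "f \<in> w \<inter> outer W - {l}"
      then have "f \<in> w - {l}" by auto
      then have "p f \<in> p ` (x - {e})" unfolding eq[symmetric] by blast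
      then obtain g where g: "g \<in> x - {e}" "p f = p g" by auto
      have "f \<notin> x" using f wne outer_unique[of f W w x] wx by auto
      moreover have "l \<notin> x" using l wne outer_unique[of l W w x] wx by auto
      ultimately have "g \<notin> outer W"
        using inj_onD[OF inj(1) g(2)] f g(1) by auto
      then show "p f \<in> p ` (x \<inter> inner W - {e})" using g split[of g x] wx by auto
    qed
    moreover have "inj_on p (w \<inter> outer W - {l})"
      using inj(1) by (elim inj_on_subset) auto
    ultimately have "card (w \<inter> outer W - {l}) \<le> card (p ` (x \<inter> inner W - {e}))"
      using fin by (intro card_inj_on_le[of p]) auto
    also have "\<dots> \<le> card (x \<inter> inner W - {e})" using fin by (intro card_image_le) auto
    finally show ?thesis .
  qed
  have "card (w \<inter> outer W) = card (w \<inter> outer W - {l}) + 1"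
    using l fin card.remove[of "w \<inter> outer W" l] by simp
  moreover have "card (x \<inter> inner W) = card (x \<inter> inner W - {e}) + 1"
    using e fin card.remove[of "x \<inter> inner W" e] by simp
  ultimately show False using 1 2 \<open>apart w x\<close> by (auto simp: apart_def)
qed

text \<open>The matching \<open>{l, e}\<close> touches \<open>w\<close>, \<open>x\<close> and
  \<open>y\<close>. While \<open>apart\<close> separates \<open>w\<close> from the other two,
  \<open>x\<close> and \<open>y\<close> are separated because their remaining edges lie in one block
  of \<open>W'\<close> and so have disjoint colours.\<close>

lemma good_reduce:
  assumes w: "w \<in> W" "3 \<le> card w" and l: "l \<in> w" "l \<in> outer W"
    and xy: "x \<in> W" "y \<in> W" "x \<noteq> y" "w \<noteq> x" "w \<noteq> y" and e: "e \<in> x" "e \<in> y"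
    and apart: "apart w x" "apart w y"
  defines "W' \<equiv> insert (x \<union> y - {e}) (insert (w - {l}) (W - {w}) - {x, y})"
  shows "block_tree W'" "card W = card W' + 1" "card (outer W) = card (outer W') + 1"
    "\<lbrakk>good W' k p; inj_on p (inner W')\<rbrakk> \<Longrightarrow> \<exists>q. good W (Suc k) q \<and> inj_on q (inner W)"
proof -
  define W1 where "W1 = insert (w - {l}) (W - {w})"
  note del = block_tree_delete[OF w l, folded W1_def]
  interpret W1: block_tree W1 by (rule del(1))
  have xy1: "x \<in> W1" "y \<in> W1" using xy by (auto simp: W1_def)
  note con = W1.block_tree_contract[OF xy1 xy(3) e, folded W'_def[folded W1_def]]
  show "block_tree W'" by (rule con(1))
  show "card W = card W' + 1" using con(4) del(4) by simp
  show card_outer: "card (outer W) = card (outer W') + 1"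
    using con(3) del(3) l finite_outer
    by (metis One_nat_def Suc_pred add.commute card_Diff_singleton card_gt_0_iff empty_iff plus_1_eq_Suc)
  have e_inner: "e \<in> inner W" using xy e by (auto intro: innerI)
  have outer': "outer W' = outer W - {l}" and inner': "inner W' = inner W - {e}"
    using con(2,3) del(2,3) by auto
  have e_notin: "e \<notin> A" if "A \<in> W" "A \<noteq> x" "A \<noteq> y" for A
    using that no_three[of x y A e] xy e by auto
  have l_notin: "l \<notin> A" if "A \<in> W" "A \<noteq> w" for A
    using that outer_unique[OF l(2) w(1), of A] l by auto
  assume p: "good W' k p" and inj: "inj_on p (inner W')"
  define q where "q = p(l := Suc k, e := Suc k)"
  have le: "l \<noteq> e" using l(2) e_inner by (auto simp: outer_def)
  have mem: "w - {l} \<in> W'" "x \<union> y - {e} \<in> W'"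
    using xy del(5) by (auto simp: W'_def)
  have rest: "A \<in> W'" if "A \<in> W" "A \<noteq> w" "A \<noteq> x" "A \<noteq> y" for A
    using that by (auto simp: W'_def)
  have range: "p f \<le> k" "1 \<le> p f" if "f \<in> (w - {l}) \<union> (x - {e}) \<union> (y - {e})" for f
    using that good_range[OF p _ mem(1), of f] good_range[OF p _ mem(2), of f] by auto
  have new: "q l = Suc k" "q e = Suc k" by (auto simp: q_def)
  have old: "q f = p f" if "f \<noteq> l" "f \<noteq> e" for f using that by (simp add: q_def)
  have e_w: "e \<notin> w" using e_notin w xy by auto
  have l_xy: "l \<notin> z" if "z = x \<or> z = y" for z using l_notin that xy by auto
  have qw: "q ` w = insert (Suc k) (p ` (w - {l}))"
  proof -
    have "w = insert l (w - {l})" using l by auto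
    moreover have "q ` (w - {l}) = p ` (w - {l})"
      using e_w by (intro image_cong refl old) auto
    ultimately show ?thesis using new by (metis image_insert)
  qed
  have qx: "q ` z = insert (Suc k) (p ` (z - {e}))" if "z = x \<or> z = y" for z
  proof -
    have "z = insert e (z - {e})" using e that by auto
    moreover have "q ` (z - {e}) = p ` (z - {e})"
      using l_xy[OF that] by (intro image_cong refl old) auto
    ultimately show ?thesis using new by (metis image_insert)
  qed
  have inj_out: "inj_on p (outer W - {l})" using p outer' by (simp add: good_def)
  have inj_in: "inj_on p (inner W - {e})" using inj inner' by simp
  have no_new: "Suc k \<notin> p ` (w - {l})" "Suc k \<notin> p ` (x - {e})" "Suc k \<notin> p ` (y - {e})"
    using range(1) by (metis imageE UnI1 UnI2 Suc_n_not_le_n)+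
  have wx: "q ` w \<noteq> q ` z" if "z = x \<or> z = y" for z
  proof -
    have "p ` (w - {l}) \<noteq> p ` (z - {e})"
    proof (rule apart_image_neq)
      show "apart w z" "z \<in> W" "e \<in> z" using that apart xy e by auto
    qed (use e_w w(1) inj_out inj_in l e_inner in auto)
    then show ?thesis
      unfolding qw qx[OF that] using no_new that by (metis insert_ident)
  qed
  have inj_xy: "inj_on p (x \<union> y - {e})" using p mem(2) by (simp add: good_def)
  have xy_neq: "q ` x \<noteq> q ` y"
  proof -
    have disj: "x \<inter> y = {e}" using meet_unique[OF xy(1-3)] e by blast
    have "x - {e} \<noteq> {}"
      using card_block[OF xy(1)] e by (metis One_nat_def Suc_1 card.empty card_insert_disjoint finite.emptyI insert_Diff not_less_eq_eq empty_iff le_refl)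
    then obtain f where f: "f \<in> x - {e}" by auto
    have "p f \<notin> p ` (y - {e})"
    proof
      assume "p f \<in> p ` (y - {e})"
      then obtain g where "g \<in> y - {e}" "p f = p g" by auto
      then have "f = g" using inj_xy f by (auto dest: inj_onD)
      then show False using \<open>g \<in> y - {e}\<close> f disj by auto
    qed
    then have "p ` (x - {e}) \<noteq> p ` (y - {e})" using f by auto
    then show ?thesis unfolding qx[OF disjI1[OF refl]] qx[OF disjI2[OF refl]]
      using no_new by (metis insert_ident)
  qed
  have "good W (Suc k) q"
  proof (rule good_extend[OF p, where T = "{w, x, y}" and l = l])
    show "{w, x, y} \<subseteq> W" using w xy by auto
    show "W - {w, x, y} \<subseteq> W'" using rest by auto
    show "inj_on q A" if "A \<in> {w, x, y}" for A
    proof -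
      have "inj_on p (w - {l})" using p mem(1) by (simp add: good_def)
      moreover have "inj_on p (x - {e})" "inj_on p (y - {e})"
        using inj_xy by (auto elim: inj_on_subset)
      moreover have "inj_on q w" if "inj_on p (w - {l})"
      proof (rule inj_onI)
        fix f g assume "f \<in> w" "g \<in> w" "q f = q g"
        moreover note e_w
        moreover have "p h \<noteq> Suc k" if "h \<in> w - {l}" for h using range that by force
        ultimately show "f = g" using that new old by (metis DiffI inj_onD singletonD)
      qed
      moreover have "inj_on q z" if "inj_on p (z - {e})" "z = x \<or> z = y" for z
      proof (rule inj_onI)
        fix f g assume "f \<in> z" "g \<in> z" "q f = q g"
        moreover note l_xy[OF that(2)]
        moreover have "p h \<noteq> Suc k" if "h \<in> z - {e}" for h using range that \<open>z = x \<or> z = y\<close> by force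
        ultimately show "f = g" using that new old by (metis DiffI inj_onD singletonD)
      qed
      ultimately show ?thesis using that by auto
    qed
    show "Suc k \<in> q ` A" if "A \<in> {w, x, y}" for A
      using that qw qx by auto
    show "inj_on (image q) {w, x, y}"
    proof -
      have "q ` w \<noteq> q ` x" "q ` w \<noteq> q ` y" using wx by auto
      then show ?thesis using xy_neq unfolding inj_on_def by blast
    qed
    show "q ` \<Union> {w, x, y} \<subseteq> {1..Suc k}"
    proof -
      have "p ` (w - {l}) \<subseteq> {1..Suc k}" "p ` (x - {e}) \<subseteq> {1..Suc k}" "p ` (y - {e}) \<subseteq> {1..Suc k}"
        using range by (meson UnCI atLeastAtMost_iff image_subsetI le_SucI)+
      then show ?thesis using qw qx[of x] qx[of y] by (simp add: image_Un)
    qed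
    show "q f = p f" if "A \<in> W - {w, x, y}" "f \<in> A" for A f
    proof (rule old)
      show "f \<noteq> l" "f \<noteq> e" using that l_notin[of A] e_notin[of A] by auto
    qed
    show "outer W = insert l (outer W')" "l \<notin> outer W'" using outer' l by auto
    show "q f = p f" if "f \<in> outer W'" for f
      using that outer' e_inner by (intro old) (auto simp: outer_def)
  qed (rule new)
  \<comment> \<open>Among the inner edges only \<open>e\<close> has the new colour.\<close>
  moreover have "inj_on q (inner W)"
  proof -
    have "inj_on q (inner W - {e})"
      using inj_in l(2) by (auto simp: inj_on_def q_def outer_def)
    moreover have "q f \<noteq> q e" if "f \<in> inner W - {e}" for f
    proof -
      have "f \<in> \<Union>W'" using that inner' inner_subset[of W'] by auto
      then have "p f \<le> k" using p by (force simp: good_def)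
      moreover have "f \<noteq> l" using that l(2) by (auto simp: outer_def)
      ultimately show ?thesis using that new(2) old[of f] by auto
    qed
    ultimately have "inj_on q (insert e (inner W - {e}))"
      unfolding inj_on_insert by fastforce
    then show ?thesis using e_inner by (simp add: insert_absorb)
  qed
  ultimately show "\<exists>q. good W (Suc k) q \<and> inj_on q (inner W)" by blast
qed


section \<open>Choosing the edges to remove\<close>

lemma inner_Int_outer: "inner W \<inter> outer W = {}"
  by (auto simp: outer_def)

lemma block_cases: "\<lbrakk>A \<in> W; e \<in> A\<rbrakk> \<Longrightarrow> e \<in> inner W \<or> e \<in> outer W"
  by (auto simp: outer_def)

lemma other_block:
  assumes "e \<in> inner W" "A \<in> W" "e \<in> A"
  obtains B where "B \<in> W" "B \<noteq> A" "e \<in> B"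
  using assms by (auto simp: inner_def)

lemma card_meet_le: "\<lbrakk>A \<in> W; B \<in> W; A \<noteq> B\<rbrakk> \<Longrightarrow> card (A \<inter> B) \<le> 1"
  using meet_unique[of A B] finite_block[of A] by (auto simp: card_le_Suc0_iff_eq)

text \<open>Double counting: the blocks that are not \<open>apart\<close> from \<open>w\<close> would have to cover all inner
  edges off \<open>w\<close>, and then carry more pendant edges than the sparsity of the forest permits.\<close>

lemma ex_apart_edge:
  assumes w: "w \<in> W" "w \<inter> outer W \<noteq> {}" "2 \<le> card (w \<inter> inner W)"
    and le: "card (outer W) \<le> card (inner W)"
  obtains x y e where "x \<in> W" "y \<in> W" "x \<noteq> y" "w \<noteq> x" "w \<noteq> y" "e \<in> x" "e \<in> y" "apart w x" "apart w y"
proof -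
  \<comment> \<open>\<open>C\<close> holds the blocks for which the first clause of
    \<open>apart w\<close> fails. An inner edge off \<open>w\<close> with both ends outside
    \<open>C\<close> is what is sought. \<open>CN\<close> and \<open>CA\<close> are the blocks of
    \<open>C\<close> not adjacent and adjacent to \<open>w\<close>.\<close>
  define C where "C = {x \<in> W. x \<noteq> w \<and> card (w \<inter> inner W - x) \<le> card (x \<inter> outer W)}"
  define CN where "CN = {x \<in> C. w \<inter> x = {}}"
  define CA where "CA = {x \<in> C. w \<inter> x \<noteq> {}}"
  define D where "D = W - {w} - C"
  define D0 where "D0 = {x \<in> D. x \<inter> outer W = {}}"
  have fin: "finite C" "finite CN" "finite CA" "finite D" "finite D0"
    using finite_blocks by (auto simp: C_def CN_def CA_def D_def D0_def)
  have sub: "C \<subseteq> W" "D \<subseteq> W" "D0 \<subseteq> W" "CA \<subseteq> W" "CN \<subseteq> W"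
    by (auto simp: C_def D_def D0_def CA_def CN_def)
  have C_split: "C = CN \<union> CA" "CN \<inter> CA = {}" by (auto simp: CN_def CA_def)
  have card_C: "card C = card CN + card CA"
    unfolding C_split(1) using fin C_split(2) by (simp add: card_Un_disjoint)
  show thesis
  proof (cases "\<exists>x\<in>W. \<exists>y\<in>W. \<exists>e. x \<noteq> y \<and> w \<noteq> x \<and> w \<noteq> y \<and> e \<in> x \<and> e \<in> y \<and> x \<notin> C \<and> y \<notin> C")
    case True
    then show thesis using that by (force simp: C_def apart_def not_le)
  next
    case False
    then have cover: "x \<in> C \<or> y \<in> C"
      if "x \<in> W" "y \<in> W" "x \<noteq> y" "w \<noteq> x" "w \<noteq> y" "e \<in> x" "e \<in> y" for x y e
      using that by blast
    have CN_ge: "2 \<le> card (x \<inter> outer W)" if "x \<in> CN" for x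
    proof -
      have "w \<inter> inner W - x = w \<inter> inner W" using that by (auto simp: CN_def)
      then show ?thesis using that w(3) by (auto simp: CN_def C_def)
    qed
    have CA_ge: "1 \<le> card (x \<inter> outer W)" if "x \<in> CA" for x
    proof -
      have x: "x \<in> W" "x \<noteq> w" using that by (auto simp: CA_def C_def)
      have "card (w \<inter> inner W) \<le> card (w \<inter> x) + card (w \<inter> inner W - x)"
        using finite_block[OF w(1)] by (intro order.trans[OF card_mono card_Un_le]) auto
      moreover have "card (w \<inter> x) \<le> 1" using x w(1) by (intro card_meet_le) auto
      ultimately show ?thesis using that w(3) by (auto simp: CA_def C_def)
    qed
    have "card (outer W) \<ge> 1 + 2 * card CN + card CA + card (D - D0)"
    proof -
      have "w \<notin> C" "w \<notin> D" "C \<inter> D = {}" "W = insert w (C \<union> D)"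
        using w(1) by (auto simp: C_def D_def)
      then have "(\<Sum>A\<in>W. card (A \<inter> outer W)) = card (w \<inter> outer W)
          + ((\<Sum>A\<in>C. card (A \<inter> outer W)) + (\<Sum>A\<in>D. card (A \<inter> outer W)))"
        using fin by (metis UnE finite_Un sum.insert sum.union_disjoint)
      moreover have "1 \<le> card (w \<inter> outer W)"
        using w finite_block by (metis One_nat_def Suc_leI card_gt_0_iff finite_Int)
      moreover have "2 * card CN + card CA \<le> (\<Sum>A\<in>C. card (A \<inter> outer W))"
      proof -
        have "(\<Sum>A\<in>C. card (A \<inter> outer W)) = (\<Sum>A\<in>CN. card (A \<inter> outer W)) + (\<Sum>A\<in>CA. card (A \<inter> outer W))"
          unfolding C_split(1) using fin C_split(2) by (intro sum.union_disjoint)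
        then show ?thesis
          using sum_bounded_below[of CN 2 "\<lambda>A. card (A \<inter> outer W)"] CN_ge
            sum_bounded_below[of CA 1 "\<lambda>A. card (A \<inter> outer W)"] CA_ge by fastforce
      qed
      moreover have "card (D - D0) \<le> (\<Sum>A\<in>D. card (A \<inter> outer W))"
      proof -
        have "1 \<le> card (A \<inter> outer W)" if "A \<in> D - D0" for A
          using that finite_block[of A] sub by (auto simp: D0_def card_gt_0_iff Suc_le_eq)
        then have "card (D - D0) \<le> (\<Sum>A\<in>D - D0. card (A \<inter> outer W))"
          using sum_bounded_below[of "D - D0" 1 "\<lambda>A. card (A \<inter> outer W)"] by simp
        also have "\<dots> \<le> (\<Sum>A\<in>D. card (A \<inter> outer W))"
          using fin by (intro sum_mono2) auto
        finally show ?thesis .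
      qed
      ultimately show ?thesis using sum_outer by linarith
    qed
    moreover have "card (inner W) = card C + card D"
    proof -
      have "card (C \<union> D) = card C + card D" using fin by (intro card_Un_disjoint) (auto simp: D_def)
      moreover have "W = insert w (C \<union> D)" "w \<notin> C \<union> D" using w(1) by (auto simp: C_def D_def)
      ultimately show ?thesis using card_blocks fin by simp
    qed
    moreover have "card D = card D0 + card (D - D0)"
      using fin card_Diff_subset[of D0 D] card_mono[of D D0] by (auto simp: D0_def)
    \<comment> \<open>First estimate: blocks in \<open>CN\<close> have two pendant edges each, yet
      there are at most \<open>card C + card D\<close> pendant edges in all, so blocks without
      pendant edges, those in \<open>D0\<close>, must compensate.\<close>
    ultimately have 1: "1 + card CN \<le> card D0"
      using le card_C by linarith
    \<comment> \<open>Second estimate: by \<open>cover\<close> the blocks in \<open>D0\<close> are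
      pairwise disjoint and all their edges end inside \<open>S\<close>. These edges, at least twice
      \<open>card D0\<close>, and the edges from \<open>w\<close> to \<open>CA\<close> number fewer
      than \<open>card S\<close>, which bounds \<open>card D0\<close> from above.\<close>
    define S where "S = insert w (C \<union> D0)"
    have D0_disj: "A \<inter> B = {}" if "A \<in> D0" "B \<in> D0" "A \<noteq> B" for A B
    proof (rule ccontr)
      assume "A \<inter> B \<noteq> {}"
      then obtain e where "e \<in> A" "e \<in> B" by auto
      then have "A \<in> C \<or> B \<in> C" using that by (intro cover[of A B e]) (auto simp: D0_def D_def)
      then show False using that by (auto simp: D0_def D_def)
    qed
    have U0: "\<Union>D0 \<subseteq> inner S"
    proof
      fix e assume "e \<in> \<Union>D0"
      then obtain A where A: "A \<in> D0" "e \<in> A" by auto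
      have "A \<in> W" using A(1) sub(3) by blast
      moreover have "e \<in> inner W"
        using block_cases[OF \<open>A \<in> W\<close> A(2)] A by (auto simp: D0_def)
      ultimately obtain B where B: "B \<in> W" "B \<noteq> A" "e \<in> B" using A(2) by (elim other_block)
      have "B \<in> S"
      proof (cases "B = w")
        case False
        have "w \<noteq> A" "A \<notin> C" using A by (auto simp: D0_def D_def)
        then have "B \<in> C" using cover[of A B e] A B False \<open>A \<in> W\<close> by auto
        then show ?thesis by (simp add: S_def)
      qed (simp add: S_def)
      then show "e \<in> inner S"
        using A B by (intro innerI[of A S B]) (auto simp: S_def)
    qed
    have UA: "(\<Union>x\<in>CA. w \<inter> x) \<subseteq> inner S"
      unfolding S_def by (auto simp: CA_def C_def intro!: innerI[of w])
    have disj: "\<Union>D0 \<inter> (\<Union>x\<in>CA. w \<inter> x) = {}"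
    proof (rule ccontr)
      assume "\<Union>D0 \<inter> (\<Union>x\<in>CA. w \<inter> x) \<noteq> {}"
      then obtain e A x where ex: "e \<in> A" "A \<in> D0" "x \<in> CA" "e \<in> w" "e \<in> x" by auto
      then have "A \<in> W" "x \<in> W" "A \<noteq> w" "x \<noteq> w" "A \<noteq> x"
        by (auto simp: D0_def D_def CA_def C_def)
      then show False using no_three[of A x w e] ex w(1) by auto
    qed
    have "card (\<Union>D0) = (\<Sum>A\<in>D0. card A)"
      using D0_disj finite_block sub by (intro card_Union_disjoint) (auto simp: pairwise_def disjnt_def)
    then have "2 * card D0 \<le> card (\<Union>D0)"
      using sum_bounded_below[of D0 2 card] card_block sub by (auto simp: subset_iff mult.commute)
    moreover have "card (\<Union>x\<in>CA. w \<inter> x) = card CA"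
    proof -
      have "card (\<Union>x\<in>CA. w \<inter> x) = (\<Sum>x\<in>CA. card (w \<inter> x))"
      proof (rule card_UN_disjoint)
        show "\<forall>i\<in>CA. \<forall>j\<in>CA. i \<noteq> j \<longrightarrow> w \<inter> i \<inter> (w \<inter> j) = {}"
          using no_three[OF w(1)] by (fastforce simp: CA_def C_def)
      qed (use fin finite_block[OF w(1)] in auto)
      also have "\<dots> = (\<Sum>x\<in>CA. 1)"
      proof (rule sum.cong[OF refl])
        fix x assume x: "x \<in> CA"
        then have "card (w \<inter> x) \<le> 1" using w(1) by (intro card_meet_le) (auto simp: CA_def C_def)
        moreover have "card (w \<inter> x) \<noteq> 0" using x finite_block[OF w(1)] by (auto simp: CA_def)
        ultimately show "card (w \<inter> x) = 1" by linarith
      qed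
      finally show ?thesis by simp
    qed
    moreover have fin_S: "finite (inner S)"
      using finite_inner inner_mono[of S W] w(1) sub by (auto simp: S_def intro: finite_subset)
    have "card (\<Union>D0) + card (\<Union>x\<in>CA. w \<inter> x) \<le> card (inner S)"
    proof -
      have "finite (\<Union>D0)" "finite (\<Union>x\<in>CA. w \<inter> x)" using fin_S U0 UA finite_subset by blast+
      then have "card (\<Union>D0) + card (\<Union>x\<in>CA. w \<inter> x) = card (\<Union>D0 \<union> (\<Union>x\<in>CA. w \<inter> x))"
        using disj by (intro card_Un_disjoint[symmetric]) auto
      also have "\<dots> \<le> card (inner S)" using fin_S U0 UA by (intro card_mono) auto
      finally show ?thesis .
    qed
    moreover have "card (inner S) < card S"
      using sub w(1) by (intro sparse) (auto simp: S_def)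
    moreover have "card S \<le> 1 + card C + card D0"
    proof -
      have "card S \<le> Suc (card (C \<union> D0))" unfolding S_def using fin by (intro card_insert_le_m1) auto
      then show ?thesis using card_Un_le[of C D0] by linarith
    qed
    ultimately have "card D0 \<le> card CN"
      using card_C by linarith
    then show thesis using 1 by linarith
  qed
qed

text \<open>This is the star with every edge subdivided once. None of its blocks has both a pendant
  edge and size three, so no reduction can start there and it is coloured directly.\<close>

definition spider :: "'e set \<Rightarrow> bool" where
  "spider c \<longleftrightarrow> c \<in> W \<and> c \<inter> outer W = {} \<and> (\<forall>A\<in>W - {c}. card (A \<inter> outer W) = 1 \<and> A \<inter> c \<noteq> {})"

text \<open>If a block has a pendant edge and two inner edges, \<open>ex_apart_edge\<close> applies.
  Otherwise all pendant edges sit at the ends of the inner tree, and an end with two of them serves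
  as \<open>w\<close>. If every such end has only one, counting leaves exactly one block without
  pendant edges, the centre of a spider.\<close>

lemma ex_reduction:
  assumes eq: "card (outer W) = card (inner W)" and card: "3 \<le> card W" and no_spider: "\<nexists>c. spider c"
  obtains w l x y e where "w \<in> W" "3 \<le> card w" "l \<in> w" "l \<in> outer W"
    "x \<in> W" "y \<in> W" "x \<noteq> y" "w \<noteq> x" "w \<noteq> y" "e \<in> x" "e \<in> y" "apart w x" "apart w y"
proof (cases "\<exists>w\<in>W. w \<inter> outer W \<noteq> {} \<and> 2 \<le> card (w \<inter> inner W)")
  case True
  then obtain w where w: "w \<in> W" "w \<inter> outer W \<noteq> {}" "2 \<le> card (w \<inter> inner W)" by auto
  then obtain l where l: "l \<in> w" "l \<in> outer W" by auto
  have "0 < card (w \<inter> outer W)" using l finite_block[OF w(1)] by (auto simp: card_gt_0_iff)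
  then have "3 \<le> card w" using card_block_split[OF w(1)] w(3) by linarith
  moreover obtain x y e where "x \<in> W" "y \<in> W" "x \<noteq> y" "w \<noteq> x" "w \<noteq> y" "e \<in> x" "e \<in> y" "apart w x" "apart w y"
    using ex_apart_edge[OF w] eq by (metis order_refl)
  ultimately show thesis using that w(1) l by blast
next
  case False
  have inner1: "card (A \<inter> inner W) = 1" if "A \<in> W" "A \<inter> outer W \<noteq> {}" for A
  proof -
    have "card (A \<inter> inner W) \<noteq> 0" using ex_inner[OF that(1)] card finite_block[OF that(1)] by simp
    moreover have "\<not> 2 \<le> card (A \<inter> inner W)" using that False by auto
    ultimately show ?thesis by linarith
  qed
  define Q where "Q = {A \<in> W. A \<inter> outer W \<noteq> {}}"
  have finQ: "finite Q" "Q \<subseteq> W" using finite_blocks by (auto simp: Q_def)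
  have sumQ: "(\<Sum>A\<in>Q. card (A \<inter> outer W)) = card (outer W)"
  proof -
    have "(\<Sum>A\<in>Q. card (A \<inter> outer W)) = (\<Sum>A\<in>W. card (A \<inter> outer W))"
      using finite_blocks by (intro sum.mono_neutral_left) (auto simp: Q_def)
    then show ?thesis using sum_outer by simp
  qed
  have Q_pos: "1 \<le> card (A \<inter> outer W)" if "A \<in> Q" for A
    using that finite_block[of A] by (auto simp: Q_def card_gt_0_iff Suc_le_eq)
  show thesis
  proof (cases "\<exists>w\<in>Q. 2 \<le> card (w \<inter> outer W)")
    case False
    then have one: "card (A \<inter> outer W) = 1" if "A \<in> Q" for A
      using that Q_pos[OF that] by (metis One_nat_def Suc_1 le_antisym not_less_eq_eq)
    have "card Q = card (inner W)" using sumQ one eq by simp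
    then have "card (W - Q) = 1" using card_blocks finQ by (simp add: card_Diff_subset)
    then obtain c where c: "W - Q = {c}" by (meson card_1_singletonE)
    have "A \<inter> c \<noteq> {}" if "A \<in> W - {c}" for A
    proof
      assume Ac: "A \<inter> c = {}"
      have A: "A \<in> Q" "A \<in> W" using that c by auto
      have "card (A \<inter> inner W) = 1" using inner1[OF A(2)] A(1) by (simp add: Q_def)
      then obtain e where e: "A \<inter> inner W = {e}" by (rule card_1_singletonE)
      obtain B where B: "B \<in> W" "B \<noteq> A" "e \<in> B" using other_block[of e A] e A(2) by auto
      have "B \<noteq> c" using B(3) e Ac by auto
      then have "B \<in> Q" using B(1) c by auto
      then have "card (B \<inter> inner W) = 1" using inner1[OF B(1)] by (simp add: Q_def)
      then obtain f where f: "B \<inter> inner W = {f}" by (rule card_1_singletonE)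
      then have "f = e" using B(3) e by auto
      \<comment> \<open>\<open>e\<close> is the only inner edge of \<open>A\<close> and of
        \<open>B\<close>, so these two blocks form a component and no room is left for
        \<open>c\<close>.\<close>
      have "{A, B} = W"
      proof (rule closed_eq_all)
        fix D F g assume g: "D \<in> {A, B}" "F \<in> W" "g \<in> D" "g \<in> F"
        show "F \<in> {A, B}"
        proof (rule ccontr)
          assume F: "F \<notin> {A, B}"
          then have "g \<in> inner W" using g A(2) B(1) by (auto intro: innerI[of D _ F])
          then have "g = e" using g(1,3) e f \<open>f = e\<close> by auto
          then show False using no_three[of A B F e] A(2) B g F e by auto
        qed
      qed (use A B in auto)
      then have "W \<subseteq> Q" using A \<open>B \<in> Q\<close> by auto
      then show False using c by auto
    qed
    moreover have "c \<in> W" "c \<inter> outer W = {}" "\<And>A. A \<in> W - {c} \<Longrightarrow> A \<in> Q" using c by (auto simp: Q_def)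
    ultimately have "spider c" using one by (simp add: spider_def)
    then show thesis using no_spider by blast
  next
    case True
    then obtain w where w: "w \<in> Q" "2 \<le> card (w \<inter> outer W)" by auto
    have wW: "w \<in> W" using w(1) finQ by auto
    have "card (w \<inter> inner W) = 1" using inner1[OF wW] w(1) by (simp add: Q_def)
    then obtain f where f: "w \<inter> inner W = {f}" by (rule card_1_singletonE)
    obtain v where v: "v \<in> W" "v \<noteq> w" "f \<in> v" using other_block[of f w] f wW by auto
    have card_w: "3 \<le> card w" using card_block_split[OF wW] w(2) f by simp
    obtain l where l: "l \<in> w" "l \<in> outer W" using w(1) by (auto simp: Q_def)
    show thesis
    proof (cases "inner W \<subseteq> v")
      case False
      then obtain e where e: "e \<in> inner W" "e \<notin> v" by auto
      then obtain x y where xy: "x \<in> W" "y \<in> W" "x \<noteq> y" "e \<in> x" "e \<in> y" by (auto simp: inner_def)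
      have e_w: "e \<notin> w"
      proof
        assume "e \<in> w"
        then have "e \<in> {f}" using e(1) unfolding f[symmetric] by simp
        then show False using e(2) v(3) by simp
      qed
      \<comment> \<open>A block without pendant edges does not contain \<open>f\<close>, which gives
        the first clause; a block with pendant edges has one inner edge against at least two pendant
        edges of \<open>w\<close>.\<close>
      have ap: "apart w z" if z: "z \<in> W" "e \<in> z" for z
      proof (cases "z \<inter> outer W = {}")
        case True
        have "f \<in> w" using f by blast
        then have "f \<notin> z" using no_three[OF wW v(1) z(1), of f] z(2) v(2,3) e(2) e_w by blast
        then have "w \<inter> inner W - z = {f}" unfolding f by auto
        then show ?thesis using True by (simp add: apart_def)
      next
        case False
        then show ?thesis using inner1[OF z(1)] w(2) by (simp add: apart_def)
      qed
      show thesis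
        using that[OF wW card_w l xy(1-3) _ _ xy(4,5) ap ap] xy e_w by auto
    next
      case True
      have fv: "finite v" using v finite_block by auto
      have "v \<inter> inner W = inner W" using True by auto
      then have v0: "v \<inter> outer W = {}" using inner1[OF v(1)] card card_blocks by (cases "v \<inter> outer W = {}") simp_all
      \<comment> \<open>All inner edges meet at \<open>v\<close>, so every other block has a pendant
        edge and \<open>w\<close> has two, which makes more pendant than inner edges.\<close>
      have "card W - 1 + 1 \<le> (\<Sum>A\<in>W - {v}. card (A \<inter> outer W))"
      proof -
        have pos: "1 \<le> card (A \<inter> outer W)" if A: "A \<in> W - {v}" for A
        proof -
          have "card (A \<inter> inner W) \<le> card (A \<inter> v)" using True fv by (intro card_mono) auto
          also have "\<dots> \<le> 1" using A v by (intro card_meet_le) auto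
          finally show ?thesis using card_block_split[of A] card_block[of A] A by auto
        qed
        have "(\<Sum>A\<in>W - {v}. card (A \<inter> outer W)) = card (w \<inter> outer W) + (\<Sum>A\<in>W - {v} - {w}. card (A \<inter> outer W))"
          using finite_blocks wW v by (intro sum.remove) auto
        moreover have "card (W - {v} - {w}) \<le> (\<Sum>A\<in>W - {v} - {w}. card (A \<inter> outer W))"
          using sum_bounded_below[of "W - {v} - {w}" 1 "\<lambda>A. card (A \<inter> outer W)"] pos by simp
        moreover have "card (W - {v} - {w}) = card W - 2" using wW v finite_blocks by simp
        ultimately show ?thesis using w(2) card by linarith
      qed
      moreover have "(\<Sum>A\<in>W - {v}. card (A \<inter> outer W)) \<le> card (outer W)"
        unfolding sum_outer[symmetric] using finite_blocks by (intro sum_mono2) auto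
      ultimately show thesis using eq card_blocks by linarith
    qed
  qed
qed

text \<open>Otherwise each block has at most one pendant edge, and comparison with
  \<open>card W\<close> forces exactly one, in blocks of size two. By \<open>sum_excess\<close>
  there are then only two pendant edges, too few for three inner edges.\<close>

lemma ex_removable:
  assumes less: "card (inner W) < card (outer W)" and card: "4 \<le> card W"
  obtains A l where "A \<in> W" "3 \<le> card A" "l \<in> A" "l \<in> outer W"
proof (cases "\<exists>A\<in>W. 3 \<le> card A \<and> A \<inter> outer W \<noteq> {}")
  case False
  have le: "card (A \<inter> outer W) \<le> 1" if "A \<in> W" for A
  proof (cases "A \<inter> outer W = {}")
    case ne: False
    then have "card A < 3" using False that by auto
    moreover have "0 < card (A \<inter> inner W)"
      using ex_inner[OF that] card finite_block[OF that] by (auto simp: card_gt_0_iff)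
    ultimately show ?thesis using card_block_split[OF that] by linarith
  qed simp
  define Q where "Q = {A \<in> W. A \<inter> outer W \<noteq> {}}"
  have "card (outer W) = (\<Sum>A\<in>Q. card (A \<inter> outer W))"
    unfolding sum_outer[symmetric] using finite_blocks
    by (intro sum.mono_neutral_right) (auto simp: Q_def)
  also have "\<dots> \<le> card Q" using sum_bounded_above[of Q "\<lambda>A. card (A \<inter> outer W)" 1] le by (simp add: Q_def)
  finally have "card W \<le> card Q" using less card_blocks by linarith
  then have "Q = W" using finite_blocks by (intro card_seteq) (auto simp: Q_def)
  have "card A - 2 = 0" if "A \<in> W" for A
  proof -
    have "A \<in> Q" using that \<open>Q = W\<close> by simp
    then have "\<not> 3 \<le> card A" using False by (auto simp: Q_def)
    then show ?thesis by simp
  qed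
  then have "card (outer W) = 2" using sum_excess by simp
  then show thesis using less card card_blocks by linarith
qed (use that in blast)

end

section \<open>At most as many inner edges as pendant edges\<close>

text \<open>Three colours have exactly four subsets of size at least two, so the four blocks must
  receive all of them. The colourings here and in the next lemma are chosen accordingly.\<close>

lemma path_colouring_end:
  assumes dist: "distinct [x, y, z, e, f, g]" and W: "W = {{x, y, e}, {e, f}, {f, g}, {g, z}}"
    and outer: "outer W = {x, y, z}" and inner: "inner W = {e, f, g}"
  shows "\<exists>p. good W 3 p \<and> inj_on p (inner W)"
proof -
  define p where "p = (\<lambda>_. 0::nat)(x := 1, y := 2, z := 3, e := 3, f := 1, g := 2)"
  have p: "p x = 1" "p y = 2" "p z = 3" "p e = 3" "p f = 1" "p g = 2"
    using dist by (auto simp: p_def)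
  have "{1, 2, 3::nat} \<noteq> {3, 1}" "{1, 2, 3::nat} \<noteq> {1, 2}" "{1, 2, 3::nat} \<noteq> {2, 3}"
    "{3, 1::nat} \<noteq> {1, 2}" "{3, 1::nat} \<noteq> {2, 3}" "{1, 2::nat} \<noteq> {2, 3}"
    by (simp_all add: set_eq_iff; presburger)+
  note neq = this this[symmetric]
  have "p ` A = p ` B \<longrightarrow> A = B" if "A \<in> W" "B \<in> W" for A B
    using that unfolding W by (elim insertE emptyE; simp add: p neq del: One_nat_def)
  then have "inj_on (image p) W" by (simp add: inj_on_def)
  then have "good W 3 p"
    unfolding good_def outer using p by (auto simp: W)
  moreover have "inj_on p (inner W)" unfolding inner using p by auto
  ultimately show ?thesis by blast
qed

lemma path_colouring_mid:
  assumes dist: "distinct [x, y, z, e, f, g]" and W: "W = {{x, e}, {y, e, f}, {f, g}, {g, z}}"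
    and outer: "outer W = {x, y, z}" and inner: "inner W = {e, f, g}"
  shows "\<exists>p. good W 3 p \<and> inj_on p (inner W)"
proof -
  define p where "p = (\<lambda>_. 0::nat)(x := 2, y := 1, z := 3, e := 3, f := 2, g := 1)"
  have p: "p x = 2" "p y = 1" "p z = 3" "p e = 3" "p f = 2" "p g = 1"
    using dist by (auto simp: p_def)
  have "{1, 3, 2::nat} \<noteq> {2, 3}" "{1, 3, 2::nat} \<noteq> {2, 1}" "{1, 3, 2::nat} \<noteq> {1, 3}"
    "{2, 3::nat} \<noteq> {2, 1}" "{2, 3::nat} \<noteq> {1, 3}" "{2, 1::nat} \<noteq> {1, 3}"
    by (simp_all add: set_eq_iff; presburger)+
  note neq = this this[symmetric]
  have "p ` A = p ` B \<longrightarrow> A = B" if "A \<in> W" "B \<in> W" for A B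
    using that unfolding W by (elim insertE emptyE; simp add: p neq del: One_nat_def)
  then have "inj_on (image p) W" by (simp add: inj_on_def)
  then have "good W 3 p"
    unfolding good_def outer using p by (auto simp: W)
  moreover have "inj_on p (inner W)" unfolding inner using p by auto
  ultimately show ?thesis by blast
qed

context block_tree
begin

lemma block_eq: "A \<in> W \<Longrightarrow> A = (A \<inter> outer W) \<union> (A \<inter> inner W)"
  using block_cases by blast

text \<open>The legs receive the cyclically consecutive pairs of colours. With at least three legs
  these pairs are different, and the centre sees at least three colours.\<close>

lemma ex_good_spider:
  assumes c: "spider c" and card: "4 \<le> card W"
  shows "\<exists>p. good W (card (outer W)) p \<and> inj_on p (inner W)"
proof -
  have cW: "c \<in> W" and c_outer: "c \<inter> outer W = {}"
    and legs: "\<And>A. A \<in> W - {c} \<Longrightarrow> card (A \<inter> outer W) = 1" "\<And>A. A \<in> W - {c} \<Longrightarrow> A \<inter> c \<noteq> {}"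
    using c by (auto simp: spider_def)
  have inner_c: "inner W = c"
  proof
    show "c \<subseteq> inner W" using block_cases[OF cW] c_outer by blast
    show "inner W \<subseteq> c"
    proof
      fix e assume "e \<in> inner W"
      then obtain A B where AB: "A \<in> W" "B \<in> W" "A \<noteq> B" "e \<in> A" "e \<in> B" by (auto simp: inner_def)
      show "e \<in> c"
      proof (rule ccontr)
        assume "e \<notin> c"
        then have ne: "A \<noteq> c" "B \<noteq> c" using AB by auto
        then obtain f g where "f \<in> A" "f \<in> c" "g \<in> B" "g \<in> c"
          using legs(2)[of A] legs(2)[of B] AB by blast
        then show False using no_triangle[OF AB(1,2) cW AB(3) ne(2,1) AB(4,5)] by blast
      qed
    qed
  qed
  have "\<exists>l. {i, l} \<in> W - {c} \<and> l \<in> outer W" if i: "i \<in> c" for i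
  proof -
    obtain B where B: "B \<in> W" "B \<noteq> c" "i \<in> B"
      using other_block[of i c] i cW inner_c by auto
    have "card (B \<inter> outer W) = 1" using legs(1)[of B] B by simp
    then obtain l where l: "B \<inter> outer W = {l}" by (rule card_1_singletonE)
    have "j = i" if "j \<in> B" "j \<in> c" for j
      using meet_unique[OF B(1) cW B(2)] that B(3) i by blast
    then have "B \<inter> inner W = {i}" unfolding inner_c using B(3) i by blast
    then have "B = {i, l}" using block_eq[OF B(1)] l by blast
    moreover have "l \<in> outer W" using l by blast
    ultimately show ?thesis using B by auto
  qed
  then obtain lf where lf: "{i, lf i} \<in> W - {c}" "lf i \<in> outer W" if "i \<in> c" for i
    by metis
  have blocks: "W - {c} = (\<lambda>i. {i, lf i}) ` c"
  proof
    show "W - {c} \<subseteq> (\<lambda>i. {i, lf i}) ` c"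
    proof
      fix A assume A: "A \<in> W - {c}"
      then obtain i where i: "i \<in> A" "i \<in> c" using legs(2) by blast
      then have "A = {i, lf i}" using no_three[of A c "{i, lf i}" i] lf(1)[of i] A cW by auto
      then show "A \<in> (\<lambda>i. {i, lf i}) ` c" using i by blast
    qed
  qed (use lf in auto)
  have lf_notin: "lf i \<notin> c" if "i \<in> c" for i
    using lf(2)[OF that] c_outer by blast
  have inj_lf: "inj_on lf c"
  proof (rule inj_onI)
    fix i j assume ij: "i \<in> c" "j \<in> c" "lf i = lf j"
    then have "{i, lf i} = {j, lf j}"
      using outer_unique[OF lf(2)[OF ij(1)], of "{i, lf i}" "{j, lf j}"] lf(1)[OF ij(1)] lf(1)[OF ij(2)] by auto
    then show "i = j" using lf_notin[OF ij(1)] lf_notin[OF ij(2)] ij by (metis doubleton_eq_iff)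
  qed
  have outer: "outer W = lf ` c"
  proof
    show "outer W \<subseteq> lf ` c"
    proof
      fix e assume e: "e \<in> outer W"
      then obtain A where A: "A \<in> W" "e \<in> A" by (auto simp: outer_def)
      then have "A \<in> W - {c}" using e c_outer by auto
      then obtain i where i: "i \<in> c" "A = {i, lf i}" using blocks by blast
      have "e \<noteq> i" using e i c_outer by auto
      then show "e \<in> lf ` c" using A i by auto
    qed
  qed (use lf in auto)
  define m where "m = card c"
  have m: "3 \<le> m" "card (outer W) = m"
    using card card_blocks inner_c inj_lf by (auto simp: m_def outer card_image)
  obtain h where h: "bij_betw h c {0..<m}"
    using finite_block[OF cW] ex_bij_betw_finite_nat m_def by blast
  have h_less: "h i < m" if "i \<in> c" for i using h that by (auto simp: bij_betw_def)
  have h_inj: "i = j" if "i \<in> c" "j \<in> c" "h i = h j" for i j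
    using h that by (auto simp: bij_betw_def dest: inj_onD)
  \<comment> \<open>The cyclic successor of colour \<open>a + 1\<close> in \<open>{1..m}\<close>;
    legs are numbered from zero, colours from one.\<close>
  define s where "s a = (if a + 1 = m then 1 else a + 2)" for a :: nat
  define p where "p e = (if e \<in> c then s (h e) else h (the_inv_into c lf e) + 1)" for e
  have p: "p i = s (h i)" "p (lf i) = h i + 1" if "i \<in> c" for i
    using that lf_notin[OF that] the_inv_into_f_f[OF inj_lf that] by (auto simp: p_def)
  have s_inj: "a = b" if "s a = s b" "a < m" "b < m" for a b
    using that m by (auto simp: s_def split: if_splits)
  have s_neq: "s a \<noteq> a + 1" if "a < m" for a
    using that m by (auto simp: s_def)
  have s_pair: "a = b" if "{s a, a + 1} = {s b, b + 1}" "a < m" "b < m" for a b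
    using that m by (auto simp: s_def doubleton_eq_iff split: if_splits)
  have inj_c: "inj_on p c"
    using s_inj h_less h_inj p(1) by (metis inj_onI)
  have image_leg: "p ` {i, lf i} = {s (h i), h i + 1}" if "i \<in> c" for i
    using p that by simp
  have card_c: "card (p ` c) = m" using inj_c by (simp add: card_image m_def)
  have neq_c: "p ` A \<noteq> p ` c" if A: "A \<in> W - {c}" for A
  proof -
    obtain i where "i \<in> c" "A = {i, lf i}" using A blocks by blast
    then have "card (p ` A) \<le> 2" using image_leg card_insert_le_m1[of 2 "{h i + 1}" "s (h i)"] by simp
    then show ?thesis using card_c m by auto
  qed
  have "inj_on (image p) W"
  proof (rule inj_onI)
    fix A B assume AB: "A \<in> W" "B \<in> W" "p ` A = p ` B"
    show "A = B"
    proof (cases "A = c \<or> B = c")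
      case True then show ?thesis using AB neq_c by (metis DiffI singletonD)
    next
      case False
      then have "A \<in> (\<lambda>i. {i, lf i}) ` c" "B \<in> (\<lambda>i. {i, lf i}) ` c"
        unfolding blocks[symmetric] using AB by simp_all
      then obtain i j where ij: "i \<in> c" "A = {i, lf i}" "j \<in> c" "B = {j, lf j}" by auto
      then have "h i = h j" using AB(3) image_leg s_pair h_less by metis
      then show ?thesis using h_inj ij by auto
    qed
  qed
  moreover have "inj_on p A" if "A \<in> W" for A
  proof (cases "A = c")
    case False
    then have "A \<in> (\<lambda>i. {i, lf i}) ` c" unfolding blocks[symmetric] using that by simp
    then obtain i where i: "i \<in> c" "A = {i, lf i}" by auto
    then show ?thesis using p[OF i(1)] s_neq[OF h_less[OF i(1)]] by auto
  qed (simp add: inj_c)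
  moreover have "inj_on p (outer W)"
    unfolding outer using p(2) h_inj by (auto simp: inj_on_def)
  moreover have "p ` \<Union>W \<subseteq> {1..m}"
  proof (rule image_subsetI)
    fix e assume "e \<in> \<Union>W"
    then have "e \<in> inner W \<union> outer W" by (auto simp: outer_def)
    then obtain i where i: "i \<in> c" "e = i \<or> e = lf i" by (auto simp: inner_c outer)
    have "s (h i) \<in> {1..m}" using h_less[OF i(1)] by (auto simp: s_def)
    then show "p e \<in> {1..m}" using p[OF i(1)] h_less[OF i(1)] i(2) by auto
  qed
  ultimately have "good W m p" by (simp add: good_def)
  then show ?thesis using inj_c inner_c m by auto
qed

text \<open>A block other than \<open>b\<close> has at most one inner edge and hence a pendant edge.
  As there are only \<open>card W - 1\<close> pendant edges, each of these blocks has exactly one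
  and \<open>b\<close> has none.\<close>

lemma spiderI:
  assumes b: "b \<in> W" "inner W \<subseteq> b" and eq: "card (outer W) = card (inner W)" and card: "3 \<le> card W"
  shows "spider b"
proof -
  have pos: "1 \<le> card (A \<inter> outer W)" if A: "A \<in> W - {b}" for A
  proof -
    have "card (A \<inter> inner W) \<le> card (A \<inter> b)" using b finite_block by (intro card_mono) auto
    also have "\<dots> \<le> 1" using A b by (intro card_meet_le) auto
    finally show ?thesis using card_block_split[of A] card_block[of A] A by auto
  qed
  have sum: "card (b \<inter> outer W) + (\<Sum>A\<in>W - {b}. card (A \<inter> outer W)) = card W - 1"
    using sum.remove[OF finite_blocks b(1), of "\<lambda>A. card (A \<inter> outer W)"] sum_outer eq card_blocks by simp
  have "card W - 1 \<le> (\<Sum>A\<in>W - {b}. card (A \<inter> outer W))"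
    using sum_bounded_below[of "W - {b}" 1 "\<lambda>A. card (A \<inter> outer W)"] pos b(1) by simp
  then have "card (b \<inter> outer W) = 0" using sum by linarith
  then have "b \<inter> outer W = {}" using finite_block[OF b(1)] by simp
  moreover have "card (A \<inter> outer W) = 1" if A: "A \<in> W - {b}" for A
  proof -
    have "card (W - {b} - {A}) \<le> (\<Sum>A\<in>W - {b} - {A}. card (A \<inter> outer W))"
      using sum_bounded_below[of "W - {b} - {A}" 1 "\<lambda>A. card (A \<inter> outer W)"] pos by simp
    moreover have "card (W - {b} - {A}) + 2 = card W"
      using A b finite_blocks card by simp
    moreover have "(\<Sum>A\<in>W - {b}. card (A \<inter> outer W))
        = card (A \<inter> outer W) + (\<Sum>A\<in>W - {b} - {A}. card (A \<inter> outer W))"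
      using A finite_blocks by (intro sum.remove) auto
    ultimately show ?thesis using sum pos[OF A] by linarith
  qed
  moreover have "A \<inter> b \<noteq> {}" if "A \<in> W - {b}" for A
    using ex_inner[of A] that card b(2) by auto
  ultimately show ?thesis using b(1) by (simp add: spider_def)
qed

text \<open>A tree on four vertices is a star or a path, and the star is a spider by
  \<open>spiderI\<close>. On a path \<open>a\<close>, \<open>b\<close>, \<open>c\<close>,
  \<open>d\<close> each end needs a pendant edge, and the third one has four possible places, two up
  to reversal.\<close>

lemma ex_good_path:
  assumes card: "card W = 4" and eq: "card (outer W) = card (inner W)" and no_spider: "\<nexists>c. spider c"
  shows "\<exists>p. good W (card (outer W)) p \<and> inj_on p (inner W)"
proof -
  have m: "card (inner W) = 3" "card (outer W) = 3" using card card_blocks eq by auto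
  have sum: "(\<Sum>A\<in>W. card (A \<inter> inner W)) = 6"
    using sum_card_blocks[of "inner W"] inner_Int_outer m by (simp add: Int_commute)
  have no_star: "\<not> inner W \<subseteq> b" if "b \<in> W" for b
    using spiderI[OF that _ eq] card no_spider by auto
  have le2: "card (A \<inter> inner W) \<le> 2" if "A \<in> W" for A
  proof (rule ccontr)
    assume "\<not> card (A \<inter> inner W) \<le> 2"
    then have "A \<inter> inner W = inner W" using finite_inner m by (intro card_seteq) auto
    then show False using no_star[OF that] by auto
  qed
  \<comment> \<open>The inner degrees are at most two and add up to six over four blocks, so two of
    them equal two.\<close>
  have "\<exists>b\<in>W. \<exists>c\<in>W. b \<noteq> c \<and> 2 \<le> card (b \<inter> inner W) \<and> 2 \<le> card (c \<inter> inner W)"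
  proof (rule ccontr)
    assume *: "\<not> ?thesis"
    obtain b where b: "b \<in> W" "\<And>A. A \<in> W - {b} \<Longrightarrow> card (A \<inter> inner W) \<le> 1"
    proof (cases "\<exists>b\<in>W. 2 \<le> card (b \<inter> inner W)")
      case True
      then obtain b where b: "b \<in> W" "2 \<le> card (b \<inter> inner W)" by auto
      have "card (A \<inter> inner W) \<le> 1" if A: "A \<in> W - {b}" for A
      proof -
        have "\<not> 2 \<le> card (A \<inter> inner W)" using * b A by blast
        then show ?thesis by simp
      qed
      then show thesis by (rule that[OF b(1)])
    next
      case False
      obtain b where "b \<in> W" using blocks_nonempty by blast
      moreover have "card (A \<inter> inner W) \<le> 1" if A: "A \<in> W - {b}" for A
      proof -
        have "\<not> 2 \<le> card (A \<inter> inner W)" using False A by blast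
        then show ?thesis by simp
      qed
      ultimately show thesis by (rule that)
    qed
    have "(\<Sum>A\<in>W - {b}. card (A \<inter> inner W)) \<le> card (W - {b})"
      using sum_bounded_above[of "W - {b}" "\<lambda>A. card (A \<inter> inner W)" 1] b(2) by simp
    moreover have "card (W - {b}) = 3" using b(1) card by simp
    ultimately show False
      using sum sum.remove[OF finite_blocks b(1), of "\<lambda>A. card (A \<inter> inner W)"] le2[OF b(1)] by linarith
  qed
  then obtain b c where bc: "b \<in> W" "c \<in> W" "b \<noteq> c" "card (b \<inter> inner W) = 2" "card (c \<inter> inner W) = 2"
    using le2 by (metis le_antisym)
  have fin: "finite b" "finite c" using bc finite_block by auto
  have un: "card (b \<inter> inner W \<union> c \<inter> inner W) \<le> 3"
    using m finite_inner card_mono[of "inner W" "b \<inter> inner W \<union> c \<inter> inner W"] by simp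
  have int: "card ((b \<inter> inner W) \<inter> (c \<inter> inner W)) \<le> 1"
    by (rule order.trans[OF card_mono card_meet_le[OF bc(1-3)]]) (use fin in auto)
  have tot: "card (b \<inter> inner W) + card (c \<inter> inner W)
      = card (b \<inter> inner W \<union> c \<inter> inner W) + card ((b \<inter> inner W) \<inter> (c \<inter> inner W))"
    using fin by (intro card_Un_Int) auto
  have "card ((b \<inter> inner W) \<inter> (c \<inter> inner W)) = 1"
    using tot un int bc by linarith
  then obtain f where f: "(b \<inter> inner W) \<inter> (c \<inter> inner W) = {f}" by (rule card_1_singletonE)
  have f_mem: "f \<in> b \<inter> inner W" "f \<in> c \<inter> inner W" using f by blast+
  have "card (b \<inter> inner W - {f}) = 1" using bc(4) f_mem(1) by simp
  then obtain e where e: "b \<inter> inner W - {f} = {e}" by (rule card_1_singletonE)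
  have "card (c \<inter> inner W - {f}) = 1" using bc(5) f_mem(2) by simp
  then obtain g where "c \<inter> inner W - {f} = {g}" by (rule card_1_singletonE)
  note eg = e this
  have b_in: "b \<inter> inner W = {e, f}" and c_in: "c \<inter> inner W = {f, g}" using eg f by blast+
  have neq: "e \<noteq> f" "g \<noteq> f" "e \<noteq> g" using eg f b_in c_in by blast+
  have inner: "inner W = {e, f, g}"
  proof -
    have "{e, f, g} \<subseteq> inner W" using b_in c_in by blast
    moreover have "card {e, f, g} = card (inner W)" using neq m by simp
    ultimately show ?thesis using finite_inner by (metis card_subset_eq)
  qed
  have mem: "e \<in> b" "f \<in> b" "f \<in> c" "g \<in> c" "e \<notin> c" "g \<notin> b"
  proof -
    have sub: "{e, f} \<subseteq> b" "{f, g} \<subseteq> c" using b_in c_in by auto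
    then show "e \<in> b" "f \<in> b" "f \<in> c" "g \<in> c" by simp_all
    have "e \<notin> c \<inter> inner W" "g \<notin> b \<inter> inner W" unfolding b_in c_in using neq by simp_all
    then show "e \<notin> c" "g \<notin> b" unfolding inner by simp_all
  qed
  obtain a where a: "a \<in> W" "a \<noteq> b" "e \<in> a"
    using other_block[of e b] inner bc(1) mem(1) by auto
  obtain d where d: "d \<in> W" "d \<noteq> c" "g \<in> d"
    using other_block[of g c] inner bc(2) mem(4) by auto
  have ac: "a \<noteq> c" "d \<noteq> b" using a d mem by auto
  have ad: "a \<noteq> d"
    using no_triangle[OF a(1) bc(1,2) a(2) bc(3) ac(1) a(3) mem(1) mem(2,3)] d(3) mem(4) by blast
  have W: "W = {a, b, c, d}"
  proof -
    have "card {a, b, c, d} = card W" using ac ad a d bc card by simp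
    then show ?thesis using card_subset_eq[OF finite_blocks, of "{a, b, c, d}"] a d bc by simp
  qed
  have "f \<notin> a" using no_three[OF a(1) bc(1,2), of f] a ac bc mem by blast
  moreover have "g \<notin> a" using no_three[OF a(1) bc(2) d(1), of g] d ac ad mem by blast
  ultimately have a_in: "a \<inter> inner W = {e}" unfolding inner using a(3) by blast
  have "f \<notin> d" using no_three[OF d(1) bc(1,2), of f] d ac bc mem by blast
  moreover have "e \<notin> d" using no_three[OF d(1) a(1) bc(1), of e] a ac ad mem by blast
  ultimately have d_in: "d \<inter> inner W = {g}" unfolding inner using d(3) by blast
  let ?p = "\<lambda>A. card (A \<inter> outer W)"
  have p_sum: "?p a + ?p b + ?p c + ?p d = 3"
    using sum_outer m ac ad a d bc by (simp add: W)
  have "1 \<le> ?p a" "1 \<le> ?p d"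
    using card_block_split[OF a(1)] card_block[OF a(1)] a_in card_block_split[OF d(1)] card_block[OF d(1)] d_in
    by auto
  then consider "?p a = 2" "?p b = 0" "?p c = 0" "?p d = 1" | "?p a = 1" "?p b = 1" "?p c = 0" "?p d = 1"
    | "?p a = 1" "?p b = 0" "?p c = 1" "?p d = 1" | "?p a = 1" "?p b = 0" "?p c = 0" "?p d = 2"
    using p_sum by linarith
  moreover have disj: "x \<noteq> y" if "x \<in> A \<inter> outer W" "y \<in> B \<inter> outer W" "A \<in> W" "B \<in> W" "A \<noteq> B" for A B x y
    using that outer_unique[of x W A B] by blast
  have out: "outer W = (a \<inter> outer W) \<union> (b \<inter> outer W) \<union> (c \<inter> outer W) \<union> (d \<inter> outer W)"
    using outer_subset[of W] unfolding W by blast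
  have fin': "finite (A \<inter> outer W)" for A using finite_outer by simp
  have not_inner: "x \<noteq> e \<and> x \<noteq> f \<and> x \<noteq> g" if "x \<in> outer W" for x
    using that inner_Int_outer inner by blast
  note split = block_eq[OF a(1), unfolded a_in] block_eq[OF bc(1), unfolded b_in]
    block_eq[OF bc(2), unfolded c_in] block_eq[OF d(1), unfolded d_in]
  note sets = a(1) bc(1,2) d(1) ad bc(3) ac a(2) d(2)
  \<comment> \<open>The names are bound afresh so that the statement also applies to the path read
    backwards.\<close>
  have path_end: ?thesis
    if ends: "card (a \<inter> outer W) = 2" "card (b \<inter> outer W) = 0" "card (c \<inter> outer W) = 0" "card (d \<inter> outer W) = 1"
      and W: "W = {a, b, c, d}" "inner W = {e, f, g}" "e \<noteq> f" "g \<noteq> f" "e \<noteq> g"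
      and sets: "a \<in> W" "d \<in> W" "a \<noteq> d"
      and out: "outer W = (a \<inter> outer W) \<union> (b \<inter> outer W) \<union> (c \<inter> outer W) \<union> (d \<inter> outer W)"
      and split: "a = (a \<inter> outer W) \<union> {e}" "b = (b \<inter> outer W) \<union> {e, f}"
        "c = (c \<inter> outer W) \<union> {f, g}" "d = (d \<inter> outer W) \<union> {g}"
      and not_inner: "\<And>x. x \<in> outer W \<Longrightarrow> x \<noteq> e \<and> x \<noteq> f \<and> x \<noteq> g"
    for a b c d e f g
  proof -
    obtain x y where xy: "a \<inter> outer W = {x, y}" "x \<noteq> y" using ends(1) by (auto simp: card_2_iff)
    obtain z where z: "d \<inter> outer W = {z}" using ends(4) by (rule card_1_singletonE)
    have e: "b \<inter> outer W = {}" "c \<inter> outer W = {}" using ends(2,3) fin' by auto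
    have o: "outer W = {x, y, z}" using out unfolding xy z e by auto
    have "z \<noteq> x" "z \<noteq> y" using disj[OF _ _ sets, of _ z] xy z by blast+
    then have "distinct [x, y, z, e, f, g]"
      using xy(2) W(3-5) not_inner[unfolded o] by auto
    moreover have "W = {{x, y, e}, {e, f}, {f, g}, {g, z}}"
    proof -
      have "a = {x, y, e}" using split(1) unfolding xy by (simp add: insert_commute)
      moreover have "b = {e, f}" using split(2) unfolding e by (simp add: insert_commute)
      moreover have "c = {f, g}" using split(3) unfolding e by (simp add: insert_commute)
      moreover have "d = {g, z}" using split(4) unfolding z by (simp add: insert_commute)
      ultimately show ?thesis using W(1) by simp
    qed
    ultimately show ?thesis using path_colouring_end[OF _ _ o W(2)] m by simp
  qed
  have path_mid: ?thesis
    if ends: "card (a \<inter> outer W) = 1" "card (b \<inter> outer W) = 1" "card (c \<inter> outer W) = 0" "card (d \<inter> outer W) = 1"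
      and W: "W = {a, b, c, d}" "inner W = {e, f, g}" "e \<noteq> f" "g \<noteq> f" "e \<noteq> g"
      and sets: "a \<in> W" "b \<in> W" "d \<in> W" "a \<noteq> d" "a \<noteq> b" "b \<noteq> d"
      and out: "outer W = (a \<inter> outer W) \<union> (b \<inter> outer W) \<union> (c \<inter> outer W) \<union> (d \<inter> outer W)"
      and split: "a = (a \<inter> outer W) \<union> {e}" "b = (b \<inter> outer W) \<union> {e, f}"
        "c = (c \<inter> outer W) \<union> {f, g}" "d = (d \<inter> outer W) \<union> {g}"
      and not_inner: "\<And>x. x \<in> outer W \<Longrightarrow> x \<noteq> e \<and> x \<noteq> f \<and> x \<noteq> g"
    for a b c d e f g
  proof -
    obtain x where x: "a \<inter> outer W = {x}" using ends(1) by (rule card_1_singletonE)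
    obtain y where y: "b \<inter> outer W = {y}" using ends(2) by (rule card_1_singletonE)
    obtain z where z: "d \<inter> outer W = {z}" using ends(4) by (rule card_1_singletonE)
    have e: "c \<inter> outer W = {}" using ends(3) fin' by auto
    have o: "outer W = {x, y, z}" using out unfolding x y z e by auto
    have "x \<noteq> y" "x \<noteq> z" "y \<noteq> z"
      using disj[of x a y b] disj[of x a z d] disj[of y b z d] x y z sets by blast+
    then have "distinct [x, y, z, e, f, g]"
      using W(3-5) not_inner[unfolded o] by auto
    moreover have "W = {{x, e}, {y, e, f}, {f, g}, {g, z}}"
    proof -
      have "a = {x, e}" using split(1) unfolding x by (simp add: insert_commute)
      moreover have "b = {y, e, f}" using split(2) unfolding y by (simp add: insert_commute)
      moreover have "c = {f, g}" using split(3) unfolding e by (simp add: insert_commute)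
      moreover have "d = {g, z}" using split(4) unfolding z by (simp add: insert_commute)
      ultimately show ?thesis using W(1) by simp
    qed
    ultimately show ?thesis using path_colouring_mid[OF _ _ o W(2)] m by simp
  qed
  have W_rev: "W = {d, c, b, a}" using W by blast
  have inner_rev: "inner W = {g, f, e}" using inner by blast
  have out_rev: "outer W = (d \<inter> outer W) \<union> (c \<inter> outer W) \<union> (b \<inter> outer W) \<union> (a \<inter> outer W)"
    using out by blast
  have split_rev: "b = (b \<inter> outer W) \<union> {f, e}" "c = (c \<inter> outer W) \<union> {g, f}"
    using split(2,3) by blast+
  have not_inner_rev: "x \<noteq> g \<and> x \<noteq> f \<and> x \<noteq> e" if "x \<in> outer W" for x
    using not_inner[OF that] by simp
  ultimately show ?thesis
  proof cases
    case 1
    then show ?thesis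
      by (rule path_end[OF _ _ _ _ W inner neq a(1) d(1) ad out split not_inner])
  next
    case 2
    then show ?thesis
      by (rule path_mid[OF _ _ _ _ W inner neq a(1) bc(1) d(1) ad a(2) ac(2)[symmetric] out split not_inner])
  next
    case 3
    show ?thesis
      by (rule path_mid[OF 3(4) 3(3) 3(2) 3(1) W_rev inner_rev neq(2,1) neq(3)[symmetric] d(1) bc(2) a(1)
            ad[symmetric] d(2) ac(1)[symmetric] out_rev split(4) split_rev(2,1) split(1) not_inner_rev])
  next
    case 4
    show ?thesis
      by (rule path_end[OF 4(4) 4(3) 4(2) 4(1) W_rev inner_rev neq(2,1) neq(3)[symmetric] d(1) a(1)
            ad[symmetric] out_rev split(4) split_rev(2,1) split(1) not_inner_rev])
  qed
qed

end

text \<open>Injectivity on the inner edges belongs to the induction because \<open>apart\<close>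
  gives separation only for such colourings. A deletion lowers the number of pendant edges and keeps
  the inner ones; a reduction starts from equality and lowers both by one. Reductions are used from
  five blocks on, so that four remain.\<close>

theorem ex_good:
  assumes "block_tree W" "4 \<le> card W" "card (inner W) \<le> card (outer W)"
  shows "\<exists>p. good W (card (outer W)) p \<and> inj_on p (inner W)"
  using assms
proof (induction "card (outer W)" arbitrary: W rule: less_induct)
  case less
  interpret block_tree W by (rule less.prems(1))
  show ?case
  proof (cases "card (inner W) < card (outer W)")
    case True
    obtain A l where A: "A \<in> W" "3 \<le> card A" and l: "l \<in> A" "l \<in> outer W"
      using ex_removable[OF True less.prems(2)] by blast
    define W' where "W' = insert (A - {l}) (W - {A})"
    note del = block_tree_delete[OF A l, folded W'_def]
    have card_outer: "card (outer W) = Suc (card (outer W'))"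
      using card.remove[OF finite_outer l(2)] del(3) by simp
    obtain p where p: "good W' (card (outer W')) p" "inj_on p (inner W')"
      using less.hyps[of W'] del card_outer True less.prems(2) by auto
    have "good W (card (outer W)) (p(l := Suc (card (outer W'))))"
      unfolding card_outer using p(1) by (intro good_delete[OF A l]) (simp add: W'_def)
    moreover have "inj_on (p(l := Suc (card (outer W')))) (inner W)"
      using p(2) del(2) l(2) by (auto simp: inj_on_def outer_def)
    ultimately show ?thesis by blast
  next
    case False
    then have eq: "card (outer W) = card (inner W)" using less.prems(3) by simp
    show ?thesis
    proof (cases "\<exists>c. spider c")
      case True
      then show ?thesis using ex_good_spider less.prems(2) by blast
    next
      case no_spider: False
      show ?thesis
      proof (cases "card W = 4")
        case True
        then show ?thesis using ex_good_path eq no_spider by blast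
      next
        case False
        then have "5 \<le> card W" using less.prems(2) by simp
        then have "3 \<le> card W" by simp
        then obtain w l x y e where w: "w \<in> W" "3 \<le> card w" and l: "l \<in> w" "l \<in> outer W"
          and xy: "x \<in> W" "y \<in> W" "x \<noteq> y" "w \<noteq> x" "w \<noteq> y" and e: "e \<in> x" "e \<in> y" and ap: "apart w x" "apart w y"
          by (rule ex_reduction[OF eq _ no_spider])
        define W' where "W' = insert (x \<union> y - {e}) (insert (w - {l}) (W - {w}) - {x, y})"
        note red = good_reduce[OF w l xy e ap, folded W'_def]
        interpret W': block_tree W' by (rule red(1))
        have "card (inner W') \<le> card (outer W')"
          using W'.card_blocks card_blocks red(2,3) eq by simp
        then obtain p where "good W' (card (outer W')) p" "inj_on p (inner W')"
          using less.hyps[of W'] red(1-3) \<open>5 \<le> card W\<close> by auto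
        then show ?thesis using red(3,4) by auto
      qed
    qed
  qed
qed

section \<open>One or two more inner edges than pendant edges\<close>

text \<open>In a good colouring with \<open>card (outer W)\<close> colours each colour also occurs
  on one pendant edge, so the colour classes have size two or three.\<close>

definition balanced :: "'e set set \<Rightarrow> ('e \<Rightarrow> nat) \<Rightarrow> bool" where
  "balanced W p \<longleftrightarrow> (\<forall>i\<in>{1..card (outer W)}. card {e \<in> inner W. p e = i} \<in> {1, 2})"

definition hubs :: "'e set set \<Rightarrow> 'e set set" where
  "hubs W = {A \<in> W. 3 \<le> card A}"

lemma good_range_inner: "good W k p \<Longrightarrow> p ` inner W \<subseteq> {1..k}"
  unfolding good_def by (meson image_mono inner_subset order_trans)

context block_tree
begin

lemma balanced_if_inj:
  assumes "good W (card (outer W)) p" "inj_on p (inner W)" "card (inner W) = card (outer W)"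
  shows "balanced W p"
  unfolding balanced_def
proof
  fix i assume i: "i \<in> {1..card (outer W)}"
  have "p ` inner W \<subseteq> {1..card (outer W)}"
    using assms(1) by (rule good_range_inner)
  moreover have "card (p ` inner W) = card {1..card (outer W)}"
    using assms(2,3) by (simp add: card_image)
  ultimately have "p ` inner W = {1..card (outer W)}" by (intro card_subset_eq) auto
  then obtain e where e: "e \<in> inner W" "p e = i" using i by (metis imageE)
  then have "{f \<in> inner W. p f = i} = {e}"
    using assms(2) by (auto dest: inj_onD)
  then show "card {f \<in> inner W. p f = i} \<in> {1, 2}" by simp
qed

text \<open>Every colour accounts for one inner edge, so the surplus of inner edges counts the
  colours used twice. It limits how many colours must be avoided in the next extension.\<close>

lemma card_doubled:
  assumes p: "good W (card (outer W)) p" and bal: "balanced W p"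
  shows "card {i \<in> {1..card (outer W)}. card {e \<in> inner W. p e = i} = 2} + card (outer W) = card (inner W)"
proof -
  let ?I = "{1..card (outer W)}" and ?c = "\<lambda>i. card {e \<in> inner W. p e = i}"
  have "p ` inner W \<subseteq> ?I"
    using p by (rule good_range_inner)
  then have "card (inner W) = (\<Sum>i\<in>?I. ?c i)"
    using sum.group[of "inner W" ?I p "\<lambda>_. 1::nat"] finite_inner by simp
  also have "\<dots> = (\<Sum>i\<in>?I. 1 + (if ?c i = 2 then 1 else 0))"
  proof (rule sum.cong[OF refl])
    fix i assume "i \<in> ?I"
    then have "?c i \<in> {1, 2}" using bal unfolding balanced_def by blast
    then show "?c i = 1 + (if ?c i = 2 then 1 else 0)" by auto
  qed
  also have "\<dots> = card (outer W) + card {i \<in> ?I. ?c i = 2}"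
    unfolding sum.distrib by (simp add: sum.If_cases Int_def conj_commute)
  finally show ?thesis by simp
qed

section \<open>Contracting three consecutive edges\<close>

text \<open>The edges \<open>l\<close>, \<open>a\<close>, \<open>b\<close> will get the new colour,
  an old colour and the new colour. If \<open>u\<close> and \<open>v\<close> both had size two, both
  would see exactly these two colours, hence the last condition.\<close>

definition pendant_path :: "'e set \<Rightarrow> 'e set \<Rightarrow> 'e set \<Rightarrow> 'e \<Rightarrow> 'e \<Rightarrow> 'e \<Rightarrow> bool" where
  "pendant_path u v t l a b \<longleftrightarrow> u \<in> W \<and> v \<in> W \<and> t \<in> W \<and> u \<noteq> v \<and> v \<noteq> t \<and> u \<noteq> t \<and>
     l \<in> u \<and> l \<in> outer W \<and> a \<in> u \<and> a \<in> v \<and> b \<in> v \<and> b \<in> t \<and> \<not> (card u = 2 \<and> card v = 2)"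

text \<open>Two contractions and one deletion remove two inner edges and one pendant edge, which
  lowers the excess of inner over pendant edges by one. The three parts of \<open>Z\<close> are
  recorded as disjoint so that their colours are disjoint too.\<close>

lemma collapse_path:
  assumes path: "pendant_path u v t l a b"
  obtains W' Z where "block_tree W'" "card W = card W' + 2" "outer W' = outer W - {l}"
    "inner W' = inner W - {a, b}" "W' = insert Z (W - {u, v, t})" "Z \<notin> W"
    "Z = (u - {a, l}) \<union> (v - {a, b}) \<union> (t - {b})"
    "card u + card v + card t = card Z + 5"
    "(u - {a, l}) \<inter> (v - {a, b}) = {}" "(u - {a, l}) \<inter> (t - {b}) = {}" "(v - {a, b}) \<inter> (t - {b}) = {}"
proof -
  have W: "u \<in> W" "v \<in> W" "t \<in> W" "u \<noteq> v" "v \<noteq> t" "u \<noteq> t"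
    and e: "l \<in> u" "l \<in> outer W" "a \<in> u" "a \<in> v" "b \<in> v" "b \<in> t" and not22: "\<not> (card u = 2 \<and> card v = 2)"
    using path by (auto simp: pendant_path_def)
  have a_t: "a \<notin> t" and b_u: "b \<notin> u"
    using no_three[OF W(1-3), of a] no_three[OF W(1-3), of b] W(4-6) e by blast+
  have ab: "a \<noteq> b" using a_t e by blast
  have l_in: "l \<notin> v" "l \<notin> t"
    using outer_unique[OF e(2) W(1) _ e(1)] W by blast+
  have uv: "u \<inter> v = {a}" and vt: "v \<inter> t = {b}"
    using meet_unique[OF W(1,2,4)] meet_unique[OF W(2,3,5)] e by blast+
  have ut: "u \<inter> t = {}"
    using no_triangle[OF W(1,2,3,4,5,6) e(3-6)] by blast
  define X where "X = u \<union> v - {a}"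
  define W1 where "W1 = insert X (W - {u, v})"
  note c1 = block_tree_contract[OF W(1,2,4) e(3,4), folded X_def, folded W1_def]
  interpret W1: block_tree W1 by (rule c1(1))
  have X: "X \<in> W1" "t \<in> W1" "X \<noteq> t" "b \<in> X" "b \<in> t"
    using W e ab c1(5) by (auto simp: W1_def X_def)
  define Y where "Y = X \<union> t - {b}"
  define W2 where "W2 = insert Y (W1 - {X, t})"
  note c2 = W1.block_tree_contract[OF X, folded Y_def, folded W2_def]
  interpret W2: block_tree W2 by (rule c2(1))
  have W1_diff: "W1 - {X, t} = W - {u, v, t}" using c1(5) W by (auto simp: W1_def)
  have card_Y: "card u + card v + card t = card Y + 4" using c1(6) c2(6) by simp
  have outer2: "outer W2 = outer W" using c1(3) c2(3) by simp
  have l: "l \<in> Y" "l \<in> outer W2" using e ab l_in b_u outer2 a_t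
    by (auto simp: X_def Y_def outer_def inner_def)
  have "2 \<le> card u" "2 \<le> card v" "2 \<le> card t" using W card_block by auto
  \<comment> \<open>The exclusion of two blocks of size two is used again here: \<open>l\<close> can
    be deleted only from a block of size at least three.\<close>
  then have Y: "Y \<in> W2" "3 \<le> card Y" using card_Y not22 by (auto simp: W2_def)
  define W' where "W' = insert (Y - {l}) (W2 - {Y})"
  note d = W2.block_tree_delete[OF Y l, folded W'_def]
  have W2_diff: "W2 - {Y} = W - {u, v, t}" using c2(5) W1_diff by (auto simp: W2_def)
  show thesis
  proof (rule that[of W' "Y - {l}"])
    show "block_tree W'" by (rule d(1))
    show "card W = card W' + 2" using c1(4) c2(4) d(4) by simp
    show "outer W' = outer W - {l}" using d(3) outer2 by simp
    show "inner W' = inner W - {a, b}" using c1(2) c2(2) d(2) by auto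
    show "W' = insert (Y - {l}) (W - {u, v, t})" using W2_diff by (simp add: W'_def)
    show Y_eq: "Y - {l} = (u - {a, l}) \<union> (v - {a, b}) \<union> (t - {b})"
      using l_in a_t b_u by (auto simp: X_def Y_def)
    show "card u + card v + card t = card (Y - {l}) + 5"
      using card_Y Y(2) l(1) by simp
    show "(u - {a, l}) \<inter> (v - {a, b}) = {}" "(u - {a, l}) \<inter> (t - {b}) = {}" "(v - {a, b}) \<inter> (t - {b}) = {}"
      using uv vt ut by blast+
    show "Y - {l} \<notin> W"
    proof
      assume Z: "Y - {l} \<in> W"
      have "Y - {l} \<notin> W2" by (rule d(5))
      then have "Y - {l} \<in> {u, v, t}" using Z W2_diff by blast
      moreover have "a \<notin> Y - {l}" "b \<notin> Y - {l}" unfolding Y_eq using a_t b_u by auto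
      ultimately show False using e by auto
    qed
  qed
qed

text \<open>The rests of \<open>u\<close>, \<open>v\<close> and \<open>t\<close> lie in the one
  block \<open>Z\<close>, so their old colours are disjoint. Equal sets at \<open>u\<close> and
  \<open>v\<close> would make both rests empty; if \<open>u\<close> or \<open>v\<close> agreed with
  \<open>t\<close>, its rest would be empty and \<open>c\<close> the only old colour at
  \<open>t\<close>, which the last condition on \<open>c\<close> forbids.\<close>

lemma good_expand:
  assumes path: "pendant_path u v t l a b"
    and W': "outer W' = outer W - {l}" "W' = insert Z (W - {u, v, t})"
      "Z = (u - {a, l}) \<union> (v - {a, b}) \<union> (t - {b})"
      "(u - {a, l}) \<inter> (v - {a, b}) = {}" "(u - {a, l}) \<inter> (t - {b}) = {}" "(v - {a, b}) \<inter> (t - {b}) = {}"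
    and p: "good W' k p" and c: "c \<in> {1..k}" "c \<notin> p ` (u - {a, l})" "c \<notin> p ` (v - {a, b})"
      "card u = 2 \<or> card v = 2 \<Longrightarrow> card t = 2 \<Longrightarrow> c \<notin> p ` (t - {b})"
  shows "good W (Suc k) (p(l := Suc k, b := Suc k, a := c))"
proof -
  define q where "q = p(l := Suc k, b := Suc k, a := c)"
  have W: "u \<in> W" "v \<in> W" "t \<in> W" "u \<noteq> v" "v \<noteq> t" "u \<noteq> t"
    and e: "l \<in> u" "l \<in> outer W" "a \<in> u" "a \<in> v" "b \<in> v" "b \<in> t" and not22: "\<not> (card u = 2 \<and> card v = 2)"
    using path by (auto simp: pendant_path_def)
  have inn: "a \<in> inner W" "b \<in> inner W" using W e by (auto intro: innerI)
  then have neq: "a \<noteq> l" "b \<noteq> l" using e(2) by (auto simp: outer_def)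
  have a_t: "a \<notin> t" and b_u: "b \<notin> u"
    using no_three[OF W(1-3), of a] no_three[OF W(1-3), of b] W(4-6) e by blast+
  have ab: "a \<noteq> b" using a_t e by blast
  have l_in: "l \<notin> v" "l \<notin> t"
    using outer_unique[OF e(2) W(1) _ e(1)] W by blast+
  have fin: "finite u" "finite v" "finite t" using W finite_block by auto
  have Z: "Z \<in> W'" using W'(2) by simp
  define Pu where "Pu = u - {a, l}"
  define Pv where "Pv = v - {a, b}"
  define Pt where "Pt = t - {b}"
  note P_def = Pu_def Pv_def Pt_def
  have Z_eq: "Z = Pu \<union> Pv \<union> Pt" and disj: "Pu \<inter> Pv = {}" "Pu \<inter> Pt = {}" "Pv \<inter> Pt = {}"
    using W'(3-6) by (auto simp: P_def)
  have old: "q f = p f" if "f \<noteq> a" "f \<noteq> b" "f \<noteq> l" for f using that by (simp add: q_def)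
  have new: "q a = c" "q b = Suc k" "q l = Suc k" using neq ab by (auto simp: q_def)
  have inj_Z: "inj_on p Z" using p Z by (simp add: good_def)
  have le: "p f \<in> {1..k}" if "f \<in> Z" for f using good_range[OF p that Z] .
  have new_notin: "Suc k \<notin> p ` S" if "S \<subseteq> Z" for S
  proof
    assume "Suc k \<in> p ` S"
    then obtain f where "f \<in> S" "Suc k = p f" by blast
    then show False using le[of f] that by auto
  qed
  have sub: "Pu \<subseteq> Z" "Pv \<subseteq> Z" "Pt \<subseteq> Z" using Z_eq by auto
  have oldZ: "q f = p f" if "f \<in> Z" for f
    using that a_t b_u l_in unfolding Z_eq P_def by (intro old) auto
  have qP: "q ` Pu = p ` Pu" "q ` Pv = p ` Pv" "q ` Pt = p ` Pt"
    using sub oldZ by (auto intro!: image_cong)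
  have u: "u = insert l (insert a Pu)" and v: "v = insert a (insert b Pv)" and t: "t = insert b Pt"
    using e by (auto simp: P_def)
  have qu: "q ` u = insert (Suc k) (insert c (p ` Pu))" by (subst u) (simp add: new qP)
  have qv: "q ` v = insert (Suc k) (insert c (p ` Pv))" by (subst v) (auto simp: new qP)
  have qt: "q ` t = insert (Suc k) (p ` Pt)" by (subst t) (simp add: new qP)
  have c': "c \<noteq> Suc k" "c \<notin> p ` Pu" "c \<notin> p ` Pv" using c by (auto simp: P_def)
  have inj_P: "inj_on q P" if "P = Pu \<or> P = Pv \<or> P = Pt" for P
  proof -
    have "inj_on p P" using inj_Z sub that by (auto elim: inj_on_subset)
    moreover have "q f = p f" if "f \<in> P" for f
      using \<open>P = Pu \<or> P = Pv \<or> P = Pt\<close> that sub by (intro oldZ) auto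
    ultimately show ?thesis by (simp add: inj_on_def)
  qed
  have card_P: "card Pu = card u - 2" "card Pv = card v - 2" "card Pt = card t - 1"
    using e neq ab fin by (auto simp: P_def card_Diff_subset)
  have finP: "finite Pu" "finite Pv" "finite Pt" using fin by (auto simp: P_def)
  have image_disj: "p ` P \<inter> p ` Q = {}" if "P \<subseteq> Z" "Q \<subseteq> Z" "P \<inter> Q = {}" for P Q
    using inj_on_image_Int[OF inj_Z that(1,2)] that(3) by simp
  have "q ` u \<noteq> q ` v"
  proof
    assume "q ` u = q ` v"
    moreover have "Suc k \<notin> insert c (p ` Pu)" "Suc k \<notin> insert c (p ` Pv)"
      using new_notin sub c' by auto
    ultimately have "insert c (p ` Pu) = insert c (p ` Pv)" unfolding qu qv by (metis insert_ident)
    then have "p ` Pu = p ` Pv" using c' by (metis insert_ident)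
    then have "Pu = {}" "Pv = {}" using image_disj[OF sub(1,2) disj(1)] by auto
    then have "card u - 2 = 0" "card v - 2 = 0" using card_P by auto
    then show False using not22 card_block[OF W(1)] card_block[OF W(2)] by linarith
  qed
  moreover have x_neq_t: "q ` x \<noteq> q ` t"
    if x: "q ` x = insert (Suc k) (insert c (p ` Q))" "Q \<subseteq> Z" "Q \<inter> Pt = {}" "card Q = card x - 2" "finite Q"
      "x = u \<or> x = v" for x Q
  proof
    assume "q ` x = q ` t"
    moreover have "Suc k \<notin> insert c (p ` Q)" "Suc k \<notin> p ` Pt"
      using new_notin sub x(2) c' by auto
    ultimately have eq: "insert c (p ` Q) = p ` Pt" unfolding x(1) qt by (metis insert_ident)
    then have "p ` Q = {}" using image_disj[OF x(2) sub(3) x(3)] by blast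
    then have "Q = {}" by simp
    then have "card x = 2" using x(4,6) card_block[of x] W by auto
    have "p ` Pt = {c}" using eq \<open>Q = {}\<close> by simp
    moreover have "card (p ` Pt) = card Pt" using inj_Z sub(3) by (metis card_image inj_on_subset)
    ultimately have "card Pt = 1" by simp
    then have "card t = 2" using card_P by simp
    moreover have "c \<in> p ` Pt" using \<open>p ` Pt = {c}\<close> by simp
    ultimately show False using c(4) \<open>card x = 2\<close> x(6) by (auto simp: P_def)
  qed
  ultimately have img: "q ` u \<noteq> q ` v" "q ` u \<noteq> q ` t" "q ` v \<noteq> q ` t"
    using x_neq_t[OF qu sub(1) disj(2) card_P(1) finP(1)] x_neq_t[OF qv sub(2) disj(3) card_P(2) finP(2)] by auto
  have "good W (Suc k) q"
  proof (rule good_extend[OF p, where T = "{u, v, t}" and l = l])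
    show "{u, v, t} \<subseteq> W" using W by auto
    show "W - {u, v, t} \<subseteq> W'" using W'(2) by auto
    show "inj_on q A" if "A \<in> {u, v, t}" for A
    proof -
      have "inj_on q u"
        by (subst u) (use inj_P[of Pu] qP(1) c' new_notin[OF sub(1)] new in \<open>auto simp: image_iff\<close>)
      moreover have "inj_on q v"
        by (subst v) (use inj_P[of Pv] qP(2) c' new_notin[OF sub(2)] new in \<open>auto simp: image_iff\<close>)
      moreover have "inj_on q t"
        by (subst t) (use inj_P[of Pt] qP(3) new_notin[OF sub(3)] new in \<open>auto simp: image_iff\<close>)
      ultimately show ?thesis using that by auto
    qed
    show "Suc k \<in> q ` A" if "A \<in> {u, v, t}" for A using that qu qv qt by auto
    show "inj_on (image q) {u, v, t}" using img unfolding inj_on_def by blast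
    show "q ` \<Union> {u, v, t} \<subseteq> {1..Suc k}"
    proof -
      have "p ` Z \<subseteq> {1..Suc k}" using le by fastforce
      then have "p ` Pu \<subseteq> {1..Suc k}" "p ` Pv \<subseteq> {1..Suc k}" "p ` Pt \<subseteq> {1..Suc k}"
        using sub by blast+
      moreover have "q ` \<Union> {u, v, t} = q ` u \<union> q ` v \<union> q ` t" by auto
      ultimately show ?thesis unfolding qu qv qt using c(1) by auto
    qed
    show "q f = p f" if A: "A \<in> W - {u, v, t}" "f \<in> A" for A f
    proof (rule old)
      show "f \<noteq> a" using no_three[OF W(1,2), of A a] A W e by blast
      show "f \<noteq> b" using no_three[OF W(2,3), of A b] A W e by blast
      show "f \<noteq> l" using outer_unique[OF e(2) W(1), of A] A e by blast
    qed
    show "outer W = insert l (outer W')" "l \<notin> outer W'" using W'(1) e by auto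
    show "q f = p f" if "f \<in> outer W'" for f
      using that W'(1) inn by (intro old) (auto simp: outer_def)
  qed (rule new)
  then show ?thesis by (simp add: q_def)
qed

end

lemma card_le_sum:
  fixes f :: "'a \<Rightarrow> nat"
  shows "(\<And>x. x \<in> A \<Longrightarrow> 1 \<le> f x) \<Longrightarrow> card A \<le> sum f A"
  using sum_bounded_below[of A 1 f] by simp

context block_tree
begin

section \<open>Counting hubs and choosing the repeated colour\<close>

lemma balanced_le:
  assumes "balanced W p" "i \<in> {1..card (outer W)}" "j \<in> {1..card (outer W)}"
  shows "card {e \<in> inner W. p e = i} \<le> card {e \<in> inner W. p e = j} + 1"
proof -
  have "card {e \<in> inner W. p e = i} \<in> {1, 2}" "card {e \<in> inner W. p e = j} \<in> {1, 2}"
    using assms unfolding balanced_def by blast+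
  then show ?thesis by auto
qed

lemma finite_hubs: "finite (hubs W)" "hubs W \<subseteq> W"
  using finite_blocks by (auto simp: hubs_def)

lemma card_hubs: "card (hubs W) + card {A \<in> W. card A = 2} = card W"
proof -
  have "W = hubs W \<union> {A \<in> W. card A = 2}" "hubs W \<inter> {A \<in> W. card A = 2} = {}"
    using card_block by (fastforce simp: hubs_def)+
  then show ?thesis using finite_blocks finite_hubs
    by (metis (no_types, lifting) card_Un_disjoint finite_Un)
qed

lemma card_hubs_le: "card (hubs W) + 2 \<le> card (outer W)"
proof -
  have "card (hubs W) \<le> (\<Sum>A\<in>hubs W. card A - 2)"
    by (rule card_le_sum) (auto simp: hubs_def)
  also have "\<dots> \<le> (\<Sum>A\<in>W. card A - 2)"
    using finite_blocks finite_hubs by (intro sum_mono2) auto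
  finally show ?thesis using sum_excess by linarith
qed

text \<open>By \<open>sum_excess\<close> the block sizes exceed two by \<open>k - 1\<close> in
  total, and hubs outside \<open>u\<close> and \<open>v\<close> account for at least
  \<open>d - 1\<close> of this. So the old colours at \<open>u\<close> and \<open>v\<close> number
  at most \<open>k - d\<close>, and the fewer than \<open>d\<close> colours in \<open>D\<close>
  still leave one free. In the application \<open>D\<close> holds the colours already used
  twice.\<close>

lemma ex_new_colour:
  assumes path: "pendant_path u v t l a b" and hubs: "d + 1 \<le> card (hubs W)" "1 \<le> d"
    and D: "card D < d" "finite D" and k: "card (outer W) = Suc k"
  shows "\<exists>c\<in>{1..k}. c \<notin> p ` (u - {a, l}) \<and> c \<notin> p ` (v - {a, b}) \<and> c \<notin> D
    \<and> (card u = 2 \<or> card v = 2 \<longrightarrow> card t = 2 \<longrightarrow> c \<notin> p ` (t - {b}))"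
proof -
  have W: "u \<in> W" "v \<in> W" "t \<in> W" "u \<noteq> v" "v \<noteq> t" "u \<noteq> t"
    and e: "l \<in> u" "l \<in> outer W" "a \<in> u" "a \<in> v" "b \<in> v" "b \<in> t" and not22: "\<not> (card u = 2 \<and> card v = 2)"
    using path by (auto simp: pendant_path_def)
  have fin: "finite u" "finite v" "finite t" using W finite_block by auto
  have "a \<in> inner W" using W e by (auto intro: innerI)
  then have neq: "a \<noteq> l" "a \<noteq> b" using e(2) no_three[OF W(1-3), of a] W e by (auto simp: outer_def)
  define X where "X = (if card u = 2 \<or> card v = 2 then if card t = 2 then p ` (t - {b}) else {} else {})"
  \<comment> \<open>If \<open>u\<close> or \<open>v\<close> has size two, one colour at
    \<open>t\<close> may also be forbidden; but then that block is not a hub, and one more hub lies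
    outside \<open>u\<close> and \<open>v\<close>.\<close>
  define \<epsilon> :: nat where "\<epsilon> = (if card u = 2 \<or> card v = 2 then 1 else 0)"
  have X: "finite X" "card X \<le> \<epsilon>"
  proof -
    show "finite X" using fin by (simp add: X_def)
    have "card (p ` (t - {b})) \<le> 1" if "card t = 2"
    proof -
      have "card (p ` (t - {b})) \<le> card (t - {b})" using fin by (intro card_image_le) auto
      then show ?thesis using that e fin by simp
    qed
    then show "card X \<le> \<epsilon>" by (simp add: X_def \<epsilon>_def)
  qed
  have card_u: "card (p ` (u - {a, l})) \<le> card u - 2" and card_v: "card (p ` (v - {a, b})) \<le> card v - 2"
  proof -
    have "card (u - {a, l}) = card u - 2" "card (v - {a, b}) = card v - 2"
      using e neq fin by (auto simp: card_Diff_subset)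
    then show "card (p ` (u - {a, l})) \<le> card u - 2" "card (p ` (v - {a, b})) \<le> card v - 2"
      using fin by (metis card_image_le finite_Diff)+
  qed
  have "(card u - 2) + (card v - 2) + d + \<epsilon> \<le> k"
  proof -
    have "(\<Sum>A\<in>W. card A - 2) = (card u - 2) + ((card v - 2) + (\<Sum>A\<in>W - {u} - {v}. card A - 2))"
      using sum.remove[OF finite_blocks W(1), of "\<lambda>A. card A - 2"]
        sum.remove[of "W - {u}" v "\<lambda>A. card A - 2"] finite_blocks W by simp
    moreover have "card (hubs W - {u, v}) \<le> (\<Sum>A\<in>W - {u} - {v}. card A - 2)"
    proof -
      have "card (hubs W - {u, v}) \<le> (\<Sum>A\<in>hubs W - {u, v}. card A - 2)"
        by (rule card_le_sum) (auto simp: hubs_def)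
      also have "\<dots> \<le> (\<Sum>A\<in>W - {u} - {v}. card A - 2)"
        using finite_blocks finite_hubs by (intro sum_mono2) auto
      finally show ?thesis .
    qed
    moreover have "card (hubs W) \<le> card (hubs W - {u, v}) + card (hubs W \<inter> {u, v})"
      using finite_hubs by (metis card_Un_le Un_Diff_Int)
    moreover have "card (hubs W \<inter> {u, v}) + \<epsilon> \<le> 2"
    proof (cases "card u = 2 \<or> card v = 2")
      case True
      then have "hubs W \<inter> {u, v} \<subseteq> {u} \<or> hubs W \<inter> {u, v} \<subseteq> {v}" by (auto simp: hubs_def)
      then have "card (hubs W \<inter> {u, v}) \<le> 1"
        using card_mono[of "{u}" "hubs W \<inter> {u, v}"] card_mono[of "{v}" "hubs W \<inter> {u, v}"] by auto
      then show ?thesis using True by (simp add: \<epsilon>_def)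
    next
      case False
      have "card (hubs W \<inter> {u, v}) \<le> card {u, v}" by (intro card_mono) auto
      then show ?thesis using False W by (simp add: \<epsilon>_def)
    qed
    ultimately show ?thesis using sum_excess k hubs by linarith
  qed
  then have less: "(card u - 2) + (card v - 2) + card D + \<epsilon> < card {1..k}"
    using D by simp
  define Y where "Y = p ` (u - {a, l}) \<union> p ` (v - {a, b}) \<union> D \<union> X"
  have "card Y \<le> card (p ` (u - {a, l})) + card (p ` (v - {a, b})) + card D + card X"
    unfolding Y_def by (intro order.trans[OF card_Un_le] add_mono order_refl)
  then have "card Y < card {1..k}" using less card_u card_v X(2) by linarith
  moreover have "finite Y" using fin D X by (simp add: Y_def)
  ultimately have "\<not> {1..k} \<subseteq> Y" by (meson card_mono not_le)
  then obtain c where "c \<in> {1..k}" "c \<notin> Y" by (meson subsetI)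
  then show ?thesis by (intro bexI[of _ c]) (auto simp: Y_def X_def)
qed

text \<open>On inner edges the new colour occurs only at \<open>b\<close>, and \<open>c\<close> is a
  colour used once before and twice now. Since \<open>W'\<close> has excess \<open>d - 1\<close>,
  fewer than \<open>d\<close> colours are ruled out as already doubled.\<close>

lemma good_excess_step:
  assumes path: "pendant_path u v t l a b" and hubs: "d + 1 \<le> card (hubs W)" "1 \<le> d"
    and W': "outer W' = outer W - {l}" "inner W' = inner W - {a, b}" "W' = insert Z (W - {u, v, t})"
      "Z = (u - {a, l}) \<union> (v - {a, b}) \<union> (t - {b})"
      "(u - {a, l}) \<inter> (v - {a, b}) = {}" "(u - {a, l}) \<inter> (t - {b}) = {}" "(v - {a, b}) \<inter> (t - {b}) = {}"
    and tree': "block_tree W'" "card (inner W') + 1 = card (outer W') + d"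
    and p: "good W' (card (outer W')) p" "balanced W' p"
  shows "\<exists>q. good W (card (outer W)) q \<and> balanced W q"
proof -
  interpret W': block_tree W' by (rule tree'(1))
  define k where "k = card (outer W')"
  have l: "l \<in> outer W" using path by (simp add: pendant_path_def)
  have k: "card (outer W) = Suc k"
    using card.remove[OF finite_outer l] W'(1) by (simp add: k_def)
  define D where "D = {i \<in> {1..k}. card {e \<in> inner W'. p e = i} = 2}"
  have "card D < d"
    using W'.card_doubled[OF p] tree'(2) by (simp add: D_def k_def)
  then obtain c where c: "c \<in> {1..k}" "c \<notin> p ` (u - {a, l})" "c \<notin> p ` (v - {a, b})" "c \<notin> D"
      "card u = 2 \<or> card v = 2 \<Longrightarrow> card t = 2 \<Longrightarrow> c \<notin> p ` (t - {b})"
    using ex_new_colour[OF path hubs _ _ k, of D p] by (auto simp: D_def)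
  define q where "q = p(l := Suc k, b := Suc k, a := c)"
  have "good W (Suc k) q"
    unfolding q_def using p(1) c by (intro good_expand[OF path W'(1,3-7)]) (auto simp: k_def)
  moreover have "balanced W q"
  proof -
    have a: "a \<in> inner W" "b \<in> inner W" and ab: "a \<noteq> b"
      using path no_three[of u v t a] by (auto simp: pendant_path_def intro: innerI)
    have l_notin: "l \<notin> inner W" using l by (simp add: outer_def)
    have q_new: "q a = c" "q b = Suc k" using ab a l_notin by (auto simp: q_def)
    have q_old: "q e = p e" if "e \<in> inner W'" for e
      using that W'(2) l_notin by (auto simp: q_def)
    have p_le: "p e \<in> {1..k}" if "e \<in> inner W'" for e
      using good_range_inner[OF p(1)] that by (auto simp: k_def)
    have inn: "inner W = insert a (insert b (inner W'))" "a \<notin> inner W'" "b \<notin> inner W'"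
      using W'(2) a by auto
    have "card {e \<in> inner W. q e = i} \<in> {1, 2}" if i: "i \<in> {1..Suc k}" for i
    proof -
      consider "i = Suc k" | "i = c" | "i \<noteq> c" "i \<in> {1..k}" using i by fastforce
      then show ?thesis
      proof cases
        case 1
        have "q e \<noteq> Suc k" if "e \<in> inner W'" for e
          using q_old[OF that] p_le[OF that] by simp
        moreover have "c \<noteq> Suc k" using c(1) by simp
        ultimately have "{e \<in> inner W. q e = i} = {b}"
          unfolding inn(1) 1 using q_new by auto
        then show ?thesis by simp
      next
        case 2
        have eq: "{e \<in> inner W. q e = i} = insert a {e \<in> inner W'. p e = i}"
          unfolding inn(1) using q_new q_old c(1) 2 by auto
        have "card {e \<in> inner W'. p e = c} = 1"
          using p(2) c(1,4) by (auto simp: balanced_def D_def k_def)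
        then show ?thesis unfolding eq using 2 inn(2) W'.finite_inner by simp
      next
        case 3
        have "{e \<in> inner W. q e = i} = {e \<in> inner W'. p e = i}"
          unfolding inn(1) using q_new q_old 3 by auto
        then show ?thesis using p(2) 3 by (simp add: balanced_def k_def)
      qed
    qed
    then show ?thesis by (simp add: balanced_def k)
  qed
  ultimately show ?thesis using k by auto
qed

text \<open>Otherwise every pendant edge would lie in a block of size two whose neighbour also has size
  two but no pendant edge, which makes more than \<open>card (outer W)\<close> blocks of size two.\<close>

lemma ex_pendant_path:
  assumes excess: "card (outer W) < card (inner W)"
    and two: "card {A \<in> W. card A = 2} \<le> card (outer W)"
  shows "\<exists>u v t l a b. pendant_path u v t l a b"
proof (rule ccontr)
  assume none: "\<nexists>u v t l a b. pendant_path u v t l a b"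
  have card: "3 \<le> card W" using card_hubs_le excess card_blocks by linarith
  \<comment> \<open>Otherwise all inner edges would meet at \<open>u\<close>. Then every other block
    has a pendant edge, as does \<open>u\<close>, and the pendant edges would be at least as many as
    the blocks.\<close>
  have nbrs: "\<exists>v a t b. v \<in> W \<and> t \<in> W \<and> u \<noteq> v \<and> v \<noteq> t \<and> u \<noteq> t \<and> a \<in> u \<and> a \<in> v \<and> b \<in> v \<and> b \<in> t"
    if u: "u \<in> W" "u \<inter> outer W \<noteq> {}" for u
  proof (rule ccontr)
    assume no: "\<not> ?thesis"
    have no: False if "v \<in> W" "t \<in> W" "u \<noteq> v" "v \<noteq> t" "u \<noteq> t" "a \<in> u" "a \<in> v" "b \<in> v" "b \<in> t" for v t a b
      using no that by blast
    define S where "S = insert u {v \<in> W. v \<inter> u \<noteq> {}}"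
    have "S = W"
    proof (rule closed_eq_all)
      fix A B e assume AB: "A \<in> S" "B \<in> W" "e \<in> A" "e \<in> B"
      show "B \<in> S"
      proof (cases "A = u \<or> B = u \<or> A = B")
        case True
        then show ?thesis using AB by (auto simp: S_def)
      next
        case False
        then obtain f where f: "A \<in> W" "f \<in> A" "f \<in> u" using AB(1) by (auto simp: S_def)
        then show ?thesis using no[of A B f e] AB False by blast
      qed
    qed (use u in \<open>auto simp: S_def\<close>)
    have inner_u: "inner W \<subseteq> u"
    proof
      fix e assume "e \<in> inner W"
      then obtain A B where AB: "A \<in> W" "B \<in> W" "A \<noteq> B" "e \<in> A" "e \<in> B" by (auto simp: inner_def)
      show "e \<in> u"
      proof (rule ccontr)
        assume "e \<notin> u"
        then have "A \<noteq> u" "B \<noteq> u" using AB by auto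
        then obtain f where "f \<in> A" "f \<in> u" using AB(1) \<open>S = W\<close> by (auto simp: S_def)
        then show False using no[of A B f e] AB \<open>A \<noteq> u\<close> \<open>B \<noteq> u\<close> by blast
      qed
    qed
    have pos: "1 \<le> card (A \<inter> outer W)" if A: "A \<in> W" for A
    proof (cases "A = u")
      case True
      then show ?thesis using u finite_block[OF A] by (simp add: Suc_le_eq card_gt_0_iff)
    next
      case False
      have "card (A \<inter> inner W) \<le> card (A \<inter> u)" using inner_u finite_block[OF A] by (intro card_mono) auto
      also have "\<dots> \<le> 1" using A u False by (intro card_meet_le)
      finally show ?thesis using card_block_split[OF A] card_block[OF A] by linarith
    qed
    then have "card W \<le> card (outer W)"
      using sum_bounded_below[of W 1 "\<lambda>A. card (A \<inter> outer W)"] sum_outer by simp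
    then show False using excess card_blocks by linarith
  qed
  have pair: "card u = 2 \<and> card (u \<inter> outer W) = 1 \<and> (\<exists>v\<in>W. card v = 2 \<and> v \<inter> outer W = {})"
    if u: "u \<in> W" "u \<inter> outer W \<noteq> {}" for u
  proof -
    obtain v a t b where v: "v \<in> W" "t \<in> W" "u \<noteq> v" "v \<noteq> t" "u \<noteq> t" "a \<in> u" "a \<in> v" "b \<in> v" "b \<in> t"
      using nbrs[OF u] by blast
    obtain l where l: "l \<in> u" "l \<in> outer W" using u by auto
    have "\<not> pendant_path u v t l a b" using none by blast
    then have uv: "card u = 2" "card v = 2" using u v l by (auto simp: pendant_path_def)
    have inn: "a \<in> inner W" "b \<in> inner W" using u v by (auto intro: innerI)
    have ab: "a \<noteq> b" using no_three[OF u(1) v(1,2), of a] v by auto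
    have "card (u \<inter> inner W) \<noteq> 0" "card (u \<inter> outer W) \<noteq> 0"
      using inn(1) v(6) l finite_block[OF u(1)] by auto
    then have "card (u \<inter> outer W) = 1" using card_block_split[OF u(1)] uv(1) by linarith
    moreover have "v \<inter> outer W = {}"
    proof -
      have "{a, b} = v" using v uv(2) ab finite_block[OF v(1)] by (intro card_subset_eq) auto
      then show ?thesis using inn inner_Int_outer by auto
    qed
    ultimately show ?thesis using uv v(1) by blast
  qed
  define U where "U = {A \<in> W. A \<inter> outer W \<noteq> {}}"
  have fin: "finite U" using finite_blocks by (simp add: U_def)
  have "card (outer W) = (\<Sum>A\<in>U. card (A \<inter> outer W))"
    unfolding sum_outer[symmetric] using finite_blocks
    by (intro sum.mono_neutral_right) (auto simp: U_def)
  also have "\<dots> = card U" using pair by (simp add: U_def)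
  finally have card_U: "card (outer W) = card U" .
  have "2 \<le> card (outer W)" using sum_excess by linarith
  then obtain u where "u \<in> U" using card_U by (metis card.empty ex_in_conv not_numeral_le_zero)
  then obtain v where v: "v \<in> W" "card v = 2" "v \<inter> outer W = {}" using pair by (auto simp: U_def)
  then have "v \<notin> U" by (simp add: U_def)
  then have "card (insert v U) = Suc (card (outer W))" using fin card_U by simp
  moreover have "insert v U \<subseteq> {A \<in> W. card A = 2}" using v pair by (auto simp: U_def)
  then have "card (insert v U) \<le> card {A \<in> W. card A = 2}"
    using finite_blocks by (intro card_mono) auto
  ultimately show False using two by simp
qed

text \<open>If every such path ran through large blocks only, \<open>u\<close>, \<open>v\<close>,
  \<open>t\<close> would be the three hubs, and no continuation could reach a further block. So
  \<open>v\<close> has no other neighbours and its third edge \<open>f\<close> is pendant; the paths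
  starting at \<open>f\<close> then show the same for \<open>u\<close> and \<open>t\<close>, and the
  whole tree has three blocks.\<close>

lemma ex_pendant_path_two:
  assumes path: "pendant_path u v t l a b" and three: "card (hubs W) = 3" and card: "4 \<le> card W"
  shows "\<exists>u v t l a b. pendant_path u v t l a b \<and> (card u = 2 \<or> card v = 2 \<or> card t = 2)"
proof (rule ccontr)
  assume none: "\<not> ?thesis"
  have W: "u \<in> W" "v \<in> W" "t \<in> W" "u \<noteq> v" "v \<noteq> t" "u \<noteq> t"
    and e: "l \<in> u" "l \<in> outer W" "a \<in> u" "a \<in> v" "b \<in> v" "b \<in> t"
    using path by (auto simp: pendant_path_def)
  have hub: "3 \<le> card A" if "A \<in> W" "card A \<noteq> 2" for A using card_block[OF that(1)] that(2) by simp
  have big: "3 \<le> card u" "3 \<le> card v" "3 \<le> card t" using none path hub W by blast+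
  have "{u, v, t} = hubs W"
    using finite_hubs W big three by (intro card_subset_eq) (auto simp: hubs_def)
  then have only: "A \<in> {u, v, t}" if "A \<in> W" "card A \<noteq> 2" for A
    using hub[OF that] that(1) by (auto simp: hubs_def)
  have new_path: "x \<in> {u, v, t}" if "pendant_path y z x l' a' b'" for x y z l' a' b'
  proof -
    have "card x \<noteq> 2" using none that by blast
    then show ?thesis using only that by (auto simp: pendant_path_def)
  qed
  have uv: "u \<inter> v = {a}" and vt: "v \<inter> t = {b}"
    using meet_unique[OF W(1,2,4)] meet_unique[OF W(2,3,5)] e by blast+
  have ut: "u \<inter> t = {}"
    using no_triangle[OF W(1,2,3,4,5,6) e(3-6)] by blast
  have v_nbr: "x \<in> {u, v, t}" if x: "x \<in> W" "f \<in> v" "f \<in> x" for x f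
  proof (cases "x = u \<or> x = v")
    case False
    then have "pendant_path u v x l a f"
      unfolding pendant_path_def using W e x big by auto
    then show ?thesis by (rule new_path)
  qed auto
  have "\<not> v \<subseteq> {a, b}"
  proof
    assume "v \<subseteq> {a, b}"
    then have "card v \<le> card {a, b}" by (intro card_mono) auto
    also have "\<dots> \<le> 2" by (simp add: card_insert_if)
    finally show False using big by simp
  qed
  then obtain f where f: "f \<in> v" "f \<noteq> a" "f \<noteq> b" by auto
  have f_outer: "f \<in> outer W"
  proof (rule ccontr)
    assume "f \<notin> outer W"
    then have "f \<in> inner W" using block_cases[OF W(2) f(1)] by simp
    then obtain x where x: "x \<in> W" "x \<noteq> v" "f \<in> x" using other_block W(2) f(1) by metis
    then have "x \<in> {u, v, t}" using v_nbr f(1) by blast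
    then show False using x f uv vt by auto
  qed
  have u_nbr: "x \<in> {u, v, t}" if x: "x \<in> W" "g \<in> u" "g \<in> x" for x g
  proof (cases "x = u \<or> x = v")
    case False
    then have "pendant_path v u x f a g"
      unfolding pendant_path_def using W e x big f f_outer by auto
    then show ?thesis by (rule new_path)
  qed auto
  have t_nbr: "x \<in> {u, v, t}" if x: "x \<in> W" "g \<in> t" "g \<in> x" for x g
  proof (cases "x = t \<or> x = v")
    case False
    then have "pendant_path v t x f b g"
      unfolding pendant_path_def using W e x big f f_outer by auto
    then show ?thesis by (rule new_path)
  qed auto
  have "{u, v, t} = W"
  proof (rule closed_eq_all)
    fix A B g assume AB: "A \<in> {u, v, t}" "B \<in> W" "g \<in> A" "g \<in> B"
    from AB(1) consider "A = u" | "A = v" | "A = t" by blast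
    then show "B \<in> {u, v, t}"
      using u_nbr[OF AB(2) _ AB(4)] v_nbr[OF AB(2) _ AB(4)] t_nbr[OF AB(2) _ AB(4)] AB(3) by cases simp_all
  qed (use W in auto)
  then have "card W = card {u, v, t}" by simp
  then show False using card W by simp
qed

section \<open>Equitable colourings for excess one and two\<close>

lemma ex_good_excess_one:
  assumes excess: "card (inner W) = card (outer W) + 1" and hubs: "2 \<le> card (hubs W)"
  shows "\<exists>q. good W (card (outer W)) q \<and> balanced W q"
proof -
  have "card {A \<in> W. card A = 2} \<le> card (outer W)"
    using card_hubs hubs excess card_blocks by linarith
  then obtain u v t l a b where path: "pendant_path u v t l a b"
    using ex_pendant_path excess by auto
  obtain W' Z where W': "block_tree W'" "card W = card W' + 2" "outer W' = outer W - {l}"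
    "inner W' = inner W - {a, b}" "W' = insert Z (W - {u, v, t})" "Z \<notin> W"
    "Z = (u - {a, l}) \<union> (v - {a, b}) \<union> (t - {b})"
    "card u + card v + card t = card Z + 5"
    "(u - {a, l}) \<inter> (v - {a, b}) = {}" "(u - {a, l}) \<inter> (t - {b}) = {}" "(v - {a, b}) \<inter> (t - {b}) = {}"
    by (rule collapse_path[OF path])
  interpret W': block_tree W' by (rule W'(1))
  have "l \<in> outer W" using path by (simp add: pendant_path_def)
  then have "card (outer W) = Suc (card (outer W'))"
    using card.remove[OF finite_outer] W'(3) by simp
  then have eq: "card (inner W') = card (outer W')"
    using W'(2) card_blocks W'.card_blocks excess by linarith
  \<comment> \<open>Two hubs force four pendant edges, hence at least six blocks before the collapse
    and four after it, as \<open>ex_good\<close> requires.\<close>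
  moreover have "4 \<le> card W'"
    using card_hubs_le hubs excess card_blocks W'(2) by linarith
  ultimately obtain p where p: "good W' (card (outer W')) p" "inj_on p (inner W')"
    using ex_good[OF W'(1)] by auto
  have "balanced W' p" using W'.balanced_if_inj[OF p eq] .
  then show ?thesis
    using good_excess_step[OF path, of 1, OF _ _ W'(3-5,7,9-11,1) _ p(1)] eq hubs by simp
qed

lemma ex_good_excess_two:
  assumes excess: "card (inner W) = card (outer W) + 2" and hubs: "3 \<le> card (hubs W)"
  shows "\<exists>q. good W (card (outer W)) q \<and> balanced W q"
proof -
  have "card {A \<in> W. card A = 2} \<le> card (outer W)"
    using card_hubs hubs excess card_blocks by linarith
  then obtain u0 v0 t0 l0 a0 b0 where path0: "pendant_path u0 v0 t0 l0 a0 b0"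
    using ex_pendant_path excess by auto
  have card: "5 \<le> card (outer W)" using card_hubs_le hubs by linarith
  obtain u v t l a b where path: "pendant_path u v t l a b"
    and small: "card (hubs W) = 3 \<Longrightarrow> card u = 2 \<or> card v = 2 \<or> card t = 2"
    using ex_pendant_path_two[OF path0] path0 card excess card_blocks by (cases "card (hubs W) = 3") auto
  obtain W' Z where W': "block_tree W'" "card W = card W' + 2" "outer W' = outer W - {l}"
    "inner W' = inner W - {a, b}" "W' = insert Z (W - {u, v, t})" "Z \<notin> W"
    "Z = (u - {a, l}) \<union> (v - {a, b}) \<union> (t - {b})"
    "card u + card v + card t = card Z + 5"
    "(u - {a, l}) \<inter> (v - {a, b}) = {}" "(u - {a, l}) \<inter> (t - {b}) = {}" "(v - {a, b}) \<inter> (t - {b}) = {}"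
    by (rule collapse_path[OF path])
  interpret W': block_tree W' by (rule W'(1))
  have W: "u \<in> W" "v \<in> W" "t \<in> W" "u \<noteq> v" "v \<noteq> t" "u \<noteq> t" "l \<in> outer W"
    using path by (auto simp: pendant_path_def)
  then have "card (outer W) = Suc (card (outer W'))"
    using card.remove[OF finite_outer] W'(3) by simp
  then have eq: "card (inner W') = card (outer W') + 1"
    using W'(2) card_blocks W'.card_blocks excess by linarith
  \<comment> \<open>The case of excess one needs two hubs. If \<open>Z\<close> is a hub, it replaces
    at most three hubs, and at most two when there are only three, by \<open>small\<close>. If
    \<open>Z\<close> is no hub, two of \<open>u\<close>, \<open>v\<close>, \<open>t\<close> have
    size two, so at most one hub is lost.\<close>
  have "2 \<le> card (hubs W')"
  proof -
    have sub: "hubs W - {u, v, t} \<subseteq> hubs W'" by (auto simp: hubs_def W'(5))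
    have split: "card (hubs W) \<le> card (hubs W - {u, v, t}) + card (hubs W \<inter> {u, v, t})"
      using finite_hubs by (metis card_Un_le Un_Diff_Int)
    have c: "2 \<le> card u" "2 \<le> card v" "2 \<le> card t" using W card_block by auto
    have le: "card (hubs W - {u, v, t}) \<le> card (hubs W')"
      using sub W'.finite_hubs by (intro card_mono)
    show ?thesis
    proof (cases "3 \<le> card Z")
      case True
      then have "insert Z (hubs W - {u, v, t}) \<subseteq> hubs W'" using sub by (auto simp: hubs_def W'(5))
      moreover have "Z \<notin> hubs W - {u, v, t}" using W'(6) by (auto simp: hubs_def)
      ultimately have "Suc (card (hubs W - {u, v, t})) \<le> card (hubs W')"
        using W'.finite_hubs finite_hubs card_mono[of "hubs W'" "insert Z (hubs W - {u, v, t})"] by simp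
      moreover have le3: "card (hubs W \<inter> {u, v, t}) \<le> (if card (hubs W) = 3 then 2 else 3)"
      proof -
        have "card (hubs W \<inter> {u, v, t}) \<le> card {u, v, t}" by (intro card_mono) auto
        then have 3: "card (hubs W \<inter> {u, v, t}) \<le> 3" using W by simp
        have "card (hubs W \<inter> {u, v, t}) \<le> 2" if h: "card (hubs W) = 3"
        proof -
          obtain x where x: "x \<in> {u, v, t}" "card x = 2" using small[OF h] by auto
          then have "hubs W \<inter> {u, v, t} \<subseteq> {u, v, t} - {x}" by (auto simp: hubs_def)
          then have "card (hubs W \<inter> {u, v, t}) \<le> card ({u, v, t} - {x})" by (intro card_mono) auto
          also have "\<dots> = 2" using x(1) W by simp
          finally show ?thesis .
        qed
        then show ?thesis using 3 by simp
      qed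
      ultimately show ?thesis using split hubs by (auto split: if_splits)
    next
      case False
      then have "card u + card v + card t \<le> 7" using W'(8) by simp
      then consider "card u = 2" "card v = 2" | "card u = 2" "card t = 2" | "card v = 2" "card t = 2"
        using c by linarith
      then have "card (hubs W \<inter> {u, v, t}) \<le> 1"
      proof cases
        case 1
        then have "hubs W \<inter> {u, v, t} \<subseteq> {t}" by (auto simp: hubs_def)
        then have "card (hubs W \<inter> {u, v, t}) \<le> card {t}" by (intro card_mono) auto
        then show ?thesis by simp
      next
        case 2
        then have "hubs W \<inter> {u, v, t} \<subseteq> {v}" by (auto simp: hubs_def)
        then have "card (hubs W \<inter> {u, v, t}) \<le> card {v}" by (intro card_mono) auto
        then show ?thesis by simp
      next
        case 3
        then have "hubs W \<inter> {u, v, t} \<subseteq> {u}" by (auto simp: hubs_def)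
        then have "card (hubs W \<inter> {u, v, t}) \<le> card {u}" by (intro card_mono) auto
        then show ?thesis by simp
      qed
      then show ?thesis using le split hubs by linarith
    qed
  qed
  then obtain p where p: "good W' (card (outer W')) p" "balanced W' p"
    using W'.ex_good_excess_one[OF eq] by blast
  show ?thesis
    using good_excess_step[OF path, of 2, OF _ _ W'(3-5,7,9-11,1) _ p] eq hubs by simp
qed

theorem ex_good_equitable:
  assumes card: "4 \<le> card W" and excess: "card (inner W) \<le> card (outer W) + 2"
    and two: "card {A \<in> W. card A = 2} \<le> card (outer W)"
  obtains p where "good W (card (outer W)) p"
    "\<And>i j. \<lbrakk>i \<in> {1..card (outer W)}; j \<in> {1..card (outer W)}\<rbrakk> \<Longrightarrow>
       card {e \<in> inner W. p e = i} \<le> card {e \<in> inner W. p e = j} + 1"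
proof -
  \<comment> \<open>This is where the bound on degree-two vertices enters: an excess of
    \<open>d\<close> forces \<open>d + 1\<close> hubs.\<close>
  have hubs: "card (inner W) + 1 \<le> card (outer W) + card (hubs W)"
    using card_hubs two card_blocks by linarith
  consider "card (inner W) \<le> card (outer W)" | "card (inner W) = card (outer W) + 1"
    | "card (inner W) = card (outer W) + 2"
    using excess by linarith
  then show thesis
  proof cases
    case 1
    then obtain p where p: "good W (card (outer W)) p" "inj_on p (inner W)"
      using ex_good[OF block_tree_axioms card] by blast
    have "card {e \<in> inner W. p e = i} \<le> 1" for i
    proof -
      have "e = f" if "e \<in> {e \<in> inner W. p e = i}" "f \<in> {e \<in> inner W. p e = i}" for e f
        using that p(2) by (auto dest: inj_onD)
      then show ?thesis using finite_inner by (simp add: card_le_Suc0_iff_eq)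
    qed
    then show thesis using that[OF p(1)] trans_le_add2 by metis
  next
    case 2
    then obtain p where p: "good W (card (outer W)) p" "balanced W p"
      using ex_good_excess_one hubs by auto
    show thesis by (rule that[OF p(1)]) (rule balanced_le[OF p(2)])
  next
    case 3
    then obtain p where p: "good W (card (outer W)) p" "balanced W p"
      using ex_good_excess_two hubs by auto
    show thesis by (rule that[OF p(1)]) (rule balanced_le[OF p(2)])
  qed
qed

end

section \<open>At most three blocks\<close>

lemma good_range_outer: "good W k p \<Longrightarrow> p ` outer W \<subseteq> {1..k}"
  unfolding good_def by (meson image_mono outer_subset order_trans)

lemma good_card_le:
  assumes "good W k p"
  shows "card (outer W) \<le> k"
proof -
  have "inj_on p (outer W)" using assms by (simp add: good_def)
  moreover note good_range_outer[OF assms]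
  ultimately have "card (outer W) \<le> card {1..k}"
    by (intro card_inj_on_le) auto
  then show ?thesis by simp
qed

context block_tree
begin

text \<open>The pendant edges have distinct colours and are as many as the colours, so each colour
  occurs on exactly one of them. Equitability thereby depends on the inner edges alone.\<close>

lemma card_class:
  assumes p: "good W (card (outer W)) p" and i: "i \<in> {1..card (outer W)}"
  shows "card {e \<in> \<Union>W. p e = i} = 1 + card {e \<in> inner W. p e = i}"
proof -
  have inj: "inj_on p (outer W)" using p by (simp add: good_def)
  have "p ` outer W \<subseteq> {1..card (outer W)}"
    using p by (rule good_range_outer)
  moreover have "card (p ` outer W) = card {1..card (outer W)}" using inj by (simp add: card_image)
  ultimately have "p ` outer W = {1..card (outer W)}" by (intro card_subset_eq) auto
  then obtain l where l: "l \<in> outer W" "p l = i" using i by (metis imageE)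
  have "l \<notin> {e \<in> inner W. p e = i}" using l by (simp add: outer_def)
  moreover have "{e \<in> \<Union>W. p e = i} = insert l {e \<in> inner W. p e = i}"
  proof (intro equalityI subsetI)
    fix e assume e: "e \<in> {e \<in> \<Union>W. p e = i}"
    show "e \<in> insert l {e \<in> inner W. p e = i}"
    proof (cases "e \<in> inner W")
      case False
      then have "e \<in> outer W" using e by (simp add: outer_def)
      then have "e = l" using inj_onD[OF inj, of e l] e l by simp
      then show ?thesis by simp
    qed (use e in simp)
  next
    fix e assume "e \<in> insert l {e \<in> inner W. p e = i}"
    then show "e \<in> {e \<in> \<Union>W. p e = i}"
      using l outer_subset[of W] inner_subset[of W] by blast
  qed
  ultimately show ?thesis using finite_inner by simp
qed

text \<open>The ends of two inner edges are two pairs among at most three blocks, so the pairs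
  meet.\<close>

lemma common_block:
  assumes card: "card W \<le> 3" and ef: "e \<in> inner W" "f \<in> inner W"
  obtains F where "F \<in> W" "e \<in> F" "f \<in> F"
proof -
  obtain A B where AB: "A \<in> W" "B \<in> W" "A \<noteq> B" "e \<in> A" "e \<in> B" using ef(1) by (auto simp: inner_def)
  obtain C D where CD: "C \<in> W" "D \<in> W" "C \<noteq> D" "f \<in> C" "f \<in> D" using ef(2) by (auto simp: inner_def)
  have "{A, B} \<inter> {C, D} \<noteq> {}"
  proof
    assume "{A, B} \<inter> {C, D} = {}"
    then have "card ({A, B} \<union> {C, D}) = card {A, B} + card {C, D}" by (intro card_Un_disjoint) auto
    moreover have "card ({A, B} \<union> {C, D}) \<le> card W" using AB CD finite_blocks by (intro card_mono) auto
    ultimately show False using card AB(3) CD(3) by simp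
  qed
  then show thesis using that AB CD by blast
qed

lemma inj_inner_if_few_blocks:
  assumes p: "good W k p" and card: "card W \<le> 3"
  shows "inj_on p (inner W)"
proof (rule inj_onI)
  fix e f assume ef: "e \<in> inner W" "f \<in> inner W" "p e = p f"
  obtain F where F: "F \<in> W" "e \<in> F" "f \<in> F" using common_block[OF card ef(1,2)] .
  then have "inj_on p F" using p by (simp add: good_def)
  then show "e = f" using F ef(3) by (auto dest: inj_onD)
qed

text \<open>There is one more edge than there are colours, so one colour is repeated: the inner edge
  \<open>a\<close> takes the colour of a pendant edge \<open>l\<close> at the opposite end. All
  other colours are unique, so only \<open>t\<close> and \<open>v\<close> might be confused, and
  only as \<open>{l, b}\<close> and \<open>{a, b}\<close>.\<close>

lemma ex_good_three_blocks:
  assumes card: "card W = 3" and big: "\<exists>A\<in>W. card A \<noteq> 2"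
  shows "\<exists>p. good W (card (outer W) + 1) p \<and>
    (\<forall>i\<in>{1..card (outer W) + 1}. card {e \<in> \<Union>W. p e = i} \<in> {1, 2})"
proof -
  have "card (inner W) = 2" using card card_blocks by simp
  then obtain a0 b0 where ab0: "inner W = {a0, b0}" "a0 \<noteq> b0"
    by (auto simp: card_2_iff)
  obtain v where v: "v \<in> W" "a0 \<in> v" "b0 \<in> v"
    using common_block[of a0 b0] card ab0 by auto
  obtain u0 where u0: "u0 \<in> W" "u0 \<noteq> v" "a0 \<in> u0" using other_block[of a0 v] ab0 v by auto
  obtain t0 where t0: "t0 \<in> W" "t0 \<noteq> v" "b0 \<in> t0" using other_block[of b0 v] ab0 v by auto
  have ne0: "u0 \<noteq> t0" using meet_unique[OF u0(1) v(1) u0(2), of a0 b0] u0 t0 v ab0 by auto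
  have W0: "W = {u0, v, t0}"
  proof -
    have "card {u0, v, t0} = card W" using card ne0 u0 t0 by simp
    then show ?thesis using card_subset_eq[OF finite_blocks, of "{u0, v, t0}"] u0 v t0 by simp
  qed
  \<comment> \<open>The path of blocks is oriented so that \<open>t\<close> and \<open>v\<close>,
    the two blocks endangered by the repeated colour, are not both of size two.\<close>
  obtain u t a b where ab: "inner W = {a, b}" "a \<noteq> b" and W: "W = {u, v, t}" "u \<noteq> v" "t \<noteq> v" "u \<noteq> t"
    and mem: "a \<in> u" "a \<in> v" "b \<in> v" "b \<in> t" and not22: "\<not> (card t = 2 \<and> card v = 2)"
  proof (cases "card t0 = 2 \<and> card v = 2")
    case False
    then show thesis using that[of a0 b0 u0 t0] ab0 W0 u0 t0 v ne0 by auto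
  next
    case True
    then have "card u0 \<noteq> 2" using big W0 by auto
    then show thesis using that[of b0 a0 t0 u0] ab0 W0 u0 t0 v ne0 by (auto simp: insert_commute)
  qed
  have mW: "u \<in> W" "v \<in> W" "t \<in> W" using W by auto
  have a_t: "a \<notin> t" using meet_unique[OF mW(2,3), of a b] W mem ab by auto
  have b_u: "b \<notin> u" using meet_unique[OF mW(1,2), of a b] W mem ab by auto
  have "2 \<le> card u" "2 \<le> card t" using card_block mW by auto
  then have "u \<noteq> {a}" "t \<noteq> {b}" by auto
  then obtain lu l where "lu \<in> u" "lu \<noteq> a" "l \<in> t" "l \<noteq> b" using mem by blast
  then have lu: "lu \<in> u" "lu \<in> outer W" and l: "l \<in> t" "l \<in> outer W"
    using block_cases[of u lu] block_cases[of t l] mW ab a_t b_u by auto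
  have out: "l \<notin> u" "l \<notin> v" "lu \<notin> v" "lu \<notin> t"
    using outer_unique[OF l(2) mW(3,1) l(1)] outer_unique[OF l(2) mW(3,2) l(1)]
      outer_unique[OF lu(2) mW(1,2) lu(1)] outer_unique[OF lu(2) mW(1,3) lu(1)] W(2-4) by auto
  have a_out: "a \<notin> outer W" "a \<in> \<Union>W" "l \<noteq> a" using ab mW mem l by (auto simp: outer_def)
  have card_U: "card (\<Union>W) = card (outer W) + 2"
  proof -
    have "\<Union>W = inner W \<union> outer W" using inner_subset[of W] by (auto simp: outer_def)
    then have "card (\<Union>W) = card (inner W) + card (outer W)"
      using finite_inner finite_outer inner_Int_outer by (simp add: card_Un_disjoint)
    then show ?thesis using ab by simp
  qed
  define k where "k = card (outer W) + 1"
  have "card (\<Union>W - {a}) = card {1..k}"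
    using card_U a_out finite_Union_blocks by (simp add: k_def)
  then obtain h where h: "bij_betw h (\<Union>W - {a}) {1..k}"
    using finite_Union_blocks by (metis finite_Diff finite_atLeastAtMost finite_same_card_bij)
  have h_inj: "e = f" if "h e = h f" "e \<in> \<Union>W" "f \<in> \<Union>W" "e \<noteq> a" "f \<noteq> a" for e f
    using h that by (auto simp: bij_betw_def dest: inj_onD)
  have h_range: "h ` (\<Union>W - {a}) = {1..k}" using h by (simp add: bij_betw_def)
  \<comment> \<open>\<open>h\<close> numbers all edges except \<open>a\<close> bijectively;
    \<open>a\<close> and \<open>l\<close> share no block, so the repetition is proper.\<close>
  define p where "p = h(a := h l)"
  have p: "p a = h l" "\<And>e. e \<noteq> a \<Longrightarrow> p e = h e" by (auto simp: p_def)
  have p_eq: "e = f \<or> {e, f} = {a, l}" if ef: "p e = p f" "e \<in> \<Union>W" "f \<in> \<Union>W" for e f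
  proof (cases "e = a \<or> f = a")
    case True
    have "l \<in> \<Union>W" using l mW by auto
    then show ?thesis using True ef p h_inj[of l f] h_inj[of e l] a_out(3) by (cases "e = a"; cases "f = a") auto
  next
    case False
    then show ?thesis using ef p h_inj[of e f] by simp
  qed
  have "inj_on p A" if A: "A \<in> W" for A
  proof (rule inj_onI)
    fix e f assume ef: "e \<in> A" "f \<in> A" "p e = p f"
    have "\<not> (a \<in> A \<and> l \<in> A)" using A W(1) a_t out by auto
    then show "e = f" using p_eq[of e f] ef A by (auto simp: doubleton_eq_iff)
  qed
  moreover have "inj_on p (outer W)"
  proof (rule inj_onI)
    fix e f assume ef: "e \<in> outer W" "f \<in> outer W" "p e = p f"
    then show "e = f" using p_eq[of e f] a_out(1) outer_subset[of W] by (auto simp: doubleton_eq_iff)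
  qed
  moreover have "inj_on (image p) W"
  proof -
    have lu_new: "p lu \<notin> p ` A" if A: "A = v \<or> A = t" for A
    proof
      assume "p lu \<in> p ` A"
      then obtain e where e: "e \<in> A" "p lu = p e" by auto
      have "lu \<in> \<Union>W" "e \<in> \<Union>W" using lu(1) e(1) mW A by blast+
      then have "lu = e \<or> {lu, e} = {a, l}" using p_eq e(2) by blast
      moreover have "lu \<noteq> e" "lu \<noteq> a" "lu \<noteq> l" using e A out lu a_out by auto
      ultimately show False by (auto simp: doubleton_eq_iff)
    qed
    have "p ` u \<noteq> p ` v" "p ` u \<noteq> p ` t" using lu_new lu(1) by blast+
    moreover have "p ` t \<noteq> p ` v"
    proof
      assume eq: "p ` t = p ` v"
      have "t \<subseteq> {l, b}"
      proof
        fix e assume e: "e \<in> t"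
        then obtain f where f: "f \<in> v" "p e = p f" using eq by (metis imageE imageI)
        have "e \<in> \<Union>W" "f \<in> \<Union>W" using e f(1) mW by blast+
        then have "e = f \<or> {e, f} = {a, l}" using p_eq f(2) by blast
        then show "e \<in> {l, b}"
          using meet_unique[OF mW(3,2) W(3), of e b] e f mem a_t by (auto simp: doubleton_eq_iff)
      qed
      moreover have "v \<subseteq> {a, b}"
      proof
        fix e assume e: "e \<in> v"
        then obtain f where f: "f \<in> t" "p e = p f" using eq by (metis imageE imageI)
        have "e \<in> \<Union>W" "f \<in> \<Union>W" using e f(1) mW by blast+
        then have "e = f \<or> {e, f} = {a, l}" using p_eq f(2) by blast
        then show "e \<in> {a, b}"
          using meet_unique[OF mW(3,2) W(3), of e b] e f mem a_t by (auto simp: doubleton_eq_iff)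
      qed
      ultimately have "card t \<le> card {l, b}" "card v \<le> card {a, b}" by (auto intro: card_mono)
      moreover have "card {l, b} \<le> 2" "card {a, b} \<le> 2" by (simp_all add: card_insert_if)
      ultimately have "card t \<le> 2" "card v \<le> 2" by linarith+
      then show False using not22 card_block[OF mW(2)] card_block[OF mW(3)] by simp
    qed
    ultimately show ?thesis unfolding W(1) inj_on_def by blast
  qed
  moreover have "p ` \<Union>W \<subseteq> {1..k}"
  proof (rule image_subsetI)
    fix e assume e: "e \<in> \<Union>W"
    have "l \<in> \<Union>W - {a}" using l mW a_out by auto
    then have "h l \<in> {1..k}" using h_range by blast
    moreover have "h e \<in> {1..k}" if "e \<noteq> a" using e that h_range by blast
    ultimately show "p e \<in> {1..k}" using p by (cases "e = a") auto
  qed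
  ultimately have "good W k p" by (simp add: good_def)
  moreover have "card {e \<in> \<Union>W. p e = i} \<in> {1, 2}" if i: "i \<in> {1..k}" for i
  proof -
    have "i \<in> h ` (\<Union>W - {a})" unfolding h_range by (rule i)
    then obtain e where e: "e \<in> \<Union>W" "e \<noteq> a" "h e = i" by blast
    have "f = e \<or> f = a" if "f \<in> \<Union>W" "p f = i" for f
    proof (cases "f = a")
      case False
      have "h f = h e" using p(2)[OF False] that(2) e(3) by simp
      then show ?thesis using h_inj[OF _ that(1) e(1) False e(2)] by blast
    qed simp
    then have "{f \<in> \<Union>W. p f = i} \<subseteq> {e, a}" by blast
    moreover have "e \<in> {f \<in> \<Union>W. p f = i}" using e p(2)[of e] by simp
    ultimately have "{f \<in> \<Union>W. p f = i} = {e, a} \<or> {f \<in> \<Union>W. p f = i} = {e}" by blast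
    then show ?thesis using e(2) by auto
  qed
  ultimately have "good W k p \<and> (\<forall>i\<in>{1..k}. card {e \<in> \<Union>W. p e = i} \<in> {1, 2})" by blast
  then show ?thesis unfolding k_def by (intro exI[where x = p])
qed

end

section \<open>Trees\<close>

lemma edge_cases:
  assumes "simple_graph V E" "e \<in> E"
  obtains x y where "e = {x, y}" "x \<noteq> y" "x \<in> V" "y \<in> V"
proof -
  have "e \<in> [V]\<^bsup>2\<^esup>" using assms by (auto simp: simple_graph_def)
  then obtain x y where "e = {x, y}" "x \<in> V" "y \<in> V" "x \<noteq> y" by (rule nsets2_E)
  then show thesis using that by blast
qed

lemma edge_subset:
  assumes "simple_graph V E" "e \<in> E"
  shows "e \<subseteq> V"
  using edge_cases[OF assms] by (metis empty_subsetI insert_subset)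

lemma finite_edges: "simple_graph V E \<Longrightarrow> finite E"
  unfolding simple_graph_def using finite_imp_finite_nsets finite_subset by blast

lemma connected_closed:
  assumes "connected_graph V E" "S \<subseteq> V" "S \<noteq> {}"
    and closed: "\<And>x y. \<lbrakk>x \<in> S; y \<in> V; {x, y} \<in> E\<rbrakk> \<Longrightarrow> y \<in> S"
    and "simple_graph V E"
  shows "S = V"
proof (intro equalityI subsetI)
  fix y assume y: "y \<in> V"
  obtain x where x: "x \<in> S" using assms(3) by blast
  then have "(x, y) \<in> (adj_rel E)\<^sup>*" using assms(1,2) y by (auto simp: connected_graph_def)
  then show "y \<in> S"
  proof (induction rule: rtrancl_induct)
    case (step z w)
    then have e: "{z, w} \<in> E" by (simp add: adj_rel_def)
    then have "w \<in> V" using edge_subset[OF assms(5)] by blast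
    then show ?case using closed[OF step.IH _ e] by simp
  qed (rule x)
qed (use assms(2) in auto)

text \<open>The cycle closes up the initial part of a longest path inside \<open>S\<close>, up to a second
  neighbour of its first vertex.\<close>

lemma ex_cycle:
  assumes S: "finite S" "S \<noteq> {}" and loop: "\<And>x. {x} \<notin> E"
    and nbrs: "\<And>v. v \<in> S \<Longrightarrow> \<exists>x\<in>S. \<exists>y\<in>S. x \<noteq> y \<and> {v, x} \<in> E \<and> {v, y} \<in> E"
  shows "\<exists>c. is_cycle E c"
proof -
  define P where "P xs \<longleftrightarrow> xs \<noteq> [] \<and> distinct xs \<and> set xs \<subseteq> S \<and>
    (\<forall>i. Suc i < length xs \<longrightarrow> {xs ! i, xs ! Suc i} \<in> E)" for xs
  obtain s where "s \<in> S" using S by auto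
  then have P_single: "P [s]" by (simp add: P_def)
  have bound: "length xs < Suc (card S)" if "P xs" for xs
  proof -
    have "length xs = card (set xs)" using that by (simp add: P_def distinct_card)
    also have "\<dots> \<le> card S" using that S by (intro card_mono) (auto simp: P_def)
    finally show ?thesis by simp
  qed
  obtain xs where xs: "P xs" and max: "\<And>ys. P ys \<Longrightarrow> length ys \<le> length xs"
    using ex_has_greatest_nat[of P "[s]" length "Suc (card S)"] P_single bound by blast
  have ne: "xs \<noteq> []" and dist: "distinct xs" and sub: "set xs \<subseteq> S"
    and step: "\<And>i. Suc i < length xs \<Longrightarrow> {xs ! i, xs ! Suc i} \<in> E"
    using xs by (auto simp: P_def)
  have hd: "hd xs = xs ! 0" using ne by (simp add: hd_conv_nth)
  have "xs ! 0 \<in> S" using ne sub by auto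
  then obtain x y where xy: "x \<in> S" "y \<in> S" "x \<noteq> y" "{xs ! 0, x} \<in> E" "{xs ! 0, y} \<in> E"
    using nbrs by blast
  \<comment> \<open>A neighbour off the path could be prepended to it, against maximality; position
    zero would be a loop.\<close>
  have on_path: "\<exists>i. i < length xs \<and> 1 \<le> i \<and> z = xs ! i" if z: "z \<in> S" "{xs ! 0, z} \<in> E" for z
  proof -
    have "z \<in> set xs"
    proof (rule ccontr)
      assume "z \<notin> set xs"
      have "{(z # xs) ! i, (z # xs) ! Suc i} \<in> E" if "Suc i < length (z # xs)" for i
        using that step z by (cases i) (auto simp: insert_commute)
      then have "P (z # xs)" using \<open>z \<notin> set xs\<close> z dist sub by (auto simp: P_def)
      then show False using max[of "z # xs"] by simp
    qed
    then obtain i where i: "i < length xs" "z = xs ! i" by (auto simp: in_set_conv_nth)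
    have "i \<noteq> 0"
    proof
      assume "i = 0"
      then have "{xs ! 0} \<in> E" using i z by simp
      then show False using loop by blast
    qed
    then show ?thesis using i by auto
  qed
  obtain i j where ij: "i < length xs" "1 \<le> i" "x = xs ! i" "j < length xs" "1 \<le> j" "y = xs ! j"
    using on_path[OF xy(1,4)] on_path[OF xy(2,5)] by blast
  have "i \<noteq> j" using ij xy(3) by auto
  \<comment> \<open>Of two different positions that are at least one, some position is at least two,
    so the closed path has three or more vertices.\<close>
  then obtain m where m: "m < length xs" "2 \<le> m" "{xs ! m, xs ! 0} \<in> E"
  proof (cases "2 \<le> i")
    case True
    then show thesis using that[of i] ij xy by (auto simp: insert_commute)
  next
    case False
    then show thesis using that[of j] ij xy \<open>i \<noteq> j\<close> by (auto simp: insert_commute)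
  qed
  have "is_cycle E (take (Suc m) xs)"
    unfolding is_cycle_def
  proof (intro conjI allI impI)
    show "3 \<le> length (take (Suc m) xs)" using m by simp
    show "distinct (take (Suc m) xs)" using dist by simp
    fix k assume "k < length (take (Suc m) xs)"
    then have k: "k \<le> m" and len: "length (take (Suc m) xs) = Suc m" using m by auto
    show "{take (Suc m) xs ! k, take (Suc m) xs ! (Suc k mod length (take (Suc m) xs))} \<in> E"
    proof (cases "k = m")
      case True
      then show ?thesis unfolding len using m by simp
    next
      case False
      then show ?thesis unfolding len using k m step[of k] by simp
    qed
  qed
  then show ?thesis by blast
qed

text \<open>By \<open>ex_cycle\<close>, acyclicity yields a vertex of \<open>S\<close> with at most
  one neighbour in \<open>S\<close>; removing it loses one vertex and at most one edge.\<close>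

lemma tree_sparse:
  assumes tree: "is_tree V E" and "S \<subseteq> V" "S \<noteq> {}"
  shows "card {e \<in> E. e \<subseteq> S} < card S"
  using assms(2,3)
proof (induction "card S" arbitrary: S rule: less_induct)
  case less
  have graph: "simple_graph V E" and acyclic: "\<nexists>c. is_cycle E c" using tree by (auto simp: is_tree_def)
  have finS: "finite S" using less.prems graph finite_subset by (auto simp: simple_graph_def)
  have finE: "finite E" using graph by (rule finite_edges)
  have loop: "{x} \<notin> E" for x using edge_cases[OF graph, of "{x}"] by (metis doubleton_eq_iff insert_absorb2)
  obtain v where v: "v \<in> S" "\<And>x y. \<lbrakk>x \<in> S; y \<in> S; {v, x} \<in> E; {v, y} \<in> E\<rbrakk> \<Longrightarrow> x = y"
    using ex_cycle[OF finS less.prems(2) loop] acyclic by blast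
  have one: "card {e \<in> E. e \<subseteq> S \<and> v \<in> e} \<le> 1"
  proof -
    have "e = f" if e: "e \<in> E" "e \<subseteq> S" "v \<in> e" and f: "f \<in> E" "f \<subseteq> S" "v \<in> f" for e f
    proof -
      obtain x where x: "e = {v, x}" using e edge_cases[OF graph e(1)] by (metis empty_iff insert_commute insert_iff)
      obtain y where y: "f = {v, y}" using f edge_cases[OF graph f(1)] by (metis empty_iff insert_commute insert_iff)
      have "x = y" using v(2)[of x y] x y e f by simp
      then show ?thesis using x y by simp
    qed
    then show ?thesis using finE by (auto simp: card_le_Suc0_iff_eq)
  qed
  have split: "{e \<in> E. e \<subseteq> S} = {e \<in> E. e \<subseteq> S - {v}} \<union> {e \<in> E. e \<subseteq> S \<and> v \<in> e}" by auto
  have le: "card {e \<in> E. e \<subseteq> S} \<le> card {e \<in> E. e \<subseteq> S - {v}} + 1"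
    unfolding split by (rule order.trans[OF card_Un_le]) (use one in simp)
  have card_S: "card S = Suc (card (S - {v}))" using finS v(1) by (rule card.remove)
  show ?case
  proof (cases "S - {v} = {}")
    case True
    have "e \<notin> E" if "e \<subseteq> S" for e
    proof
      assume "e \<in> E"
      then obtain x y where "e = {x, y}" "x \<noteq> y" by (rule edge_cases[OF graph])
      then show False using that True by auto
    qed
    then have "{e \<in> E. e \<subseteq> S} = {}" by blast
    then show ?thesis unfolding card_S by (simp only: card.empty zero_less_Suc)
  next
    case False
    then have "card {e \<in> E. e \<subseteq> S - {v}} < card (S - {v})"
      using less.hyps[of "S - {v}"] card_S less.prems by auto
    then show ?thesis using le card_S by simp
  qed
qed

text \<open>Grow a vertex set from a single vertex: as long as it is not everything, connectedness
  provides an edge leaving it, and each new vertex brings a new edge.\<close>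

lemma card_vertices_le:
  assumes graph: "simple_graph V E" and conn: "connected_graph V E"
  shows "card V \<le> card E + 1"
proof -
  have finV: "finite V" using graph by (simp add: simple_graph_def)
  have finE: "finite E" using graph by (rule finite_edges)
  have "\<exists>S\<subseteq>V. card S = Suc n \<and> n \<le> card {e \<in> E. e \<subseteq> S}" if "n < card V" for n
    using that
  proof (induction n)
    case 0
    then obtain v where "v \<in> V" by fastforce
    then show ?case by (intro exI[of _ "{v}"]) simp
  next
    case (Suc n)
    then obtain S where S: "S \<subseteq> V" "card S = Suc n" "n \<le> card {e \<in> E. e \<subseteq> S}" by auto
    have finS: "finite S" using S finV finite_subset by blast
    have "S \<noteq> V" "S \<noteq> {}" using S Suc.prems by auto
    then obtain x y where xy: "x \<in> S" "y \<in> V" "{x, y} \<in> E" "y \<notin> S"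
      using connected_closed[OF conn S(1) _ _ graph] by blast
    have "insert {x, y} {e \<in> E. e \<subseteq> S} \<subseteq> {e \<in> E. e \<subseteq> insert y S}" using xy by auto
    then have "card (insert {x, y} {e \<in> E. e \<subseteq> S}) \<le> card {e \<in> E. e \<subseteq> insert y S}"
      using finE by (intro card_mono) auto
    moreover have "{x, y} \<notin> {e \<in> E. e \<subseteq> S}" using xy by auto
    ultimately have "Suc n \<le> card {e \<in> E. e \<subseteq> insert y S}" using S(3) finE by simp
    then show ?case using S xy finS by (intro exI[of _ "insert y S"]) auto
  qed
  from this[of "card V - 1"] have "card V \<le> Suc (card E) \<or> card V = 0"
  proof (cases "card V = 0")
    case False
    then obtain S where "card V - 1 \<le> card {e \<in> E. e \<subseteq> S}"
      using \<open>card V - 1 < card V \<Longrightarrow> _\<close> by auto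
    also have "\<dots> \<le> card E" using finE by (intro card_mono) auto
    finally show ?thesis by linarith
  qed simp
  then show ?thesis by auto
qed

lemma tree_card:
  assumes "is_tree V E"
  shows "card V = card E + 1"
proof -
  have graph: "simple_graph V E" "connected_graph V E" using assms by (auto simp: is_tree_def)
  then have "V \<noteq> {}" by (simp add: connected_graph_def)
  have "{e \<in> E. e \<subseteq> V} = E"
    using edge_subset[OF graph(1)] by blast
  then have "card E < card V" using tree_sparse[OF assms, of V] \<open>V \<noteq> {}\<close> by simp
  then show ?thesis using card_vertices_le[OF graph] by simp
qed

section \<open>Block trees of trees\<close>

locale big_tree =
  fixes V :: "'a set" and E :: "'a set set"
  assumes tree: "is_tree V E" and card_V: "3 \<le> card V"
begin

lemma graph: "simple_graph V E" and connected: "connected_graph V E"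
  using tree by (auto simp: is_tree_def)

lemma finite_V: "finite V"
  using graph by (simp add: simple_graph_def)

lemma finite_E: "finite E"
  using graph by (rule finite_edges)

lemma incident_iff: "e \<in> incident_edges E v \<longleftrightarrow> e \<in> E \<and> v \<in> e"
  by (auto simp: incident_edges_def)

lemma finite_incident: "finite (incident_edges E v)"
  using finite_E by (simp add: incident_edges_def)

lemma not_closed_pair:
  assumes "S \<subseteq> V" "S \<noteq> {}" "card S \<le> 2"
  obtains x y where "x \<in> S" "y \<in> V" "y \<notin> S" "{x, y} \<in> E"
proof -
  have "S \<noteq> V" using assms card_V by auto
  then show thesis
    using connected_closed[OF connected assms(1,2) _ graph] that by blast
qed

lemma degree_pos: "v \<in> V \<Longrightarrow> 1 \<le> degree E v"
proof -
  assume v: "v \<in> V"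
  obtain x y where "x \<in> {v}" "{x, y} \<in> E" by (rule not_closed_pair[of "{v}"]) (use v in auto)
  then have "{v, y} \<in> incident_edges E v" by (simp add: incident_iff)
  then have "card (incident_edges E v) \<noteq> 0" using finite_incident by auto
  then show ?thesis by (simp add: degree_def)
qed

text \<open>An edge leaving \<open>{u, v}\<close> would contain \<open>u\<close>, \<open>v\<close>
  and a third vertex. So a pair with the same incident edges would be a component, which three
  vertices exclude. This allows vertices to be identified with their edge sets.\<close>

lemma inj_incident: "inj_on (incident_edges E) V"
proof (rule inj_onI, rule ccontr)
  fix u v assume uv: "u \<in> V" "v \<in> V" "incident_edges E u = incident_edges E v" "u \<noteq> v"
  obtain x y where xy: "x \<in> {u, v}" "y \<notin> {u, v}" "{x, y} \<in> E"
    by (rule not_closed_pair[of "{u, v}"]) (use uv in \<open>auto simp: card_insert_if\<close>)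
  then have "{x, y} \<in> incident_edges E u" "{x, y} \<in> incident_edges E v"
    using uv(3) incident_iff[of "{x, y}" x] by auto
  then show False using xy uv(4) by (auto simp: incident_iff)
qed

definition inner_verts :: "'a set" where
  "inner_verts = {v \<in> V. 2 \<le> degree E v}"

definition leaves :: "'a set" where
  "leaves = {v \<in> V. degree E v = 1}"

definition blocks :: "'a set set set" where
  "blocks = incident_edges E ` inner_verts"

lemma verts_split: "V = inner_verts \<union> leaves" "inner_verts \<inter> leaves = {}"
proof -
  have "v \<in> inner_verts \<or> v \<in> leaves" if "v \<in> V" for v
    using degree_pos[OF that] that by (auto simp: inner_verts_def leaves_def)
  then show "V = inner_verts \<union> leaves" by (auto simp: inner_verts_def leaves_def)
  show "inner_verts \<inter> leaves = {}" by (auto simp: inner_verts_def leaves_def)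
qed

lemma leaf_edge:
  assumes "v \<in> leaves"
  obtains e where "incident_edges E v = {e}"
proof -
  have "card (incident_edges E v) = 1" using assms by (simp add: leaves_def degree_def)
  then obtain e where "incident_edges E v = {e}" by (rule card_1_singletonE)
  then show thesis by (rule that)
qed

text \<open>Two adjacent leaves would have the same single incident edge, against
  \<open>inj_incident\<close>. Hence the blocks cover all edges.\<close>

lemma edge_meets_inner:
  assumes "e \<in> E"
  shows "\<exists>v\<in>inner_verts. v \<in> e"
proof (rule ccontr)
  assume none: "\<not> ?thesis"
  obtain x y where e: "e = {x, y}" "x \<noteq> y" "x \<in> V" "y \<in> V" using edge_cases[OF graph assms] .
  then have "x \<in> leaves" "y \<in> leaves" using none verts_split(1) by auto
  then obtain f g where "incident_edges E x = {f}" "incident_edges E y = {g}" by (metis leaf_edge)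
  moreover from this have "e = f" "e = g" using e assms incident_iff[of e x] incident_iff[of e y] by auto
  ultimately show False using inj_onD[OF inj_incident, of x y] e by auto
qed

lemma Union_blocks: "\<Union>blocks = E"
  using edge_meets_inner by (auto simp: blocks_def incident_iff)

lemma inj_inner: "inj_on (incident_edges E) inner_verts"
  using inj_incident by (rule inj_on_subset) (auto simp: inner_verts_def)

text \<open>Formulated for arbitrary sets of non-leaf vertices because \<open>sparse\<close> speaks
  about all subfamilies; it reduces \<open>sparse\<close> to \<open>tree_sparse\<close>.\<close>

lemma inner_image:
  assumes S: "S \<subseteq> inner_verts"
  shows "inner (incident_edges E ` S) = {e \<in> E. e \<subseteq> S}"
proof (intro equalityI subsetI)
  fix e assume "e \<in> inner (incident_edges E ` S)"
  then obtain u v where uv: "u \<in> S" "v \<in> S" "u \<noteq> v" "e \<in> E" "u \<in> e" "v \<in> e"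
    by (auto simp: inner_def incident_iff)
  obtain x y where "e = {x, y}" using edge_cases[OF graph uv(4)] by metis
  then have "e = {u, v}" using uv by auto
  then show "e \<in> {e \<in> E. e \<subseteq> S}" using uv by simp
next
  fix e assume "e \<in> {e \<in> E. e \<subseteq> S}"
  then have e: "e \<in> E" "e \<subseteq> S" by auto
  obtain x y where xy: "e = {x, y}" "x \<noteq> y" using edge_cases[OF graph e(1)] by metis
  then have "incident_edges E x \<noteq> incident_edges E y"
    using e S inj_inner by (auto dest: inj_onD)
  then show "e \<in> inner (incident_edges E ` S)"
    using e xy by (intro innerI[of "incident_edges E x" _ "incident_edges E y"]) (auto simp: incident_iff)
qed

lemma inner_blocks: "inner blocks = {e \<in> E. e \<subseteq> inner_verts}"
  unfolding blocks_def by (rule inner_image) simp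

lemma card_outer: "card (outer blocks) = card leaves"
proof -
  define f where "f v = the_elem (incident_edges E v)" for v
  have f: "incident_edges E v = {f v}" if "v \<in> leaves" for v
    using leaf_edge[OF that] f_def by (metis the_elem_eq)
  have "inj_on f leaves"
  proof (rule inj_onI)
    fix u v assume "u \<in> leaves" "v \<in> leaves" "f u = f v"
    then show "u = v" using f inj_onD[OF inj_incident, of u v] by (simp add: leaves_def)
  qed
  moreover have "f ` leaves = outer blocks"
  proof (intro equalityI subsetI)
    fix e assume "e \<in> f ` leaves"
    then obtain v where v: "v \<in> leaves" "incident_edges E v = {e}" using f by auto
    then have "e \<in> E" "v \<in> e" "v \<notin> inner_verts" using incident_iff[of e v] verts_split(2) by auto
    then show "e \<in> outer blocks"
      by (auto simp: outer_def Union_blocks inner_blocks)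
  next
    fix e assume "e \<in> outer blocks"
    then have e: "e \<in> E" "\<not> e \<subseteq> inner_verts" by (auto simp: outer_def Union_blocks inner_blocks)
    then obtain v where v: "v \<in> e" "v \<in> leaves"
      using edge_subset[OF graph e(1)] verts_split(1) by blast
    then have "e \<in> incident_edges E v" using e by (simp add: incident_iff)
    then show "e \<in> f ` leaves" using f[OF v(2)] v(2) by auto
  qed
  ultimately show ?thesis by (metis card_image)
qed

lemma card_edges: "card E = card (inner blocks) + card (outer blocks)"
proof -
  have "E = inner blocks \<union> outer blocks" "inner blocks \<inter> outer blocks = {}"
    using Union_blocks inner_subset[of blocks] by (auto simp: outer_def)
  then show ?thesis using finite_E by (metis card_Un_disjoint finite_Un)
qed

lemma card_blocks_eq: "card blocks = card inner_verts"
  unfolding blocks_def using inj_inner by (rule card_image)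

sublocale block_tree blocks
proof
  show "finite blocks" using finite_V by (simp add: blocks_def inner_verts_def)
next
  fix A assume "A \<in> blocks"
  then show "2 \<le> card A" by (auto simp: blocks_def inner_verts_def degree_def)
next
  fix A B C e assume "A \<in> blocks" "B \<in> blocks" "C \<in> blocks" and e: "e \<in> A" "e \<in> B" "e \<in> C"
  then obtain u v w where A: "A = incident_edges E u" "B = incident_edges E v" "C = incident_edges E w"
    by (auto simp: blocks_def)
  then have mem: "e \<in> E" "u \<in> e" "v \<in> e" "w \<in> e" using e by (auto simp: incident_iff)
  obtain x y where "e = {x, y}" using edge_cases[OF graph mem(1)] by metis
  then have "u = v \<or> u = w \<or> v = w" using mem by auto
  then show "A = B \<or> A = C \<or> B = C" using A by auto
next
  fix S' assume "S' \<subseteq> blocks" "S' \<noteq> {}"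
  then obtain S where S: "S \<subseteq> inner_verts" "S' = incident_edges E ` S" "S \<noteq> {}"
    unfolding blocks_def by (metis image_is_empty subset_imageE)
  have "S \<subseteq> V" using S(1) by (auto simp: inner_verts_def)
  moreover have "card S' = card S"
    unfolding S(2) using inj_inner S(1) by (meson card_image inj_on_subset)
  ultimately show "card (inner S') < card S'"
    using tree_sparse[OF tree _ S(3)] inner_image[OF S(1)] S(2) by simp
next
  have "card V = card inner_verts + card leaves"
    using verts_split finite_V by (metis card_Un_disjoint finite_Un)
  then show "card blocks = card (inner blocks) + 1"
    using tree_card[OF tree] card_edges card_outer card_blocks_eq by linarith
qed

lemma num_deg_1: "num_deg V E 1 = card (outer blocks)"
  by (simp add: card_outer num_deg_def leaves_def)

lemma num_deg_2: "num_deg V E 2 = card {A \<in> blocks. card A = 2}"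
proof -
  have "{A \<in> blocks. card A = 2} = incident_edges E ` {v \<in> V. degree E v = 2}"
    by (auto simp: blocks_def inner_verts_def degree_def)
  moreover have "inj_on (incident_edges E) {v \<in> V. degree E v = 2}"
    using inj_incident by (rule inj_on_subset) auto
  ultimately show ?thesis by (simp add: num_deg_def card_image)
qed

section \<open>Colourings of the tree and of its blocks\<close>

lemma color_set_leaf: "incident_edges E v = {e} \<Longrightarrow> color_set E p v = {p e}"
  by (simp add: color_set_def)

lemma vdec_imp_good:
  assumes "vdec V E k p"
  shows "good blocks k p"
  unfolding good_def
proof (intro conjI ballI)
  have proper: "p \<in> E \<rightarrow> {1..k}" "\<And>e f. \<lbrakk>e \<in> E; f \<in> E; e \<noteq> f; e \<inter> f \<noteq> {}\<rbrakk> \<Longrightarrow> p e \<noteq> p f"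
    and dist: "\<And>u v. \<lbrakk>u \<in> V; v \<in> V; u \<noteq> v\<rbrakk> \<Longrightarrow> color_set E p u \<noteq> color_set E p v"
    using assms by (auto simp: vdec_def proper_edge_coloring_def)
  show "p ` \<Union>blocks \<subseteq> {1..k}" unfolding Union_blocks using proper(1) by blast
  show "inj_on p A" if A: "A \<in> blocks" for A
  proof (rule inj_onI)
    fix e f assume ef: "e \<in> A" "f \<in> A" "p e = p f"
    obtain v where "A = incident_edges E v" using A by (auto simp: blocks_def)
    then have "e \<in> E" "f \<in> E" "v \<in> e \<inter> f" using ef by (auto simp: incident_iff)
    then show "e = f" using proper(2)[of e f] ef(3) by blast
  qed
  show "inj_on (image p) blocks"
  proof (rule inj_onI)
    fix A B assume AB: "A \<in> blocks" "B \<in> blocks" "p ` A = p ` B"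
    then obtain u v where uv: "u \<in> V" "v \<in> V" "A = incident_edges E u" "B = incident_edges E v"
      by (auto simp: blocks_def inner_verts_def)
    then show "A = B" using dist[of u v] AB(3) by (auto simp: color_set_def)
  qed
  show "inj_on p (outer blocks)"
  proof (rule inj_onI)
    fix e f assume ef: "e \<in> outer blocks" "f \<in> outer blocks" "p e = p f"
    have leaf: "\<exists>v\<in>leaves. incident_edges E v = {e}" if "e \<in> outer blocks" for e
    proof -
      have e: "e \<in> E" "\<not> e \<subseteq> inner_verts" using that by (auto simp: outer_def Union_blocks inner_blocks)
      then obtain v where v: "v \<in> e" "v \<in> leaves"
        using edge_subset[OF graph e(1)] verts_split(1) by blast
      obtain g where g: "incident_edges E v = {g}" using leaf_edge[OF v(2)] .
      have "e \<in> incident_edges E v" using e v by (simp add: incident_iff)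
      then show ?thesis using g v(2) by auto
    qed
    obtain u where u: "u \<in> leaves" "incident_edges E u = {e}" using leaf[OF ef(1)] by blast
    obtain v where v: "v \<in> leaves" "incident_edges E v = {f}" using leaf[OF ef(2)] by blast
    have "u = v"
      using dist[of u v] u v ef(3) color_set_leaf[OF u(2)] color_set_leaf[OF v(2)] by (auto simp: leaves_def)
    then show "e = f" using u v by simp
  qed
qed

lemma good_imp_vdec:
  assumes good: "good blocks k p"
  shows "vdec V E k p"
  unfolding vdec_def proper_edge_coloring_def
proof (intro conjI ballI impI)
  show "p \<in> E \<rightarrow> {1..k}" using good Union_blocks by (auto simp: good_def image_subset_iff)
next
  fix e f assume ef: "e \<in> E" "f \<in> E" "e \<noteq> f \<and> e \<inter> f \<noteq> {}"
  then obtain v where v: "v \<in> e" "v \<in> f" by auto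
  then have sub: "{e, f} \<subseteq> incident_edges E v" using ef by (auto simp: incident_iff)
  have "card {e, f} \<le> degree E v"
    unfolding degree_def using finite_incident sub by (rule card_mono)
  moreover have "v \<in> V" using edge_subset[OF graph ef(1)] v by blast
  ultimately have "incident_edges E v \<in> blocks" using ef(3) by (auto simp: blocks_def inner_verts_def)
  then have "inj_on p (incident_edges E v)" using good by (simp add: good_def)
  then show "p e \<noteq> p f" using sub ef(3) by (auto dest: inj_onD)
next
  fix u v assume uv: "u \<in> V" "v \<in> V" "u \<noteq> v"
  have big: "card (color_set E p w) \<ge> 2" if "w \<in> inner_verts" for w
  proof -
    have "inj_on p (incident_edges E w)" using good that by (simp add: good_def blocks_def)
    then have "card (color_set E p w) = degree E w" by (simp add: color_set_def degree_def card_image)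
    then show ?thesis using that by (simp add: inner_verts_def)
  qed
  have small: "card (color_set E p w) = 1" if "w \<in> leaves" for w
    using leaf_edge[OF that] color_set_leaf by (metis is_singletonI is_singleton_altdef)
  consider "u \<in> inner_verts" "v \<in> inner_verts" | "u \<in> leaves" "v \<in> leaves"
    | "u \<in> inner_verts" "v \<in> leaves" | "u \<in> leaves" "v \<in> inner_verts"
    using uv verts_split(1) by auto
  then show "color_set E p u \<noteq> color_set E p v"
  proof cases
    case 1
    then have "incident_edges E u \<in> blocks" "incident_edges E v \<in> blocks" by (auto simp: blocks_def)
    moreover have "incident_edges E u \<noteq> incident_edges E v" using inj_incident uv by (auto dest: inj_onD)
    moreover have "inj_on (image p) blocks" using good by (simp add: good_def)
    ultimately show ?thesis unfolding color_set_def by (auto dest: inj_onD)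
  next
    case 2
    obtain e where e: "incident_edges E u = {e}" using leaf_edge[OF 2(1)] .
    obtain f where f: "incident_edges E v = {f}" using leaf_edge[OF 2(2)] .
    have "e \<noteq> f" using inj_onD[OF inj_incident _ uv(1,2)] uv(3) e f by auto
    have "e \<in> E" "u \<in> e" "f \<in> E" "v \<in> f" using e f incident_iff[of e u] incident_iff[of f v] by auto
    moreover have "u \<notin> inner_verts" "v \<notin> inner_verts" using 2 verts_split(2) by auto
    ultimately have "e \<in> outer blocks" "f \<in> outer blocks"
      by (auto simp: outer_def Union_blocks inner_blocks)
    then have "p e \<noteq> p f" using good \<open>e \<noteq> f\<close> by (auto simp: good_def dest: inj_onD)
    then show ?thesis using color_set_leaf[OF e] color_set_leaf[OF f] by simp
  next
    case 3
    then show ?thesis using big[of u] small[of v] by auto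
  next
    case 4
    then show ?thesis using big[of v] small[of u] by auto
  qed
qed

lemma vdec_iff_good: "vdec V E k p \<longleftrightarrow> good blocks k p"
  using vdec_imp_good good_imp_vdec by blast

lemma vdec_ge: "vdec V E k p \<Longrightarrow> card (outer blocks) \<le> k"
  using vdec_imp_good good_card_le by blast

lemma equitable_vdec_iff:
  "equitable_vdec V E k p \<longleftrightarrow> good blocks k p \<and>
    (\<forall>i\<in>{1..k}. \<forall>j\<in>{1..k}. card {e \<in> \<Union>blocks. p e = i} \<le> card {e \<in> \<Union>blocks. p e = j} + 1)"
  unfolding equitable_vdec_def vdec_iff_good color_class_def Union_blocks ..

lemma chi_eqI:
  assumes "equitable_vdec V E k p" and lower: "\<And>j q. vdec V E j q \<Longrightarrow> k \<le> j"
  shows "chi_es V E = chi_s V E"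
proof -
  have "vdec V E k p" using assms(1) by (simp add: equitable_vdec_def)
  then have "chi_s V E = k" unfolding chi_s_def using lower by (intro Least_equality) auto
  moreover have "chi_es V E = k"
    unfolding chi_es_def using assms by (intro Least_equality) (auto simp: equitable_vdec_def)
  ultimately show ?thesis by simp
qed

text \<open>For three blocks, all of size two would mean a path with two leaves and three vertices
  of degree two, which \<open>two\<close> excludes, so \<open>ex_good_three_blocks\<close> applies.
  With at most one inner edge there are at most L + 1 edges, and giving every edge its own colour
  suffices.\<close>

lemma ex_equitable_few_blocks:
  assumes card: "card blocks \<le> 3" and two: "num_deg V E 2 \<le> num_deg V E 1"
  shows "\<exists>k\<le>card (outer blocks) + 1. \<exists>p. equitable_vdec V E k p"
proof (cases "card blocks = 3")
  case True
  have "\<exists>A\<in>blocks. card A \<noteq> 2"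
  proof (rule ccontr)
    assume *: "\<not> ?thesis"
    then have "{A \<in> blocks. card A = 2} = blocks" by auto
    then have "3 \<le> card (outer blocks)" using two True unfolding num_deg_1 num_deg_2 by simp
    moreover have "(\<Sum>A\<in>blocks. card A - 2) = 0" using * by simp
    ultimately show False using sum_excess by simp
  qed
  then obtain p where p: "good blocks (card (outer blocks) + 1) p"
      "\<And>i. i \<in> {1..card (outer blocks) + 1} \<Longrightarrow> card {e \<in> \<Union>blocks. p e = i} \<in> {1, 2}"
    using ex_good_three_blocks[OF True] by blast
  have "card {e \<in> \<Union>blocks. p e = i} \<le> card {e \<in> \<Union>blocks. p e = j} + 1"
    if "i \<in> {1..card (outer blocks) + 1}" "j \<in> {1..card (outer blocks) + 1}" for i j
    using p(2)[OF that(1)] p(2)[OF that(2)] by fastforce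
  then show ?thesis using p(1) equitable_vdec_iff by blast
next
  case False
  then have "card (inner blocks) \<le> 1" using card card_blocks by linarith
  then have "card E \<le> card (outer blocks) + 1" using card_edges by linarith
  then show ?thesis using ex_equitable_vdec_tree[OF tree card_V] by blast
qed

text \<open>Any two inner edges share a block and so differ in colour; by \<open>card_class\<close>
  every colour class has size one or two.\<close>

lemma equitable_few_blocks:
  assumes "card blocks \<le> 3" and p: "vdec V E (card (outer blocks)) p"
  shows "equitable_vdec V E (card (outer blocks)) p"
proof -
  have good: "good blocks (card (outer blocks)) p" using p by (rule vdec_imp_good)
  have inj: "inj_on p (inner blocks)" using good assms(1) by (rule inj_inner_if_few_blocks)
  have le: "card {e \<in> inner blocks. p e = i} \<le> 1" for i
  proof -
    have "e = f" if "e \<in> {e \<in> inner blocks. p e = i}" "f \<in> {e \<in> inner blocks. p e = i}" for e f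
      using that inj by (auto dest: inj_onD)
    then show ?thesis using finite_inner by (simp add: card_le_Suc0_iff_eq)
  qed
  have "card {e \<in> \<Union>blocks. p e = i} \<le> card {e \<in> \<Union>blocks. p e = j} + 1"
    if ij: "i \<in> {1..card (outer blocks)}" "j \<in> {1..card (outer blocks)}" for i j
    unfolding card_class[OF good ij(1)] card_class[OF good ij(2)] using le[of i] by linarith
  then show ?thesis unfolding equitable_vdec_iff using good by blast
qed

lemma ex_equitable_many_blocks:
  assumes card: "4 \<le> card blocks" and two: "num_deg V E 2 \<le> num_deg V E 1"
    and size: "card E \<le> 2 * (num_deg V E 1 + 1)"
  shows "\<exists>p. equitable_vdec V E (card (outer blocks)) p"
proof -
  have excess: "card (inner blocks) \<le> card (outer blocks) + 2"
    using size unfolding num_deg_1 card_edges by simp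
  obtain p where p: "good blocks (card (outer blocks)) p"
    and le: "\<And>i j. \<lbrakk>i \<in> {1..card (outer blocks)}; j \<in> {1..card (outer blocks)}\<rbrakk> \<Longrightarrow>
       card {e \<in> inner blocks. p e = i} \<le> card {e \<in> inner blocks. p e = j} + 1"
    using ex_good_equitable[OF card excess two[unfolded num_deg_1 num_deg_2]] by blast
  have "card {e \<in> \<Union>blocks. p e = i} \<le> card {e \<in> \<Union>blocks. p e = j} + 1"
    if "i \<in> {1..card (outer blocks)}" "j \<in> {1..card (outer blocks)}" for i j
    using le[OF that] card_class[OF p that(1)] card_class[OF p that(2)] by linarith
  then show ?thesis using p equitable_vdec_iff by blast
qed

end

theorem theorem2:
  fixes V :: "'a set" and E :: "'a set set"
  assumes "is_tree V E"
    and "card V \<ge> 3"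
    and "num_deg V E 2 \<le> num_deg V E 1"
    and "card E \<le> 2 * (num_deg V E 1 + 1)"
  shows "chi_es V E = chi_s V E"
proof -
  interpret big_tree V E
    using assms by unfold_locales
  let ?L = "card (outer blocks)"
  have lower: "?L \<le> j" if "vdec V E j q" for j q using vdec_ge[OF that] .
  show ?thesis
  proof (cases "\<exists>p. equitable_vdec V E ?L p")
    case True
    then show ?thesis using chi_eqI lower by blast
  next
    case False
    have few: "card blocks \<le> 3"
    proof (rule ccontr)
      assume "\<not> card blocks \<le> 3"
      then have "4 \<le> card blocks" by simp
      then show False using ex_equitable_many_blocks assms(3,4) False by blast
    qed
    \<comment> \<open>With few blocks any such colouring would be equitable, so none exists at all
      and the lower bound rises to \<open>?L + 1\<close>.\<close>
    have no: "\<not> vdec V E ?L q" for q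
      using equitable_few_blocks[OF few] False by blast
    have lower': "?L + 1 \<le> j" if "vdec V E j q" for j q
      using lower[OF that] no that by (metis Suc_eq_plus1 Suc_leI le_neq_implies_less)
    obtain k p where k: "k \<le> ?L + 1" "equitable_vdec V E k p"
      using ex_equitable_few_blocks[OF few assms(3)] by blast
    have "k \<le> j" if "vdec V E j q" for j q
      using lower'[OF that] k(1) by linarith
    then show ?thesis by (rule chi_eqI[OF k(2)])
  qed
qed

end
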